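(* Let $q\ge 2$ be a prime power, let $g\in\mathbb{F}_q[x]$ with $\delta=\deg g\ge 1$, and let $n\ge 1$. Let $\widetilde{R}(n,g,q)$ be the number of (not necessarily monic) polynomials $f\in\mathbb{F}_q[x]$ of degree $n$ that can be written as $f=h+g^k$, where $h$ is a (not necessarily monic) irreducible polynomial of degree $n$ in $\mathbb{F}_q[x]$ and $k$ is a nonnegative integer, and put $\widetilde{r}(n,g,q)=\widetilde{R}(n,g,q)/((q-1)q^n)$. Then $$\frac{1+\delta/n}{\delta}\ \ge\ \widetilde{r}(n,g,q)\ >\ \frac{(1-2q^{-n/2})^2\,(1+\delta/n)^{-1}}{\delta+8\,\frac{q}{q-1}\left(1+e^\gamma\min\left\{5\sqrt{\delta/q},\ \frac{\log 6\delta}{\log q}\right\}\right)},$$ where $\gamma$ is Euler's constant.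
   Context: $\mathbb{F}_q$ denotes the finite field with $q$ elements. The bounds hold uniformly in $g$, $n\ge1$, $\delta\ge1$, $q\ge2$. *)

theory Defs
  imports "HOL-Analysis.Analysis" "HOL-Computational_Algebra.Polynomial_Factorial"
begin

definition Rtilde :: "nat \<Rightarrow> 'a::{finite,field} poly \<Rightarrow> nat" where
  "Rtilde n g = card {f :: 'a poly. degree f = n \<and>
      (\<exists>h k. irreducible h \<and> degree h = n \<and> f = h + g ^ k)}"

definition rtilde :: "nat \<Rightarrow> 'a::{finite,field} poly \<Rightarrow> real" where
  "rtilde n g = real (Rtilde n g) / ((real CARD('a) - 1) * real CARD('a) ^ n)"

end

theory Submission
  imports Defs
begin

text \<open>
  Let \<open>r f\<close> be the number of representations \<open>f = h + g\<^sup>k\<close> with \<open>h\<close> irreducible of degree \<open>n\<close> and \<open>k deg g < n\<close>.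
  The upper bound counts pairs \<open>(h, k)\<close>; the lower bound is Cauchy--Schwarz, \<open>(\<Sum>r)\<^sup>2 \<le> R \<Sum>r\<^sup>2\<close>.
  The off-diagonal part of \<open>\<Sum>r\<^sup>2\<close> counts \<open>h\<close> such that \<open>h\<close> and \<open>h + (g\<^sup>i - g\<^sup>j)\<close> are both irreducible. Selberg's
  sieve bounds it without error term by \<open>8q/(q-1) \<cdot> (q-1)q\<^sup>n/n\<^sup>2 \<cdot> \<Prod>(1 + 1/|P|)\<close> over the primes \<open>P\<close>
  dividing \<open>g\<^sup>i - g\<^sup>j\<close>. Expanding the product over sets \<open>T\<close> of primes and grouping by the least \<open>e\<close> such that
  \<open>T\<close> divides \<open>g (g\<^sup>e - 1)\<close>, as Romanov did, the average over \<open>i, j\<close> is at most \<open>\<Sum>\<^sub>T 1/(|T| e(T))\<close>. The sets with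
  \<open>e(T) \<le> x\<close> contribute at most a product over primes of bounded total degree, which an explicit
  Mertens estimate bounds, and partial summation over \<open>x\<close> gives the two terms of the minimum.
\<close>

section \<open>Polynomials over a finite field\<close>

text \<open>Every inequality has to hold for all \<open>q\<close>, \<open>n\<close> and degrees, so
  each main term must absorb its own error. Polynomials of degree below \<open>n\<close> are exactly
  equidistributed modulo any modulus of degree at most \<open>n\<close>; hence the sieve can be run
  in dual form, with orthogonal mean-zero functions in place of optimised weights, and loses
  nothing. The 8 comes from n^2/8 \<le> (N+1)(N+2)/2 with N = n div 2, and q/(q-1) is the zeta
  function of F_q[x] at 2, the product of 1/(1 - |P|^-2) with |P| = q^deg P. The obstacle in the
  Mertens step is that primes of one degree arrive in bulk, while 1 + e^\<gamma> log_q M must be a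
  bound for every real M \<ge> 2. It is checked only at M = 2 and at the powers of q, and carried in
  between because exp is convex and ln concave. The 6 bounds the exponential of a convergent sum of
  logarithms; the 5 leaves room when the summation is split near x = sqrt(q / deg g). Exponents with
  k deg g < n leave the degree of h + g^k at n, so the first moment is exact; the factor 1/(1 + deg
  g / n) of the lower bound then only has to supply strictness.\<close>

definition polys_below :: "nat \<Rightarrow> 'a::zero poly set" where
  "polys_below m = {p. \<forall>k\<ge>m. coeff p k = 0}"

text \<open>The coefficient form of \<open>polys_below\<close> is visibly closed under subtraction,
  and it is right at \<open>m = 0\<close> too, where only the zero polynomial qualifies although its
  degree is \<open>0\<close>.\<close>

lemma polys_below_iff: "p \<in> polys_below m \<longleftrightarrow> p = 0 \<or> degree p < m"
  unfolding polys_below_def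
  by (auto simp: coeff_eq_0) (metis leading_coeff_neq_0 linorder_not_less)

lemma polys_below_0 [simp]: "polys_below 0 = {0}"
  by (auto simp: polys_below_iff)

lemma polys_below_Suc:
  "polys_below (Suc m) = (\<lambda>(a, p). pCons a p) ` (UNIV \<times> polys_below m)"
proof (intro set_eqI iffI)
  fix p :: "'a poly" assume p: "p \<in> polys_below (Suc m)"
  obtain a r where "p = pCons a r" by (cases p) auto
  have "coeff r k = 0" if "m \<le> k" for k
  proof -
    have "coeff p (Suc k) = 0" using p that by (simp add: polys_below_def)
    then show ?thesis using \<open>p = pCons a r\<close> by simp
  qed
  then have "r \<in> polys_below m" by (simp add: polys_below_def)
  with \<open>p = pCons a r\<close> show "p \<in> (\<lambda>(a, p). pCons a p) ` (UNIV \<times> polys_below m)" by auto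
qed (auto simp: polys_below_def coeff_pCons split: nat.splits)

lemma finite_card_polys_below:
  "finite (polys_below m :: 'a::{finite,zero} poly set) \<and> card (polys_below m :: 'a poly set) = CARD('a) ^ m"
proof (induction m)
  case (Suc m)
  have "inj_on (\<lambda>(a, p). pCons a p) (UNIV \<times> (polys_below m :: 'a poly set))"
    by (auto simp: inj_on_def)
  with Suc show ?case
    by (auto simp: polys_below_Suc card_image card_cartesian_product)
qed auto

lemmas finite_polys_below [simp] = finite_card_polys_below [THEN conjunct1]
lemmas card_polys_below = finite_card_polys_below [THEN conjunct2]

lemma polys_below_diff: "p \<in> polys_below m \<Longrightarrow> r \<in> polys_below m \<Longrightarrow> p - r \<in> polys_below m"
  for p :: "'a::ab_group_add poly"
  by (auto simp: polys_below_def)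

lemma dvd_polys_below_imp_0:
  fixes p :: "'a::field poly"
  assumes "p \<in> polys_below (degree d)" "d dvd p"
  shows "p = 0"
  using assms by (auto simp: polys_below_iff dest: dvd_imp_degree_le)

lemma card_field_ge_2: "CARD('a::{finite,field}) \<ge> 2"
proof -
  have "card {0, 1::'a} \<le> CARD('a)" by (intro card_mono) auto
  then show ?thesis by simp
qed

definition monics :: "nat \<Rightarrow> 'a::comm_semiring_1 poly set" where
  "monics n = {p. degree p = n \<and> lead_coeff p = 1}"

text \<open>A fixed leading term turns these polynomials into a translate of
  \<open>polys_below n\<close>, the shape on which both counting and the sieve operate.\<close>

lemma degree_lead_eq_image:
  fixes c :: "'a::field"
  assumes "c \<noteq> 0"
  shows "{p. degree p = n \<and> lead_coeff p = c} = (\<lambda>r. monom c n + r) ` polys_below n"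
proof (intro set_eqI iffI)
  fix p assume p: "p \<in> {p. degree p = n \<and> lead_coeff p = c}"
  have "p - monom c n \<in> polys_below n"
    unfolding polys_below_def
  proof (clarify)
    fix k assume "n \<le> k"
    with p show "coeff (p - monom c n) k = 0"
      by (cases "k = n") (auto simp: coeff_eq_0)
  qed
  then show "p \<in> (\<lambda>r. monom c n + r) ` polys_below n"
    by (intro image_eqI[of _ _ "p - monom c n"]) auto
next
  fix p assume "p \<in> (\<lambda>r. monom c n + r) ` polys_below n"
  then obtain r where r: "p = monom c n + r" "r \<in> polys_below n" by auto
  then have cn: "coeff p n = c" by (auto simp: polys_below_def)
  have "degree p \<le> n"
    using r by (auto simp: polys_below_def coeff_monom intro!: degree_le)
  moreover have "n \<le> degree p" using cn assms by (intro le_degree) auto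
  ultimately show "p \<in> {p. degree p = n \<and> lead_coeff p = c}" using cn by auto
qed

lemma
  fixes c :: "'a::{finite,field}"
  assumes "c \<noteq> 0"
  shows finite_degree_lead_eq: "finite {p. degree p = n \<and> lead_coeff p = c}"
    and card_degree_lead_eq: "card {p. degree p = n \<and> lead_coeff p = c} = CARD('a) ^ n"
  by (auto simp: degree_lead_eq_image[OF assms] card_image card_polys_below)

lemma finite_monics [simp]: "finite (monics n :: 'a::{finite,field} poly set)"
  and card_monics: "card (monics n :: 'a::{finite,field} poly set) = CARD('a) ^ n"
  using finite_degree_lead_eq[of "1::'a" n] card_degree_lead_eq[of "1::'a" n]
  by (auto simp: monics_def)

lemma finite_degree_eq: "finite {p :: 'a::{finite,field} poly. degree p = n}"
  by (rule finite_subset[of _ "polys_below (Suc n)"]) (auto simp: polys_below_iff)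

subsection \<open>Monic irreducible polynomials\<close>

definition monic_irr :: "'a::field poly set" where
  "monic_irr = {P. lead_coeff P = 1 \<and> irreducible P}"

lemma monic_irr_nonzero [simp]: "P \<in> monic_irr \<Longrightarrow> P \<noteq> 0"
  by (auto simp: monic_irr_def)

lemma zero_not_monic_irr [simp]: "0 \<notin> monic_irr"
  by (simp add: monic_irr_def)

lemma monic_irr_degree_pos: "P \<in> monic_irr \<Longrightarrow> degree P > 0"
  using irreducible_not_unit[of P] is_unit_iff_degree[of P] by (auto simp: monic_irr_def)

lemma monic_irr_prime_elem: "P \<in> monic_irr \<Longrightarrow> prime_elem P"
  by (auto simp: monic_irr_def intro: field_poly_irreducible_imp_prime)

lemma monic_irr_dvd_mult_iff: "P \<in> monic_irr \<Longrightarrow> P dvd a * b \<longleftrightarrow> P dvd a \<or> P dvd b"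
  by (simp add: monic_irr_prime_elem prime_elem_dvd_mult_iff)

lemma monic_irr_not_dvd_1: "P \<in> monic_irr \<Longrightarrow> \<not> P dvd 1"
  using monic_irr_prime_elem[of P] by (auto simp: prime_elem_def)

lemma monic_irr_dvd_imp_eq:
  assumes "P \<in> monic_irr" "Q \<in> monic_irr" "P dvd Q"
  shows "P = Q"
proof -
  obtain c where c: "Q = P * c" using assms(3) by auto
  have "is_unit c"
    using assms c monic_irr_not_dvd_1[of P] irreducibleD[of Q P c] by (auto simp: monic_irr_def)
  moreover have "c \<noteq> 0" using c assms(2) monic_irr_nonzero[of Q] by auto
  ultimately have "degree c = 0" by (simp add: is_unit_iff_degree)
  then obtain a where a: "c = [:a:]" by (rule degree_eq_zeroE)
  moreover have "lead_coeff Q = lead_coeff P * lead_coeff c" using c by (simp only: lead_coeff_mult)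
  ultimately have "a = 1" using assms by (auto simp: monic_irr_def)
  with a c show ?thesis by simp
qed

lemma exists_monic_irr_dvd:
  fixes f :: "'a::field poly"
  assumes "degree f > 0"
  shows "\<exists>P\<in>monic_irr. P dvd f"
  using assms
proof (induction "degree f" arbitrary: f rule: less_induct)
  case less
  show ?case
  proof (cases "irreducible f")
    case True
    have "smult (inverse (lead_coeff f)) f \<in> monic_irr"
      using True less.prems irreducible_mult_unit_left[of "[:inverse (lead_coeff f):]" f]
      by (auto simp: monic_irr_def is_unit_iff_degree)
    moreover have "smult (inverse (lead_coeff f)) f dvd f"
      using less.prems by (subst smult_dvd_iff) auto
    ultimately show ?thesis by blast
  next
    case False
    have "f \<noteq> 0" using less.prems by auto
    then have "\<not> is_unit f" using less.prems by (simp add: is_unit_iff_degree)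
    with False \<open>f \<noteq> 0\<close> obtain a b where ab: "f = a * b" "\<not> is_unit a" "\<not> is_unit b"
      by (auto simp: irreducible_def)
    with \<open>f \<noteq> 0\<close> have "degree a > 0" "degree b > 0" "a \<noteq> 0" "b \<noteq> 0"
      by (auto simp: is_unit_iff_degree)
    then have "\<exists>P\<in>monic_irr. P dvd a" using ab(1)
      by (intro less.hyps) (auto simp: degree_mult_eq)
    then show ?thesis using ab(1) by (meson dvd_mult2)
  qed
qed

lemma finite_monic_irr_degree_le: "finite {P \<in> monic_irr :: 'a::{finite,field} poly set. degree P \<le> N}"
  by (rule finite_subset[of _ "polys_below (Suc N)"]) (auto simp: polys_below_iff)

section \<open>Prime divisors and squarefree products\<close>

definition prime_divs :: "'a::field poly \<Rightarrow> 'a poly set" where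
  "prime_divs f = {P \<in> monic_irr. P dvd f}"

lemma finite_prime_divs: "f \<noteq> 0 \<Longrightarrow> finite (prime_divs f)" for f :: "'a::{finite,field} poly"
  by (rule finite_subset[OF _ finite_monic_irr_degree_le[of "degree f"]])
     (auto simp: prime_divs_def dest: dvd_imp_degree_le)

lemma prime_divs_mult: "prime_divs (f * g) = prime_divs f \<union> prime_divs g"
  by (auto simp: prime_divs_def monic_irr_dvd_mult_iff)

lemma monic_irr_not_dvd_prod:
  assumes "finite U" "U \<subseteq> monic_irr" "P \<in> monic_irr" "P \<notin> U"
  shows "\<not> P dvd \<Prod>U"
  using assms
proof (induction rule: finite_induct)
  case (insert Q U)
  then show ?case using monic_irr_dvd_imp_eq[of P Q] by (auto simp: monic_irr_dvd_mult_iff)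
qed (auto dest: monic_irr_not_dvd_1)

lemma prod_monic_irr_dvd:
  assumes "finite U" "U \<subseteq> monic_irr" "\<And>P. P \<in> U \<Longrightarrow> P dvd f"
  shows "\<Prod>U dvd f"
  using assms
proof (induction rule: finite_induct)
  case (insert P U)
  then obtain c where c: "f = \<Prod>U * c" by (auto simp: dvd_def)
  have "P dvd \<Prod>U * c" using insert.prems c by auto
  moreover have "\<not> P dvd \<Prod>U" using insert by (intro monic_irr_not_dvd_prod) auto
  ultimately have "P dvd c" using insert.prems by (auto simp: monic_irr_dvd_mult_iff)
  then show ?case using insert.hyps c by (auto simp: mult.commute mult_dvd_mono)
qed auto

lemma degree_prod_monic_irr:
  assumes "finite U" "U \<subseteq> monic_irr"
  shows "degree (\<Prod>U) = (\<Sum>P\<in>U. degree P)"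
  using assms by (intro degree_prod_eq_sum_degree) (auto simp: subset_iff)

lemma sum_degree_le:
  assumes "finite U" "U \<subseteq> monic_irr" "\<And>P. P \<in> U \<Longrightarrow> P dvd f" "f \<noteq> 0"
  shows "(\<Sum>P\<in>U. degree P) \<le> degree f"
  using dvd_imp_degree_le[OF prod_monic_irr_dvd[OF assms(1-3)] assms(4)]
    degree_prod_monic_irr[OF assms(1,2)] by simp

subsection \<open>Independence of residues\<close>

text \<open>Division with remainder by \<open>D\<close>, read as a bijection. Because
  \<open>degree D \<le> m\<close>, only complete blocks of residues occur and there is no boundary
  term.\<close>

lemma sum_polys_below_split:
  fixes D :: "'a::{finite,field} poly" and F :: "'a poly \<Rightarrow> 'b::comm_monoid_add"
  assumes "D \<noteq> 0" "degree D \<le> m"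
  shows "(\<Sum>r\<in>polys_below m. F r) =
    (\<Sum>r\<in>polys_below (degree D). \<Sum>t\<in>polys_below (m - degree D). F (r + D * t))"
proof -
  have "(\<Sum>r\<in>polys_below m. F r) =
    (\<Sum>(r,t)\<in>polys_below (degree D) \<times> polys_below (m - degree D). F (r + D * t))"
  proof (intro sum.reindex_bij_witness[of _ "\<lambda>(r,t). r + D * t" "\<lambda>r. (r mod D, r div D)"])
    fix p :: "'a poly" assume p: "p \<in> polys_below m"
    show "(\<lambda>(r,t). r + D * t) (p mod D, p div D) = p" by simp
    have "p mod D \<in> polys_below (degree D)"
      using degree_mod_less[of D p] assms by (auto simp: polys_below_iff)
    moreover have "p div D \<in> polys_below (m - degree D)"
    proof (cases "p div D = 0")
      case False
      \<comment> \<open>The remainder has smaller degree than \<open>p div D * D\<close>, so adding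
        it cannot cancel the leading term.\<close>
      have "degree (p div D) + degree D \<le> degree p"
      proof (cases "p mod D = 0")
        case True
        then have "p = p div D * D" by (metis add.right_neutral div_mult_mod_eq)
        then have "degree p = degree (p div D * D)" by simp
        with False assms(1) show ?thesis by (simp add: degree_mult_eq)
      next
        case nz: False
        have "degree (p mod D) < degree D" using nz assms(1) by (intro degree_mod_less') auto
        also have "\<dots> \<le> degree (p div D * D)" using False assms(1) by (simp add: degree_mult_eq)
        finally have "degree (p div D * D + p mod D) = degree (p div D * D)" by (rule degree_add_eq_left)
        then show ?thesis using False assms(1) by (simp add: degree_mult_eq)
      qed
      moreover have "p \<noteq> 0" using False by auto
      ultimately show ?thesis using p by (auto simp: polys_below_iff)
    qed (simp add: polys_below_iff)
    ultimately show "(p mod D, p div D) \<in> polys_below (degree D) \<times> polys_below (m - degree D)" by simp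
  next
    fix x :: "'a poly \<times> 'a poly" assume x: "x \<in> polys_below (degree D) \<times> polys_below (m - degree D)"
    obtain r t where rt: "x = (r, t)" by fastforce
    with x have r: "r \<in> polys_below (degree D)" and t: "t \<in> polys_below (m - degree D)" by auto
    have r_div: "r div D = 0" using r by (auto simp: polys_below_iff div_poly_less)
    have r_mod: "r mod D = r" using r by (auto simp: polys_below_iff mod_poly_less)
    show "((case x of (r, t) \<Rightarrow> r + D * t) mod D, (case x of (r, t) \<Rightarrow> r + D * t) div D) = x"
      using assms r_div r_mod rt by auto
    have "r \<in> polys_below m" using r assms by (auto simp: polys_below_iff)
    moreover have "D * t \<in> polys_below m" using t assms
      by (cases "t = 0") (auto simp: polys_below_iff degree_mult_eq)
    ultimately show "(case x of (r, t) \<Rightarrow> r + D * t) \<in> polys_below m" using rt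
      by (auto simp: polys_below_def)
  qed auto
  then show ?thesis by (simp add: sum.cartesian_product)
qed

section \<open>Averages of periodic functions\<close>

definition periodic :: "'a::field poly \<Rightarrow> ('a poly \<Rightarrow> real) \<Rightarrow> bool" where
  "periodic P G \<longleftrightarrow> (\<forall>x y. P dvd x - y \<longrightarrow> G x = G y)"

text \<open>The mean over residues modulo \<open>P\<close>, for which
  \<open>polys_below (degree P)\<close> is a complete system of representatives.\<close>

definition average :: "'a::{finite,field} poly \<Rightarrow> ('a poly \<Rightarrow> real) \<Rightarrow> real" where
  "average P G = (\<Sum>r\<in>polys_below (degree P). G r) / real CARD('a) ^ degree P"

lemma periodicD: "periodic P G \<Longrightarrow> P dvd x - y \<Longrightarrow> G x = G y"
  unfolding periodic_def by blast

text \<open>As \<open>c\<close> is invertible modulo \<open>P\<close>, the affine map sending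
  \<open>t\<close> to \<open>b + c * t\<close> permutes the residues.\<close>

lemma sum_periodic_affine:
  fixes P :: "'a::{finite,field} poly"
  assumes P: "P \<in> monic_irr" and G: "periodic P G" and c: "\<not> P dvd c"
  shows "(\<Sum>t\<in>polys_below (degree P). G (b + c * t)) = (\<Sum>t\<in>polys_below (degree P). G t)"
proof -
  let ?A = "polys_below (degree P) :: 'a poly set" and ?h = "\<lambda>t. (b + c * t) mod P"
  have inj: "inj_on ?h ?A"
  proof (rule inj_onI)
    fix s t assume st: "s \<in> ?A" "t \<in> ?A" "?h s = ?h t"
    then have "P dvd (b + c * s) - (b + c * t)" by (simp add: mod_eq_dvd_iff)
    then have "P dvd c * (s - t)" by (simp add: algebra_simps)
    then have "P dvd s - t" using c P by (simp add: monic_irr_dvd_mult_iff)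
    then show "s = t" using dvd_polys_below_imp_0[OF polys_below_diff[OF st(1,2)]] by simp
  qed
  have "?h ` ?A \<subseteq> ?A"
    using degree_mod_less[of P] P by (force simp: polys_below_iff)
  then have "?h ` ?A = ?A" using inj by (intro card_subset_eq) (auto simp: card_image)
  then have "(\<Sum>t\<in>?A. G t) = (\<Sum>t\<in>?A. G (?h t))"
    using sum.reindex[OF inj, of G] by simp
  also have "\<dots> = (\<Sum>t\<in>?A. G (b + c * t))"
    by (intro sum.cong refl periodicD[OF G]) (simp add: mod_eq_dvd_iff[symmetric])
  finally show ?thesis by simp
qed

text \<open>The Chinese remainder theorem for averages: residues modulo distinct primes are
  independent, and exactly so on a translate of \<open>polys_below m\<close> once \<open>m\<close>
  reaches the total degree of the primes. A prime \<open>P\<close> is split off by writing the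
  argument as \<open>r + D * t\<close> with \<open>D = \<Prod>U\<close>.\<close>

lemma sum_prod_periodic:
  fixes U :: "'a::{finite,field} poly set"
  assumes "finite U" "U \<subseteq> monic_irr" "(\<Sum>P\<in>U. degree P) \<le> m" "\<And>P. P \<in> U \<Longrightarrow> periodic P (G P)"
  shows "(\<Sum>r\<in>polys_below m. \<Prod>P\<in>U. G P (b + r)) = real CARD('a) ^ m * (\<Prod>P\<in>U. average P (G P))"
  using assms
proof (induction arbitrary: m rule: finite_induct)
  case empty
  then show ?case by (simp add: card_polys_below)
next
  case (insert P U)
  define D where "D = \<Prod>U"
  define k where "k = m - degree D"
  let ?q = "real CARD('a)"
  have U: "U \<subseteq> monic_irr" and P: "P \<in> monic_irr" using insert.prems by auto
  have degD: "degree D = (\<Sum>Q\<in>U. degree Q)"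
    unfolding D_def using insert.hyps U by (intro degree_prod_monic_irr) auto
  have D0: "D \<noteq> 0" using insert.hyps U by (auto simp: D_def subset_iff)
  have PD: "\<not> P dvd D"
    unfolding D_def using insert.hyps U P by (intro monic_irr_not_dvd_prod) auto
  have m: "degree P + degree D \<le> m" using insert.prems insert.hyps degD by simp
  \<comment> \<open>For fixed \<open>r\<close> the factor at \<open>P\<close> sees an affine
    function of \<open>t\<close> whose slope \<open>D\<close> is invertible modulo \<open>P\<close>,
    so its mean does not depend on \<open>r\<close>.\<close>
  have inner: "(\<Sum>t\<in>polys_below k. G P (b + (r + D * t))) = ?q ^ k * average P (G P)" for r
  proof -
    have "(\<Sum>t\<in>polys_below k. G P (b + (r + D * t))) =
      (\<Sum>t\<in>polys_below (degree P). \<Sum>s\<in>polys_below (k - degree P). G P (b + (r + D * (t + P * s))))"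
      using P m by (intro sum_polys_below_split) (auto simp: k_def)
    also have "\<dots> = (\<Sum>t\<in>polys_below (degree P). \<Sum>s\<in>(polys_below (k - degree P) :: 'a poly set). G P ((b + r) + D * t))"
    proof (intro sum.cong refl)
      fix t s :: "'a poly"
      have "b + (r + D * (t + P * s)) - ((b + r) + D * t) = P * (D * s)" by (simp add: algebra_simps)
      then have "P dvd b + (r + D * (t + P * s)) - ((b + r) + D * t)" by (metis dvd_triv_left)
      then show "G P (b + (r + D * (t + P * s))) = G P ((b + r) + D * t)"
        using insert.prems(3)[of P] by (intro periodicD[of P]) auto
    qed
    also have "\<dots> = ?q ^ (k - degree P) * (\<Sum>t\<in>polys_below (degree P). G P ((b + r) + D * t))"
      by (simp add: card_polys_below sum_distrib_left)
    also have "(\<Sum>t\<in>polys_below (degree P). G P ((b + r) + D * t)) = (\<Sum>t\<in>polys_below (degree P). G P t)"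
      using insert.prems(3)[of P] P PD by (intro sum_periodic_affine) auto
    also have "?q ^ (k - degree P) * \<dots> = ?q ^ k * average P (G P)"
    proof -
      have "degree P \<le> k" using m by (simp add: k_def)
      then show ?thesis by (simp add: average_def power_diff)
    qed
    finally show ?thesis .
  qed
  \<comment> \<open>Every prime in \<open>U\<close> divides \<open>D\<close>, hence the factors over
    \<open>U\<close> do not see \<open>t\<close>.\<close>
  have outer: "(\<Prod>Q\<in>U. G Q (b + (r + D * t))) = (\<Prod>Q\<in>U. G Q (b + r))" for r t
  proof (intro prod.cong refl)
    fix Q assume Q: "Q \<in> U"
    have "b + (r + D * t) - (b + r) = D * t" by simp
    moreover have "Q dvd D" unfolding D_def using Q insert.hyps by (intro dvd_prodI) auto
    ultimately show "G Q (b + (r + D * t)) = G Q (b + r)"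
      using insert.prems(3)[of Q] Q by (intro periodicD[of Q]) auto
  qed
  have "(\<Sum>r\<in>polys_below m. \<Prod>Q\<in>insert P U. G Q (b + r)) =
    (\<Sum>r\<in>polys_below (degree D). \<Sum>t\<in>polys_below k. \<Prod>Q\<in>insert P U. G Q (b + (r + D * t)))"
    unfolding k_def using D0 m by (intro sum_polys_below_split) auto
  also have "\<dots> = (\<Sum>r\<in>polys_below (degree D). (\<Prod>Q\<in>U. G Q (b + r)) * (?q ^ k * average P (G P)))"
  proof (intro sum.cong refl)
    fix r
    have "(\<Sum>t\<in>polys_below k. \<Prod>Q\<in>insert P U. G Q (b + (r + D * t))) =
      (\<Sum>t\<in>polys_below k. G P (b + (r + D * t)) * (\<Prod>Q\<in>U. G Q (b + r)))"
      using insert.hyps by (simp add: outer)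
    then show "(\<Sum>t\<in>polys_below k. \<Prod>Q\<in>insert P U. G Q (b + (r + D * t))) =
      (\<Prod>Q\<in>U. G Q (b + r)) * (?q ^ k * average P (G P))"
      by (simp add: inner flip: sum_distrib_right)
  qed
  also have "\<dots> = (?q ^ degree D * (\<Prod>Q\<in>U. average Q (G Q))) * (?q ^ k * average P (G P))"
    using insert.prems insert.IH[of "degree D"] degD by (simp add: sum_distrib_right[symmetric])
  also have "\<dots> = ?q ^ m * (\<Prod>Q\<in>insert P U. average Q (G Q))"
    using insert.hyps m by (simp add: k_def power_add[symmetric] mult_ac)
  finally show ?case .
qed

section \<open>Counting irreducible polynomials\<close>

lemma monic_irr_power_dvd_mult_iff:
  assumes "P \<in> monic_irr" "\<not> P dvd a"
  shows "P ^ k dvd a * b \<longleftrightarrow> P ^ k dvd b"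
proof
  show "P ^ k dvd a * b \<Longrightarrow> P ^ k dvd b"
  proof (induction k)
    case (Suc k)
    then have "P ^ k dvd b" by (meson dvd_trans le_imp_power_dvd le_SucI order_refl)
    then obtain c where c: "b = P ^ k * c" by auto
    with Suc.prems have "P ^ k * P dvd P ^ k * (a * c)" by (simp add: mult_ac)
    then have "P dvd a * c" using assms by (subst (asm) dvd_mult_cancel_left) auto
    then have "P dvd c" using assms by (simp add: monic_irr_dvd_mult_iff)
    then show ?case using c by (simp add: mult.commute mult_dvd_mono)
  qed simp
qed simp

lemma degree_power_monic_irr:
  assumes P: "P \<in> monic_irr"
  shows "degree (P ^ k) = k * degree P" "lead_coeff (P ^ k) = 1"
proof -
  show "degree (P ^ k) = k * degree P" using P by (simp add: degree_power_eq)
  show "lead_coeff (P ^ k) = 1" using P unfolding lead_coeff_power by (simp add: monic_irr_def)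
qed

text \<open>The analogue of log = sum of the von Mangoldt function: the degree is the sum of
  \<open>degree P\<close> times the valuation at \<open>P\<close>, the valuation being counted as
  the number of \<open>k \<ge> 1\<close> with \<open>P ^ k\<close> dividing \<open>f\<close>. The
  common cutoff \<open>N\<close> keeps both sums finite and independent of \<open>f\<close>.\<close>

lemma sum_degree_power_dvd:
  fixes f :: "'a::{finite,field} poly"
  assumes "f \<noteq> 0" "degree f \<le> N"
  shows "(\<Sum>P | P \<in> monic_irr \<and> degree P \<le> N. degree P * (\<Sum>k=1..N. of_bool (P ^ k dvd f))) = degree f"
  using assms
proof (induction "degree f" arbitrary: f rule: less_induct)
  case less
  let ?B = "{P \<in> monic_irr :: 'a poly set. degree P \<le> N}"
  let ?mu = "\<lambda>P f. (\<Sum>k=1..N. of_bool (P ^ k dvd f)) :: nat"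
  show ?case
  proof (cases "degree f = 0")
    case True
    have "?mu P f = 0" if "P \<in> ?B" for P
    proof (intro sum.neutral ballI)
      fix k assume "k \<in> {1..N}"
      then have "degree (P ^ k) > 0"
        using that monic_irr_degree_pos[of P] by (simp add: degree_power_monic_irr)
      then show "of_bool (P ^ k dvd f) = (0::nat)"
        using dvd_imp_degree_le[of "P ^ k" f] True less.prems by auto
    qed
    with True show ?thesis by simp
  next
    case False
    then obtain Q where Q: "Q \<in> monic_irr" "Q dvd f" using exists_monic_irr_dvd[of f] by auto
    then obtain g where g: "f = Q * g" by auto
    with less.prems have g0: "g \<noteq> 0" and deg: "degree f = degree Q + degree g"
      by (auto simp: degree_mult_eq)
    have QB: "Q \<in> ?B" using Q deg less.prems by auto
    have degQ: "degree Q > 0" using Q monic_irr_degree_pos by auto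
    \<comment> \<open>Removing one factor \<open>Q\<close> lowers the valuation at \<open>Q\<close>
      by one and leaves the others alone.\<close>
    have "?mu P f = (if P = Q then 1 else 0) + ?mu P g" if "P \<in> ?B" for P
    proof (cases "P = Q")
      case True
      have N: "N > 0" using less.prems deg degQ by simp
      have "degree g < degree (Q ^ N)"
      proof -
        have "N * 1 \<le> N * degree Q" using degQ by (intro mult_le_mono2) auto
        then have "degree g < N * degree Q" using less.prems(2) deg degQ by linarith
        then show ?thesis using Q by (simp add: degree_power_monic_irr)
      qed
      \<comment> \<open>The index shift would lose the term \<open>k = N\<close> for
        \<open>g\<close>; for reasons of degree that term is zero.\<close>
      then have nd: "\<not> Q ^ N dvd g" using dvd_imp_degree_le[of "Q ^ N" g] g0 by auto
      have "?mu Q f = (\<Sum>k<N. of_bool (Q ^ Suc k dvd f))"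
        unfolding One_nat_def by (rule sum.atLeast1_atMost_eq)
      also have "\<dots> = (\<Sum>k<N. of_bool (Q ^ k dvd g))" using Q g by (simp del: sum_of_bool_eq)
      also have "\<dots> = (\<Sum>k\<le>N. of_bool (Q ^ k dvd g))"
        using nd by (simp del: sum_of_bool_eq flip: lessThan_Suc_atMost)
      also have "\<dots> = 1 + ?mu Q g"
        by (simp del: sum_of_bool_eq add: atMost_atLeast0 sum.atLeast_Suc_atMost)
      finally show ?thesis using True by simp
    next
      case False
      then have "\<not> P dvd Q" using that Q monic_irr_dvd_imp_eq[of P Q] by auto
      then show ?thesis using False that g by (simp del: sum_of_bool_eq add: monic_irr_power_dvd_mult_iff)
    qed
    then have "(\<Sum>P\<in>?B. degree P * ?mu P f) =
      (\<Sum>P\<in>?B. (if P = Q then degree P else 0) + degree P * ?mu P g)"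
      by (intro sum.cong refl) (auto simp: algebra_simps)
    also have "\<dots> = (\<Sum>P\<in>?B. if P = Q then degree P else 0) + (\<Sum>P\<in>?B. degree P * ?mu P g)"
      by (rule sum.distrib)
    also have "(\<Sum>P\<in>?B. if P = Q then degree P else 0) = degree Q"
      using QB finite_monic_irr_degree_le[of N] by (subst sum.delta) auto
    also have "(\<Sum>P\<in>?B. degree P * ?mu P g) = degree g"
      using g0 deg less.prems degQ by (intro less.hyps) auto
    finally show ?thesis using deg by simp
  qed
qed

lemma card_monics_dvd:
  fixes D :: "'a::{finite,field} poly"
  assumes "lead_coeff D = 1"
  shows "card {f \<in> monics n. D dvd f} = (if degree D \<le> n then CARD('a) ^ (n - degree D) else 0)"
proof (cases "degree D \<le> n")
  case True
  have D0: "D \<noteq> 0" using assms by auto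
  have "bij_betw (\<lambda>g. D * g) (monics (n - degree D)) {f \<in> monics n. D dvd f}"
    unfolding bij_betw_def
  proof
    show "inj_on (\<lambda>g. D * g) (monics (n - degree D))" using D0 by (auto simp: inj_on_def)
    show "(\<lambda>g. D * g) ` monics (n - degree D) = {f \<in> monics n. D dvd f}"
    proof (intro set_eqI iffI)
      fix f assume "f \<in> (\<lambda>g. D * g) ` monics (n - degree D)"
      then obtain g where g: "f = D * g" "degree g = n - degree D" "lead_coeff g = 1"
        unfolding image_iff monics_def mem_Collect_eq by blast
      then have "g \<noteq> 0" by auto
      then have "degree f = n" using D0 g True by (simp add: degree_mult_eq)
      moreover have "lead_coeff f = 1" by (simp only: g(1,3) lead_coeff_mult assms mult_1)
      ultimately show "f \<in> {f \<in> monics n. D dvd f}" using g by (simp add: monics_def)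
    next
      fix f assume "f \<in> {f \<in> monics n. D dvd f}"
      then obtain g where g: "f = D * g" and f: "degree f = n" "lead_coeff f = 1"
        by (auto simp: monics_def)
      then have "g \<noteq> 0" by auto
      then have "degree g = n - degree D" using D0 g f by (simp add: degree_mult_eq)
      moreover have "lead_coeff f = lead_coeff D * lead_coeff g" using g by (simp only: lead_coeff_mult)
      then have "lead_coeff g = 1" using f(2) assms by simp
      ultimately show "f \<in> (\<lambda>g. D * g) ` monics (n - degree D)" using g by (auto simp: monics_def)
    qed
  qed
  then show ?thesis using True bij_betw_same_card card_monics by metis
next
  case False
  have "f \<notin> monics n" if "D dvd f" for f
    using dvd_imp_degree_le[OF that] False by (cases "f = 0") (auto simp: monics_def)
  then show ?thesis using False by auto
qed

definition irr_count :: "'a::field itself \<Rightarrow> nat \<Rightarrow> nat" where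
  "irr_count _ n = card {P \<in> monic_irr :: 'a poly set. degree P = n}"

text \<open>The degrees of all monic polynomials of degree \<open>n\<close> are summed in two ways:
  directly, and over prime powers \<open>P ^ k\<close>, each of which divides
  \<open>q ^ (n - k * degree P)\<close> of them.\<close>

lemma sum_degree_monics:
  "n * CARD('a) ^ n = (\<Sum>m=1..n. (\<Sum>d | d dvd m. d * irr_count TYPE('a::{finite,field}) d) * CARD('a) ^ (n - m))"
proof -
  let ?B = "{P \<in> monic_irr :: 'a poly set. degree P \<le> n}"
  let ?q = "CARD('a)"
  have finB: "finite ?B" by (rule finite_monic_irr_degree_le)
  have cnt: "(\<Sum>f\<in>monics n. of_bool (P ^ k dvd f)) = (if k * degree P \<le> n then ?q ^ (n - k * degree P) else 0)"
    if "P \<in> ?B" for P :: "'a poly" and k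
  proof -
    have "monics n \<inter> {f. P ^ k dvd f} = {f \<in> monics n. P ^ k dvd f}" by auto
    then have "(\<Sum>f\<in>monics n. of_bool (P ^ k dvd f)) = card {f \<in> monics n. P ^ k dvd f}"
      by simp
    also have "\<dots> = (if degree (P ^ k) \<le> n then ?q ^ (n - degree (P ^ k)) else 0)"
      using that by (intro card_monics_dvd degree_power_monic_irr) auto
    finally show ?thesis using that by (simp only: degree_power_monic_irr mem_Collect_eq)
  qed
  have "n * ?q ^ n = (\<Sum>f\<in>(monics n :: 'a poly set). degree f)"
    by (simp add: monics_def card_monics[unfolded monics_def])
  also have "\<dots> = (\<Sum>f\<in>monics n. \<Sum>P\<in>?B. degree P * (\<Sum>k=1..n. of_bool (P ^ k dvd f)))"
  proof (intro sum.cong refl)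
    fix f :: "'a poly" assume "f \<in> monics n"
    then have "f \<noteq> 0" "degree f \<le> n" by (auto simp: monics_def)
    then show "degree f = (\<Sum>P\<in>?B. degree P * (\<Sum>k=1..n. of_bool (P ^ k dvd f)))"
      by (subst sum_degree_power_dvd) auto
  qed
  also have "\<dots> = (\<Sum>f\<in>monics n. \<Sum>P\<in>?B. \<Sum>k=1..n. degree P * of_bool (P ^ k dvd f))"
    by (intro sum.cong refl) (simp only: sum_distrib_left)
  also have "\<dots> = (\<Sum>P\<in>?B. \<Sum>f\<in>monics n. \<Sum>k=1..n. degree P * of_bool (P ^ k dvd f))"
    by (rule sum.swap)
  also have "\<dots> = (\<Sum>P\<in>?B. \<Sum>k=1..n. \<Sum>f\<in>monics n. degree P * of_bool (P ^ k dvd f))"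
    by (intro sum.cong refl sum.swap)
  also have "\<dots> = (\<Sum>P\<in>?B. \<Sum>k=1..n. degree P * (if k * degree P \<le> n then ?q ^ (n - k * degree P) else 0))"
    by (intro sum.cong refl) (simp only: cnt flip: sum_distrib_left)
  also have "\<dots> = (\<Sum>d\<in>{1..n}. \<Sum>P\<in>{P\<in>?B. degree P = d}.
      \<Sum>k=1..n. degree P * (if k * degree P \<le> n then ?q ^ (n - k * degree P) else 0))"
    by (intro sum.group[symmetric] finB) (auto dest: monic_irr_degree_pos simp: Suc_le_eq)
  also have "\<dots> = (\<Sum>d\<in>{1..n}. \<Sum>k=1..n. d * irr_count TYPE('a) d * (if k * d \<le> n then ?q ^ (n - k * d) else 0))"
  proof (intro sum.cong refl)
    fix d assume d: "d \<in> {1..n}"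
    then have eq: "{P\<in>?B. degree P = d} = {P\<in>monic_irr. degree P = d}" by auto
    show "(\<Sum>P\<in>{P\<in>?B. degree P = d}. \<Sum>k=1..n. degree P * (if k * degree P \<le> n then ?q ^ (n - k * degree P) else 0)) =
      (\<Sum>k=1..n. d * irr_count TYPE('a) d * (if k * d \<le> n then ?q ^ (n - k * d) else 0))"
    proof -
      have "(\<Sum>P\<in>{P\<in>?B. degree P = d}. \<Sum>k=1..n. degree P * (if k * degree P \<le> n then ?q ^ (n - k * degree P) else 0)) =
        (\<Sum>P\<in>{P\<in>monic_irr :: 'a poly set. degree P = d}. \<Sum>k=1..n. d * (if k * d \<le> n then ?q ^ (n - k * d) else 0))"
        unfolding eq by (intro sum.cong refl) (simp only: mem_Collect_eq)
      also have "\<dots> = irr_count TYPE('a) d * (\<Sum>k=1..n. d * (if k * d \<le> n then ?q ^ (n - k * d) else 0))"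
        by (simp only: sum_constant irr_count_def of_nat_id)
      also have "\<dots> = (\<Sum>k=1..n. d * irr_count TYPE('a) d * (if k * d \<le> n then ?q ^ (n - k * d) else 0))"
        unfolding sum_distrib_left by (intro sum.cong refl) (simp only: mult_ac)
      finally show ?thesis .
    qed
  qed
  also have "\<dots> = (\<Sum>(d,k)\<in>{1..n} \<times> {1..n}. d * irr_count TYPE('a) d * (if k * d \<le> n then ?q ^ (n - k * d) else 0))"
    by (simp add: sum.cartesian_product)
  also have "\<dots> = (\<Sum>(d,k)\<in>{(d,k). 1 \<le> d \<and> 1 \<le> k \<and> k * d \<le> n}. d * irr_count TYPE('a) d * ?q ^ (n - k * d))"
  proof (rule sum.mono_neutral_cong_right)
    show "{(d,k). 1 \<le> d \<and> 1 \<le> k \<and> k * d \<le> n} \<subseteq> {1..n} \<times> {1..n}"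
    proof clarify
      fix d k assume dk: "1 \<le> d" "1 \<le> k" "k * d \<le> n"
      then have "1 * d \<le> k * d" "k * 1 \<le> k * d" by (intro mult_le_mono; simp)+
      then have "d \<le> n" "k \<le> n" using dk(3) by linarith+
      with dk show "d \<in> {1..n} \<and> k \<in> {1..n}" by simp
    qed
  next
    show "\<forall>x\<in>{1..n} \<times> {1..n} - {(d,k). 1 \<le> d \<and> 1 \<le> k \<and> k * d \<le> n}.
      (case x of (d,k) \<Rightarrow> d * irr_count TYPE('a) d * (if k * d \<le> n then ?q ^ (n - k * d) else 0)) = 0"
      by (clarsimp split: if_splits)
  next
    fix x :: "nat \<times> nat" assume "x \<in> {(d,k). 1 \<le> d \<and> 1 \<le> k \<and> k * d \<le> n}"
    then show "(case x of (d,k) \<Rightarrow> d * irr_count TYPE('a) d * (if k * d \<le> n then ?q ^ (n - k * d) else 0)) =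
      (case x of (d,k) \<Rightarrow> d * irr_count TYPE('a) d * ?q ^ (n - k * d))"
      by clarsimp
  qed simp
  \<comment> \<open>Prime powers are regrouped by their degree \<open>m = k * d\<close>, which turns
    the condition on \<open>d\<close> into divisibility.\<close>
  also have "\<dots> = (\<Sum>(m,d)\<in>(SIGMA m:{1..n}. {d. d dvd m}). d * irr_count TYPE('a) d * ?q ^ (n - m))"
  proof (rule sum.reindex_bij_witness[of _ "\<lambda>(m,d). (d, m div d)" "\<lambda>(d,k). (k * d, d)"])
    fix x assume "x \<in> (SIGMA m:{1..n}. {d::nat. d dvd m})"
    then obtain m d where x: "x = (m, d)" "1 \<le> m" "m \<le> n" "d dvd m" by auto
    then have "1 \<le> d" "1 \<le> m div d"
      by (auto simp: Suc_le_eq div_greater_zero_iff dvd_imp_le intro!: Nat.gr0I)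
    with x show "(case x of (m, d) \<Rightarrow> (d, m div d)) \<in> {(d, k). 1 \<le> d \<and> 1 \<le> k \<and> k * d \<le> n}" by auto
  qed auto
  also have "\<dots> = (\<Sum>m=1..n. \<Sum>d | d dvd m. d * irr_count TYPE('a) d * ?q ^ (n - m))"
    by (subst sum.Sigma) auto
  finally show ?thesis by (simp add: sum_distrib_right)
qed

text \<open>Gauss's formula. The preceding identity is a convolution with powers of
  \<open>q\<close>; subtracting \<open>q\<close> times its instance at \<open>n - 1\<close> cancels
  every term except the one with \<open>m = n\<close>.\<close>

theorem sum_divisors_irr_count:
  assumes "n > 0"
  shows "(\<Sum>d | d dvd n. d * irr_count TYPE('a::{finite,field}) d) = CARD('a) ^ n"
proof -
  obtain k where n: "n = Suc k" using assms gr0_implies_Suc by blast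
  let ?q = "CARD('a)" and ?psi = "\<lambda>m. \<Sum>d | d dvd m. d * irr_count TYPE('a) d"
  have "n * ?q ^ n = (\<Sum>m=1..k. ?psi m * ?q ^ (Suc k - m)) + ?psi n"
    using sum_degree_monics[where 'a='a, of n] by (simp add: n)
  also have "(\<Sum>m=1..k. ?psi m * ?q ^ (Suc k - m)) = ?q * (\<Sum>m=1..k. ?psi m * ?q ^ (k - m))"
    unfolding sum_distrib_left by (intro sum.cong refl) (simp add: Suc_diff_le mult_ac)
  also have "\<dots> = k * ?q ^ n"
    using sum_degree_monics[where 'a='a, of k] by (simp add: n)
  finally show ?thesis by (simp add: n)
qed

lemma irr_count_upper:
  assumes "n > 0"
  shows "n * irr_count TYPE('a::{finite,field}) n \<le> CARD('a) ^ n"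
proof -
  have "n * irr_count TYPE('a) n \<le> (\<Sum>d | d dvd n. d * irr_count TYPE('a) d)"
    using assms by (intro member_le_sum) auto
  then show ?thesis using sum_divisors_irr_count[OF assms, where 'a='a] by simp
qed

lemma irr_count_1: "irr_count TYPE('a::{finite,field}) 1 = CARD('a)"
  using sum_divisors_irr_count[of 1, where 'a='a] by simp

text \<open>Proper divisors of \<open>n\<close> are at most \<open>n div 2\<close>, and their terms
  in Gauss's formula are bounded by a geometric sum, which stays below twice its last power because
  \<open>q \<ge> 2\<close>.\<close>

lemma irr_count_lower:
  assumes "n > 0"
  shows "CARD('a) ^ n < n * irr_count TYPE('a::{finite,field}) n + 2 * CARD('a) ^ (n div 2)"
proof -
  let ?q = "CARD('a)"
  have q: "?q \<ge> 2" by (rule card_field_ge_2)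
  have geo: "(\<Sum>d=1..h. ?q ^ d) < 2 * ?q ^ h" for h
  proof (induction h)
    case (Suc h)
    have "2 * ?q ^ h \<le> ?q * ?q ^ h" using q by (rule mult_le_mono1)
    moreover have "(\<Sum>d=1..Suc h. ?q ^ d) = (\<Sum>d=1..h. ?q ^ d) + ?q * ?q ^ h" by simp
    ultimately show ?case using Suc unfolding power_Suc by linarith
  qed simp
  have sub: "{d. d dvd n} - {n} \<subseteq> {1..n div 2}"
  proof
    fix d assume d: "d \<in> {d. d dvd n} - {n}"
    then obtain c where c: "n = d * c" by auto
    with d assms have "c \<noteq> 1" "c \<noteq> 0" "d \<noteq> 0" by auto
    then have "2 \<le> c" by linarith
    then have "d * 2 \<le> n" unfolding c by (rule mult_le_mono2)
    with \<open>d \<noteq> 0\<close> show "d \<in> {1..n div 2}" by auto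
  qed
  have "?q ^ n = n * irr_count TYPE('a) n + (\<Sum>d\<in>{d. d dvd n} - {n}. d * irr_count TYPE('a) d)"
    using assms by (subst sum_divisors_irr_count[OF assms, where 'a='a, symmetric], subst sum.remove[of _ n]) auto
  also have "(\<Sum>d\<in>{d. d dvd n} - {n}. d * irr_count TYPE('a) d) \<le> (\<Sum>d=1..n div 2. d * irr_count TYPE('a) d)"
    using sub by (intro sum_mono2) auto
  also have "\<dots> \<le> (\<Sum>d=1..n div 2. ?q ^ d)"
    by (intro sum_mono irr_count_upper) auto
  also have "\<dots> < 2 * ?q ^ (n div 2)" by (rule geo)
  finally show ?thesis by simp
qed

text \<open>The absolute value matters because the theorem squares this quantity, which is negative
  for \<open>n = 1\<close> and \<open>q < 4\<close>. For \<open>n = 1\<close> the right-hand side is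
  exactly 1; for \<open>n \<ge> 2\<close> the left-hand expression is nonnegative and the previous
  lemma applies.\<close>

lemma irr_count_bounds:
  fixes n :: nat
  assumes n: "n > 0"
  defines "q \<equiv> real CARD('a::{finite,field})"
  shows "\<bar>1 - 2 * q powr (- real n / 2)\<bar> \<le> real n * real (irr_count TYPE('a) n) / q ^ n"
    and "irr_count TYPE('a) n > 0"
proof -
  let ?N = "irr_count TYPE('a) n"
  have q: "q \<ge> 2" using card_field_ge_2[where 'a='a] by (simp add: q_def)
  have *: "\<bar>1 - 2 * q powr (- real n / 2)\<bar> \<le> real n * real ?N / q ^ n \<and> ?N > 0"
  proof (cases "n = 1")
    case True
    have "q powr (- 1/2) \<le> q powr 0" using q by (intro powr_mono) auto
    moreover have "q powr (-1/2) \<ge> 0" by simp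
    ultimately have "\<bar>1 - 2 * q powr (- 1/2)\<bar> \<le> 1" using q by (simp add: abs_le_iff)
    moreover have "real ?N = q" using True irr_count_1[where 'a='a] by (simp add: q_def)
    ultimately show ?thesis using True q by (auto intro!: Nat.gr0I)
  next
    case False
    have qn: "q ^ n = q powr (real n)" using q by (simp add: powr_realpow)
    have "real (CARD('a) ^ n) < real (n * ?N + 2 * CARD('a) ^ (n div 2))"
      using irr_count_lower[OF n, where 'a='a] by (simp only: of_nat_less_iff)
    then have "q ^ n < real n * real ?N + 2 * q ^ (n div 2)" by (simp add: q_def)
    also have "q ^ (n div 2) = q powr (real (n div 2))" using q by (simp add: powr_realpow)
    also have "\<dots> \<le> q powr (real n / 2)" using q by (intro powr_mono) auto
    finally have "q ^ n - 2 * q powr (real n / 2) < real n * real ?N" by simp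
    then have "(q ^ n - 2 * q powr (real n / 2)) / q ^ n < real n * real ?N / q ^ n"
      using q by (intro divide_strict_right_mono) auto
    moreover have "q powr (real n / 2) / q ^ n = q powr (- real n / 2)"
      unfolding qn by (simp flip: powr_diff)
    ultimately have lt: "1 - 2 * q powr (- real n / 2) < real n * real ?N / q ^ n"
      using q by (simp add: diff_divide_distrib)
    have "q powr (- real n / 2) \<le> q powr (-1)" using n False q by (intro powr_mono) auto
    also have "\<dots> \<le> 1 / 2" using q by (simp add: powr_minus field_simps)
    finally have ge: "0 \<le> 1 - 2 * q powr (- real n / 2)" by simp
    have "?N \<noteq> 0"
    proof
      assume "?N = 0"
      then show False using lt ge by simp
    qed
    with lt ge show ?thesis by auto
  qed
  then show "\<bar>1 - 2 * q powr (- real n / 2)\<bar> \<le> real n * real ?N / q ^ n" "?N > 0" by auto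
qed

section \<open>Selberg's sieve\<close>

text \<open>Selberg's denominator: the sum of a multiplicative function over squarefree products of
  primes from \<open>Q\<close> of degree at most \<open>N\<close>, each product encoded by its set
  of primes.\<close>

definition sieve_sum :: "('a::field poly \<Rightarrow> real) \<Rightarrow> 'a poly set \<Rightarrow> nat \<Rightarrow> real" where
  "sieve_sum h Q N = (\<Sum>T | T \<subseteq> Q \<and> (\<Sum>P\<in>T. degree P) \<le> N. \<Prod>P\<in>T. h P)"

lemma periodic_mult: "periodic P F \<Longrightarrow> periodic P G \<Longrightarrow> periodic P (\<lambda>x. F x * G x)"
  unfolding periodic_def by metis

text \<open>Duality instead of optimised weights. \<open>psi P\<close> is -1 on forbidden residues
  and \<open>h P\<close> elsewhere, so it has mean 0 and mean square \<open>h P\<close>. Products of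
  these functions over sets of degree at most \<open>N\<close> are orthogonal, since two such sets
  have total degree at most \<open>2 * N \<le> n\<close>. Their sum \<open>Phi\<close> equals
  \<open>L\<close> at every sifted point, while its squares add up to \<open>q ^ n * L\<close>;
  hence \<open>card S * L ^ 2\<close> is at most \<open>q ^ n * L\<close>.\<close>

lemma selberg_sieve:
  fixes forb :: "'a::{finite,field} poly \<Rightarrow> 'a poly \<Rightarrow> bool"
  defines "w \<equiv> \<lambda>P. real (card {r \<in> polys_below (degree P). forb P r})"
  defines "h \<equiv> \<lambda>P. w P / (real CARD('a) ^ degree P - w P)"
  assumes Q: "finite Q" "Q \<subseteq> monic_irr" and N: "2 * N \<le> n"
    and per: "\<And>P x y. P \<in> Q \<Longrightarrow> P dvd x - y \<Longrightarrow> forb P x \<longleftrightarrow> forb P y"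
    and less: "\<And>P. P \<in> Q \<Longrightarrow> w P < real CARD('a) ^ degree P"
    and S: "S \<subseteq> (\<lambda>r. b + r) ` polys_below n"
    and sifted: "\<And>x P. x \<in> S \<Longrightarrow> P \<in> Q \<Longrightarrow> \<not> forb P x"
  shows "real (card S) * sieve_sum h Q N \<le> real CARD('a) ^ n"
proof -
  let ?q = "real CARD('a)"
  define TT where "TT = {T. T \<subseteq> Q \<and> (\<Sum>P\<in>T. degree P) \<le> N}"
  define psi where "psi = (\<lambda>P x. if forb P x then -1 else h P)"
  define L where "L = sieve_sum h Q N"
  have finTT: "finite TT" using Q(1) by (auto simp: TT_def)
  have fin: "finite T" "T \<subseteq> Q" "T \<subseteq> monic_irr" "(\<Sum>P\<in>T. degree P) \<le> N" if "T \<in> TT" for T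
    using that Q by (auto simp: TT_def intro: finite_subset)
  have h_nonneg: "h P \<ge> 0" if "P \<in> Q" for P
    using less[OF that] by (auto simp: h_def w_def)
  have psi_per: "periodic P (psi P)" if "P \<in> Q" for P
    using per[OF that] by (auto simp: periodic_def psi_def)
  have card_split: "real (card {r \<in> polys_below (degree P). \<not> forb P r}) = ?q ^ degree P - w P" for P :: "'a poly"
  proof -
    have "card (polys_below (degree P) :: 'a poly set) =
      card {r \<in> polys_below (degree P). forb P r} + card {r \<in> polys_below (degree P). \<not> forb P r}"
      by (subst card_Un_disjoint[symmetric]) (auto intro!: arg_cong[where f=card])
    then show ?thesis by (simp add: w_def card_polys_below flip: of_nat_power)
  qed
  have avg: "average P (\<lambda>x. if forb P x then s else t) = (s * w P + t * (?q ^ degree P - w P)) / ?q ^ degree P"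
    for P :: "'a poly" and s t :: real
  proof -
    have "(\<Sum>r\<in>polys_below (degree P). if forb P r then s else t) =
      s * w P + t * (?q ^ degree P - w P)"
      by (subst sum.If_cases) (auto simp: w_def card_split[unfolded w_def] Int_def mult_ac)
    then show ?thesis by (simp add: average_def)
  qed
  have avg1: "average P (psi P) = 0" if "P \<in> Q" for P
    using less[OF that] unfolding psi_def avg by (simp add: h_def)
  have avg2: "average P (\<lambda>x. psi P x * psi P x) = h P" if "P \<in> Q" for P
  proof -
    have eq: "(\<lambda>x. psi P x * psi P x) = (\<lambda>x. if forb P x then 1 else h P * h P)"
      by (auto simp: psi_def)
    have "h P * (?q ^ degree P - w P) = w P" using less[OF that] by (simp add: h_def)
    then have "1 * w P + h P * h P * (?q ^ degree P - w P) = h P * ?q ^ degree P"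
      by (simp add: algebra_simps)
    then show ?thesis unfolding eq avg by simp
  qed
  have corr: "(\<Sum>r\<in>polys_below n. (\<Prod>P\<in>T. psi P (b + r)) * (\<Prod>P\<in>T'. psi P (b + r))) =
      (if T = T' then ?q ^ n * (\<Prod>P\<in>T. h P) else 0)" if T: "T \<in> TT" "T' \<in> TT" for T T'
  proof -
    \<comment> \<open>Padding with the constant 1 turns two products over different sets into one
      product over the union.\<close>
    define G where "G = (\<lambda>P x. (if P \<in> T then psi P x else 1) * (if P \<in> T' then psi P x else 1))"
    have "(\<Sum>P\<in>T \<union> T'. degree P) \<le> (\<Sum>P\<in>T. degree P) + (\<Sum>P\<in>T'. degree P)"
      using fin T by (simp add: sum_Un_nat)
    then have deg: "(\<Sum>P\<in>T \<union> T'. degree P) \<le> n" using fin(4)[OF T(1)] fin(4)[OF T(2)] N by linarith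
    have "(\<Prod>P\<in>T. psi P x) * (\<Prod>P\<in>T'. psi P x) = (\<Prod>P\<in>T \<union> T'. G P x)" for x
    proof -
      have 1: "(\<Prod>P\<in>T. psi P x) = (\<Prod>P\<in>T \<union> T'. if P \<in> T then psi P x else 1)"
        using fin T by (intro prod.mono_neutral_cong_left) auto
      have 2: "(\<Prod>P\<in>T'. psi P x) = (\<Prod>P\<in>T \<union> T'. if P \<in> T' then psi P x else 1)"
        using fin T by (intro prod.mono_neutral_cong_left) auto
      show ?thesis by (simp add: 1 2 prod.distrib[symmetric] G_def)
    qed
    then have "(\<Sum>r\<in>polys_below n. (\<Prod>P\<in>T. psi P (b + r)) * (\<Prod>P\<in>T'. psi P (b + r))) =
      (\<Sum>r\<in>polys_below n. \<Prod>P\<in>T \<union> T'. G P (b + r))" by simp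
    also have "\<dots> = ?q ^ n * (\<Prod>P\<in>T \<union> T'. average P (G P))"
    proof (rule sum_prod_periodic)
      fix P assume "P \<in> T \<union> T'"
      then have "P \<in> Q" using fin T by auto
      have "periodic P (\<lambda>x. if P \<in> T then psi P x else 1)" "periodic P (\<lambda>x. if P \<in> T' then psi P x else 1)"
        using psi_per[OF \<open>P \<in> Q\<close>] by (auto simp: periodic_def)
      then show "periodic P (G P)" unfolding G_def by (rule periodic_mult)
    qed (use fin T deg in auto)
    also have "\<dots> = (if T = T' then ?q ^ n * (\<Prod>P\<in>T. h P) else 0)"
    proof (cases "T = T'")
      case True
      have "(\<Prod>P\<in>T \<union> T'. average P (G P)) = (\<Prod>P\<in>T. h P)"
      proof (intro prod.cong)
        fix P assume "P \<in> T"
        then have "P \<in> Q" "G P = (\<lambda>x. psi P x * psi P x)" using True fin T by (auto simp: G_def)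
        then show "average P (G P) = h P" by (simp add: avg2)
      qed (use True in simp)
      with True show ?thesis by simp
    next
      case False
      \<comment> \<open>A prime lying in only one of the two sets contributes a mean-zero factor,
        which annihilates the whole correlation.\<close>
      then obtain P where P: "P \<in> T \<union> T'" "P \<in> T \<longleftrightarrow> P \<notin> T'" by blast
      then have "P \<in> Q" "G P = psi P" using fin T by (auto simp: G_def)
      then have "average P (G P) = 0" by (simp add: avg1)
      then have "(\<Prod>P\<in>T \<union> T'. average P (G P)) = 0"
        using P(1) fin T by (intro prod_zero) auto
      with False show ?thesis by simp
    qed
    finally show ?thesis .
  qed
  define Phi where "Phi = (\<lambda>x. \<Sum>T\<in>TT. \<Prod>P\<in>T. psi P x)"
  have L_eq: "L = (\<Sum>T\<in>TT. \<Prod>P\<in>T. h P)" by (simp add: L_def sieve_sum_def TT_def)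
  have Phi_S: "Phi x = L" if "x \<in> S" for x
    unfolding Phi_def L_eq
  proof (intro sum.cong prod.cong refl)
    fix T P assume "T \<in> TT" "P \<in> T"
    then show "psi P x = h P" using sifted[OF that, of P] fin(2)[of T] by (auto simp: psi_def)
  qed
  \<comment> \<open>The empty set contributes 1, so \<open>L\<close> is positive and can be
    cancelled at the end.\<close>
  have "(\<Prod>P\<in>{}. h P) \<le> L"
    unfolding L_eq
  proof (rule member_le_sum[OF _ _ finTT])
    fix T assume "T \<in> TT - {{}}"
    then show "0 \<le> (\<Prod>P\<in>T. h P)" using h_nonneg fin(2)[of T] by (intro prod_nonneg) auto
  qed (simp add: TT_def)
  then have L_pos: "L > 0" by simp
  have finA: "finite ((\<lambda>r. b + r) ` polys_below n)" by simp
  have "real (card S) * L ^ 2 = (\<Sum>x\<in>S. Phi x ^ 2)" by (simp add: Phi_S)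
  also have "\<dots> \<le> (\<Sum>x\<in>(\<lambda>r. b + r) ` polys_below n. Phi x ^ 2)"
    by (rule sum_mono2[OF finA S]) auto
  also have "\<dots> = (\<Sum>r\<in>polys_below n. Phi (b + r) ^ 2)"
    by (simp add: sum.reindex)
  also have "\<dots> = (\<Sum>r\<in>polys_below n. \<Sum>T\<in>TT. \<Sum>T'\<in>TT. (\<Prod>P\<in>T. psi P (b + r)) * (\<Prod>P\<in>T'. psi P (b + r)))"
    by (simp add: Phi_def power2_eq_square sum_product)
  also have "\<dots> = (\<Sum>T\<in>TT. \<Sum>r\<in>polys_below n. \<Sum>T'\<in>TT. (\<Prod>P\<in>T. psi P (b + r)) * (\<Prod>P\<in>T'. psi P (b + r)))"
    by (rule sum.swap)
  also have "\<dots> = (\<Sum>T\<in>TT. \<Sum>T'\<in>TT. \<Sum>r\<in>polys_below n. (\<Prod>P\<in>T. psi P (b + r)) * (\<Prod>P\<in>T'. psi P (b + r)))"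
    by (intro sum.cong refl sum.swap)
  also have "\<dots> = (\<Sum>T\<in>TT. \<Sum>T'\<in>TT. if T = T' then ?q ^ n * (\<Prod>P\<in>T. h P) else 0)"
    by (intro sum.cong refl corr)
  also have "\<dots> = ?q ^ n * L"
    using finTT by (simp add: L_eq sum_distrib_left)
  finally have "(real (card S) * L) * L \<le> ?q ^ n * L" by (simp add: power2_eq_square mult_ac)
  then show ?thesis using L_pos by (simp add: L_def)
qed

section \<open>Euler products over finite sets of primes\<close>

definition smooth :: "'a::field poly set \<Rightarrow> 'a poly set" where
  "smooth Q = {u. lead_coeff u = 1 \<and> prime_divs u \<subseteq> Q}"

text \<open>The coefficient of u^m in the Euler product of 1/(1 - (u/q)^(deg P)) over
  \<open>P\<close> in \<open>Q\<close>.\<close>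

definition smooth_density :: "'a::{finite,field} poly set \<Rightarrow> nat \<Rightarrow> real" where
  "smooth_density Q m = real (card {u \<in> smooth Q. degree u = m}) / real CARD('a) ^ m"

lemma smooth_eq_monics: "{u \<in> smooth Q. degree u = m} = {u \<in> monics m. prime_divs u \<subseteq> Q}"
  by (auto simp: smooth_def monics_def)

lemma finite_smooth_degree: "finite {u \<in> smooth Q. degree u = m}" for Q :: "'a::{finite,field} poly set"
  by (simp add: smooth_eq_monics)

lemma smooth_density_nonneg: "smooth_density Q m \<ge> 0"
  by (simp add: smooth_density_def)

lemma smooth_density_le_1: "smooth_density Q m \<le> 1" for Q :: "'a::{finite,field} poly set"
proof -
  have "card {u \<in> smooth Q. degree u = m} \<le> card (monics m :: 'a poly set)"
    unfolding smooth_eq_monics by (intro card_mono) auto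
  then show ?thesis by (simp add: smooth_density_def card_monics flip: of_nat_power)
qed

lemma smooth_density_eq_1:
  fixes Q :: "'a::{finite,field} poly set"
  assumes "{P \<in> monic_irr. degree P \<le> N} \<subseteq> Q" "m \<le> N"
  shows "smooth_density Q m = 1"
proof -
  have "{u \<in> monics m. prime_divs u \<subseteq> Q} = monics m"
  proof (intro equalityI subsetI)
    fix u :: "'a poly" assume u: "u \<in> monics m"
    then have "u \<noteq> 0" "degree u = m" by (auto simp: monics_def)
    then have "prime_divs u \<subseteq> Q"
      using assms dvd_imp_degree_le[of _ u] by (fastforce simp: prime_divs_def)
    with u show "u \<in> {u \<in> monics m. prime_divs u \<subseteq> Q}" by simp
  qed simp
  then show ?thesis by (simp add: smooth_density_def smooth_eq_monics card_monics)
qed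

lemma smooth_density_empty: "smooth_density {} m = (if m = 0 then 1 else 0)"
proof -
  have "{u \<in> smooth {}. degree u = m} = (if m = 0 then {1 :: 'a poly} else {})"
  proof -
    have "degree u = 0" if "prime_divs u = {}" for u :: "'a poly"
      using exists_monic_irr_dvd[of u] that by (auto simp: prime_divs_def)
    moreover have "u = 1" if "degree u = 0" "lead_coeff u = 1" for u :: "'a poly"
      using that by (auto elim!: degree_eq_zeroE)
    moreover have "prime_divs (1 :: 'a poly) = {}"
      by (auto simp: prime_divs_def dest: monic_irr_not_dvd_1)
    ultimately show ?thesis by (auto simp: smooth_def)
  qed
  then show ?thesis by (simp add: smooth_density_def)
qed

text \<open>Multiplication by one further Euler factor, as a recurrence for coefficients: a smooth
  polynomial either avoids \<open>P\<close> or is \<open>P\<close> times a smooth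
  polynomial.\<close>

lemma smooth_density_insert:
  fixes P :: "'a::{finite,field} poly"
  assumes P: "P \<in> monic_irr" "P \<notin> Q"
  shows "smooth_density (insert P Q) m = smooth_density Q m +
    (if degree P \<le> m then smooth_density (insert P Q) (m - degree P) / real CARD('a) ^ degree P else 0)"
proof -
  let ?A = "\<lambda>Q m. {u \<in> smooth Q. degree u = m}"
  have lead: "lead_coeff P = 1" using P by (simp add: monic_irr_def)
  have split: "?A (insert P Q) m = ?A Q m \<union> {u \<in> ?A (insert P Q) m. P dvd u}"
    using P by (auto simp: smooth_def prime_divs_def)
  have "card (?A (insert P Q) m) = card (?A Q m) + card {u \<in> ?A (insert P Q) m. P dvd u}"
  proof (subst (1) split, rule card_Un_disjoint)
    show "finite (?A Q m)" "finite {u \<in> ?A (insert P Q) m. P dvd u}"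
      using finite_smooth_degree[of Q m]
      by (auto intro: finite_subset[OF _ finite_smooth_degree[of "insert P Q" m]])
    show "?A Q m \<inter> {u \<in> ?A (insert P Q) m. P dvd u} = {}"
      using P by (auto simp: smooth_def prime_divs_def)
  qed
  also have "card {u \<in> ?A (insert P Q) m. P dvd u} =
    (if degree P \<le> m then card (?A (insert P Q) (m - degree P)) else 0)"
  proof (cases "degree P \<le> m")
    case True
    have "{u \<in> ?A (insert P Q) m. P dvd u} = (\<lambda>v. P * v) ` ?A (insert P Q) (m - degree P)"
    proof (intro equalityI subsetI)
      fix u assume u: "u \<in> {u \<in> ?A (insert P Q) m. P dvd u}"
      then obtain v where v: "u = P * v" by blast
      have lu: "lead_coeff u = lead_coeff P * lead_coeff v" unfolding v by (rule lead_coeff_mult)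
      then have "lead_coeff v = 1" using u lead by (simp add: smooth_def)
      then have "v \<noteq> 0" by auto
      then have "degree v = m - degree P" using u v P by (auto simp: degree_mult_eq)
      moreover have "v \<in> smooth (insert P Q)"
        using u v \<open>lead_coeff v = 1\<close> by (auto simp: smooth_def prime_divs_mult)
      ultimately show "u \<in> (\<lambda>v. P * v) ` ?A (insert P Q) (m - degree P)" using v by blast
    next
      fix u assume "u \<in> (\<lambda>v. P * v) ` ?A (insert P Q) (m - degree P)"
      then obtain v where v: "u = P * v" "v \<in> smooth (insert P Q)" "degree v = m - degree P" by auto
      have lv: "lead_coeff v = 1" using v by (simp add: smooth_def)
      then have "v \<noteq> 0" by auto
      then have "degree u = m" using v P True by (simp add: degree_mult_eq)
      moreover have "lead_coeff u = 1" using v(1) lead lv by (simp only: lead_coeff_mult mult_1)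
      moreover have "prime_divs P \<subseteq> {P}"
        using P monic_irr_dvd_imp_eq by (auto simp: prime_divs_def)
      ultimately show "u \<in> {u \<in> ?A (insert P Q) m. P dvd u}"
        using v by (auto simp: smooth_def prime_divs_mult)
    qed
    moreover have "inj_on (\<lambda>v. P * v) (?A (insert P Q) (m - degree P))"
      using P by (auto simp: inj_on_def)
    ultimately show ?thesis using True by (simp add: card_image)
  next
    case False
    have "\<not> P dvd u" if "u \<in> ?A (insert P Q) m" for u
      using that False dvd_imp_degree_le[of P u] by (cases "u = 0") (auto simp: smooth_def)
    then have "{u \<in> ?A (insert P Q) m. P dvd u} = {}" by blast
    then show ?thesis using False by (simp only: card.empty if_False)
  qed
  finally show ?thesis
    by (auto simp: smooth_density_def add_divide_distrib power_add[symmetric])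
qed

text \<open>The generating function of the densities evaluated at u = 1/q. Each density is at most
  1, so a geometric series, the full zeta value, dominates.\<close>

lemma prod_inverse_square_le:
  fixes Q :: "'a::{finite,field} poly set"
  assumes "finite Q" "Q \<subseteq> monic_irr"
  shows "(\<Prod>P\<in>Q. 1 / (1 - (1 / real CARD('a) ^ degree P)\<^sup>2)) \<le> real CARD('a) / (real CARD('a) - 1)"
proof -
  let ?q = "real CARD('a)"
  have q: "?q \<ge> 2" using card_field_ge_2[where 'a='a] by simp
  have geo: "(\<lambda>m. (1 / ?q) ^ m) sums (1 / (1 - 1 / ?q))"
    using q by (intro geometric_sums) auto
  have summable: "summable (\<lambda>m. smooth_density Q m * (1 / ?q) ^ m)" for Q :: "'a poly set"
  proof (rule summable_comparison_test'[OF sums_summable[OF geo]])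
    fix m
    show "norm (smooth_density Q m * (1 / ?q) ^ m) \<le> (1 / ?q) ^ m"
      using mult_right_mono[OF smooth_density_le_1[of Q m], of "(1 / ?q) ^ m"]
      by (simp add: smooth_density_nonneg)
  qed
  have "(\<Sum>m. smooth_density Q m * (1 / ?q) ^ m) = (\<Prod>P\<in>Q. 1 / (1 - (1 / ?q ^ degree P)\<^sup>2))"
    using assms
  proof (induction rule: finite_induct)
    case empty
    have "(\<Sum>m. smooth_density ({} :: 'a poly set) m * (1 / ?q) ^ m) = (\<Sum>m. if m = 0 then 1 else 0)"
      by (intro suminf_cong) (simp add: smooth_density_empty)
    also have "\<dots> = (1 :: real)" by (subst suminf_finite[of "{0}"]) auto
    finally show ?case by simp
  next
    case (insert P Q)
    let ?d = "degree P" and ?z = "1 / ?q ^ degree P"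
    let ?Y = "\<lambda>Q. (\<Sum>m. smooth_density Q m * (1 / ?q) ^ m)"
    \<comment> \<open>The part of the series that comes from multiples of \<open>P\<close>: the
      series of \<open>insert P Q\<close> itself, shifted by \<open>degree P\<close>.\<close>
    define g where "g = (\<lambda>m. if ?d \<le> m then ?z * smooth_density (insert P Q) (m - ?d) * (1 / ?q) ^ m else 0)"
    have "(\<lambda>m. ?z\<^sup>2 * (smooth_density (insert P Q) m * (1 / ?q) ^ m)) sums (?z\<^sup>2 * ?Y (insert P Q))"
      by (intro sums_mult summable_sums summable)
    moreover have "(\<lambda>m. g (m + ?d)) = (\<lambda>m. ?z\<^sup>2 * (smooth_density (insert P Q) m * (1 / ?q) ^ m))"
      by (auto simp: g_def power_add power2_eq_square power_divide fun_eq_iff)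
    ultimately have "(\<lambda>m. g (m + ?d)) sums (?z\<^sup>2 * ?Y (insert P Q))" by simp
    then have g: "g sums (?z\<^sup>2 * ?Y (insert P Q))"
      by (subst (asm) sums_zero_iff_shift) (auto simp: g_def)
    have "(\<lambda>m. smooth_density Q m * (1 / ?q) ^ m + g m) sums (?Y Q + ?z\<^sup>2 * ?Y (insert P Q))"
      by (intro sums_add g summable_sums summable)
    moreover have "(\<lambda>m. smooth_density Q m * (1 / ?q) ^ m + g m) =
        (\<lambda>m. smooth_density (insert P Q) m * (1 / ?q) ^ m)"
    proof
      fix m
      have "smooth_density (insert P Q) m = smooth_density Q m +
        (if ?d \<le> m then smooth_density (insert P Q) (m - ?d) / ?q ^ ?d else 0)"
        using insert.prems insert.hyps by (intro smooth_density_insert) auto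
      then show "smooth_density Q m * (1 / ?q) ^ m + g m = smooth_density (insert P Q) m * (1 / ?q) ^ m"
        by (auto simp: g_def algebra_simps)
    qed
    ultimately have eq: "?Y (insert P Q) = ?Y Q + ?z\<^sup>2 * ?Y (insert P Q)"
      by (simp add: sums_iff)
    have "?d > 0" using insert.prems monic_irr_degree_pos by auto
    then have "?z < 1" using q by (simp add: one_less_power)
    then have "?z\<^sup>2 < 1" using q by (simp add: power_less_one_iff)
    with eq have "?Y (insert P Q) = ?Y Q * (1 / (1 - ?z\<^sup>2))" by (simp add: field_simps)
    also have "?Y Q = (\<Prod>P\<in>Q. 1 / (1 - (1 / ?q ^ degree P)\<^sup>2))"
      using insert.prems by (intro insert.IH) auto
    finally show ?case using insert.hyps by simp
  qed
  moreover have "(\<Sum>m. smooth_density Q m * (1 / ?q) ^ m) \<le> (\<Sum>m. (1 / ?q) ^ m)"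
  proof (intro suminf_le summable sums_summable[OF geo])
    fix m show "smooth_density Q m * (1 / ?q) ^ m \<le> (1 / ?q) ^ m"
      using mult_right_mono[OF smooth_density_le_1[of Q m], of "(1 / ?q) ^ m"] by simp
  qed
  moreover have "(\<Sum>m. (1 / ?q) ^ m) = ?q / (?q - 1)"
    using geo q by (simp add: sums_iff field_simps)
  ultimately show ?thesis by simp
qed

subsection \<open>A lower bound for the sieve sum\<close>

text \<open>The coefficients of the Cauchy product of \<open>A\<close> and \<open>B\<close>, summed
  up to index \<open>N\<close>. For smooth densities this is the sum of 1/|u v| over pairs of smooth
  polynomials with deg(u v) \<le> N, a truncated divisor-function sum.\<close>

definition conv_sum :: "(nat \<Rightarrow> real) \<Rightarrow> (nat \<Rightarrow> real) \<Rightarrow> nat \<Rightarrow> real" where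
  "conv_sum A B N = (\<Sum>(i,j) | i + j \<le> N. A i * B j)"

lemma finite_pairs_le: "finite {(i,j). i + j \<le> (N::nat)}"
  by (rule finite_subset[of _ "{..N} \<times> {..N}"]) auto

lemma conv_sum_commute: "conv_sum A B N = conv_sum B A N"
  unfolding conv_sum_def
  by (rule sum.reindex_bij_witness[of _ prod.swap prod.swap]) (auto simp: mult.commute)

lemma conv_sum_mono:
  assumes "\<And>i. A i \<ge> 0" "\<And>i. B i \<ge> 0"
  shows "mono (conv_sum A B)"
  unfolding conv_sum_def using assms
  by (intro monoI sum_mono2 finite_pairs_le) auto

lemma conv_sum_nonneg:
  assumes "\<And>i. A i \<ge> 0" "\<And>i. B i \<ge> 0"
  shows "conv_sum A B N \<ge> 0"
  unfolding conv_sum_def using assms by (intro sum_nonneg) auto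

text \<open>An additional Euler factor in one argument acts on the truncated sum by the same
  recurrence as on the coefficients.\<close>

lemma conv_sum_rec:
  assumes "\<And>m. A' m = A m + (if d \<le> m then z * A' (m - d) else 0)"
  shows "conv_sum A' B N = conv_sum A B N + (if d \<le> N then z * conv_sum A' B (N - d) else 0)"
proof -
  have "conv_sum A' B N = (\<Sum>(i,j) | i + j \<le> N. A i * B j + (if d \<le> i then z * A' (i - d) * B j else 0))"
    unfolding conv_sum_def
  proof (intro sum.cong refl)
    fix x :: "nat \<times> nat"
    show "(case x of (i, j) \<Rightarrow> A' i * B j) =
      (case x of (i, j) \<Rightarrow> A i * B j + (if d \<le> i then z * A' (i - d) * B j else 0))"
      using assms[of "fst x"] by (auto simp: algebra_simps split: prod.splits)
  qed
  also have "\<dots> = conv_sum A B N + (\<Sum>(i,j) | i + j \<le> N. if d \<le> i then z * A' (i - d) * B j else 0)"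
    by (simp add: conv_sum_def sum.distrib case_prod_unfold)
  also have "(\<Sum>(i,j) | i + j \<le> N. if d \<le> i then z * A' (i - d) * B j else 0) =
    (\<Sum>(i,j) | i + j \<le> N \<and> d \<le> i. z * A' (i - d) * B j)"
    by (rule sum.mono_neutral_cong_right[OF finite_pairs_le]) (auto split: if_splits)
  also have "\<dots> = (if d \<le> N then z * conv_sum A' B (N - d) else 0)"
  proof (cases "d \<le> N")
    case True
    have "(\<Sum>(i,j) | i + j \<le> N \<and> d \<le> i. z * A' (i - d) * B j) =
      (\<Sum>(i,j) | i + j \<le> N - d. z * A' i * B j)"
      using True
      by (intro sum.reindex_bij_witness[of _ "\<lambda>(i,j). (i + d, j)" "\<lambda>(i,j). (i - d, j)"]) auto
    then show ?thesis using True
      by (simp add: conv_sum_def sum_distrib_left case_prod_unfold mult_ac)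
  next
    case False
    then have "{(i,j). i + j \<le> N \<and> d \<le> i} = {}" by auto
    then show ?thesis using False by (simp only: sum.empty if_False)
  qed
  finally show ?thesis .
qed

lemma conv_sum_1:
  assumes "\<And>m. m \<le> N \<Longrightarrow> A m = 1"
  shows "conv_sum A A N = real ((N + 1) * (N + 2)) / 2"
proof -
  have "conv_sum A A N = (\<Sum>(i,j) | i + j \<le> N. 1)"
    unfolding conv_sum_def by (intro sum.cong refl) (auto simp: assms)
  also have "{(i,j). i + j \<le> N} = (SIGMA i:{..N}. {..N - i})" by auto
  also have "(\<Sum>(i,j)\<in>(SIGMA i:{..N}. {..N - i}). (1::real)) = (\<Sum>i\<le>N. real (N - i + 1))"
    by (subst sum.Sigma[symmetric]) auto
  also have "\<dots> = (\<Sum>i\<le>N. real (i + 1))"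
    by (rule sum.reindex_bij_witness[of _ "\<lambda>i. N - i" "\<lambda>i. N - i"]) auto
  also have "\<dots> = real ((N + 1) * (N + 2)) / 2"
    by (induction N) (auto simp: field_simps)
  finally show ?thesis .
qed

text \<open>\<open>S\<close>, \<open>S'\<close> and \<open>S''\<close> model the convolution sum
  without a given prime, with it in one argument, and with it in both; \<open>z\<close> is the
  inverse norm of the prime and \<open>d\<close> its degree.\<close>

context
  fixes S S' S'' :: "nat \<Rightarrow> real" and z :: real and d :: nat
  assumes mono: "mono S" "mono S'" "mono S''" and nonneg: "\<And>N. S N \<ge> 0" "\<And>N. S' N \<ge> 0"
    and rec1: "\<And>N. S' N = S N + (if d \<le> N then z * S' (N - d) else 0)"
    and rec2: "\<And>N. S'' N = S' N + (if d \<le> N then z * S'' (N - d) else 0)"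
    and z: "z \<ge> 0" "z < 1" and d: "d > 0"
begin

text \<open>For a prime with one forbidden residue. One of the two Euler factors is replaced by its
  value 1/(1-z); in the other, monotonicity moves all shifts by 2d, 3d, ... to the shift by d, where
  the weights add up to z/(1-z).\<close>

lemma double_rec_le_1:
  "S'' N \<le> 1 / (1 - z) * (S N + (if d \<le> N then z / (1 - z) * S (N - d) else 0))"
proof -
  have *: "S' N \<le> S N + (if d \<le> N then z / (1 - z) * S (N - d) else 0)" for N
  proof (induction N rule: less_induct)
    case (less N)
    show ?case
    proof (cases "d \<le> N")
      case True
      have "S' (N - d) \<le> S (N - d) + z / (1 - z) * S (N - d)"
      proof -
        have "S' (N - d) \<le> S (N - d) + (if d \<le> N - d then z / (1 - z) * S (N - d - d) else 0)"
          using d True by (intro less.IH) auto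
        also have "\<dots> \<le> S (N - d) + z / (1 - z) * S (N - d)"
          using z nonneg(1) monoD[OF mono(1), of "N - d - d" "N - d"]
          by (auto intro!: mult_left_mono divide_right_mono)
        finally show ?thesis .
      qed
      also have "\<dots> = S (N - d) / (1 - z)" using z by (simp add: field_simps)
      finally have "z * S' (N - d) \<le> z * (S (N - d) / (1 - z))" using z by (intro mult_left_mono) auto
      then show ?thesis using rec1[of N] True by simp
    qed (use rec1[of N] in auto)
  qed
  have "S'' N \<le> S' N / (1 - z)" for N
  proof (induction N rule: less_induct)
    case (less N)
    show ?case
    proof (cases "d \<le> N")
      case True
      have "S'' (N - d) \<le> S' (N - d) / (1 - z)" using d True by (intro less.IH) auto
      also have "\<dots> \<le> S' N / (1 - z)"
        using z monoD[OF mono(2), of "N - d" N] by (intro divide_right_mono) auto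
      finally have "z * S'' (N - d) \<le> z * (S' N / (1 - z))" using z by (intro mult_left_mono) auto
      then have "S'' N \<le> S' N + z * (S' N / (1 - z))" using rec2[of N] True by simp
      also have "\<dots> = S' N / (1 - z)" using z by (simp add: field_simps)
      finally show ?thesis .
    next
      case False
      have "S' N * (1 - z) \<le> S' N * 1" using nonneg(2) z by (intro mult_left_mono) auto
      then show ?thesis using rec2[of N] False z by (simp add: field_simps)
    qed
  qed
  also have "S' N / (1 - z) \<le> (S N + (if d \<le> N then z / (1 - z) * S (N - d) else 0)) / (1 - z)"
    using * z by (intro divide_right_mono) auto
  finally show ?thesis by simp
qed

text \<open>For a prime with two forbidden residues. Two Euler factors have the coefficients (k+1)
  z^k \<le> (2z)^k; collapsing all positive shifts to the first gives the weight 2z/(1-2z).\<close>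

lemma double_rec_le_2:
  assumes z2: "2 * z < 1"
  shows "S'' N \<le> S N + (if d \<le> N then 2 * z / (1 - 2 * z) * S (N - d) else 0)"
proof (induction N rule: less_induct)
  case (less N)
  show ?case
  proof (cases "d \<le> N")
    case True
    have nonneg'': "S'' N \<ge> 0" for N
    proof (induction N rule: less_induct)
      case (less N)
      then show ?case using rec2[of N] nonneg(2)[of N] z d by (cases "d \<le> N") auto
    qed
    have "S' (N - d) \<le> S'' (N - d)" using rec2[of "N - d"] z nonneg'' by auto
    then have "z * S' (N - d) \<le> z * S'' (N - d)" using z by (intro mult_left_mono) auto
    then have "S'' N \<le> S N + 2 * z * S'' (N - d)" using rec1[of N] rec2[of N] True by simp
    also have "S'' (N - d) \<le> S (N - d) + (if d \<le> N - d then 2 * z / (1 - 2 * z) * S (N - d - d) else 0)"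
      using d True by (intro less.IH) auto
    also have "\<dots> \<le> S (N - d) + 2 * z / (1 - 2 * z) * S (N - d)"
      using z z2 nonneg(1) monoD[OF mono(1), of "N - d - d" "N - d"]
      by (auto intro!: mult_left_mono divide_right_mono)
    also have "\<dots> = S (N - d) / (1 - 2 * z)" using z2 by (simp add: field_simps)
    finally show ?thesis using True z by (simp add: mult_left_mono)
  next
    case False
    then show ?thesis using rec1[of N] rec2[of N] by simp
  qed
qed

end

lemma sieve_sum_insert:
  assumes "finite Q" "P \<notin> Q"
  shows "sieve_sum h (insert P Q) N = sieve_sum h Q N +
    (if degree P \<le> N then h P * sieve_sum h Q (N - degree P) else 0)"
proof -
  let ?A = "\<lambda>Q N. {T. T \<subseteq> Q \<and> (\<Sum>P\<in>T. degree P) \<le> N}"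
  let ?B = "{T. T \<subseteq> Q \<and> degree P + (\<Sum>P\<in>T. degree P) \<le> N}"
  have fin: "finite (?A Q N)" for N using assms by simp
  have finT: "finite T" if "T \<subseteq> Q" for T using that assms finite_subset by blast
  have sum_ins: "(\<Sum>P\<in>insert P T. degree P) = degree P + (\<Sum>P\<in>T. degree P)" if "T \<subseteq> Q" for T
    using that finT assms by (subst sum.insert) auto
  have split: "?A (insert P Q) N = ?A Q N \<union> insert P ` ?B"
  proof (intro equalityI subsetI)
    fix T assume T: "T \<in> ?A (insert P Q) N"
    show "T \<in> ?A Q N \<union> insert P ` ?B"
    proof (cases "P \<in> T")
      case True
      have sub: "T - {P} \<subseteq> Q" and eq: "T = insert P (T - {P})" using T True by auto
      have "degree P + (\<Sum>P\<in>T - {P}. degree P) \<le> N"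
        using T sum_ins[OF sub] eq by simp
      with sub have "T - {P} \<in> ?B" by simp
      with eq show ?thesis by blast
    qed (use T in auto)
  next
    fix T assume "T \<in> ?A Q N \<union> insert P ` ?B"
    then show "T \<in> ?A (insert P Q) N" using sum_ins by auto
  qed
  have "sieve_sum h (insert P Q) N = (\<Sum>T\<in>?A Q N. \<Prod>P\<in>T. h P) + (\<Sum>T\<in>insert P ` ?B. \<Prod>P\<in>T. h P)"
    unfolding sieve_sum_def split
    using assms by (intro sum.union_disjoint fin) auto
  also have "(\<Sum>T\<in>insert P ` ?B. \<Prod>P\<in>T. h P) = (\<Sum>T\<in>?B. \<Prod>P\<in>insert P T. h P)"
    using assms(2) by (intro sum.reindex[unfolded o_def] inj_onI) (auto simp: insert_ident)
  also have "\<dots> = (\<Sum>T\<in>?B. h P * (\<Prod>P\<in>T. h P))"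
    using finT assms by (intro sum.cong refl prod.insert) auto
  also have "\<dots> = (if degree P \<le> N then h P * sieve_sum h Q (N - degree P) else 0)"
  proof (cases "degree P \<le> N")
    case True
    then have "?B = ?A Q (N - degree P)" by auto
    then have "(\<Sum>T\<in>?B. h P * (\<Prod>P\<in>T. h P)) = h P * sieve_sum h Q (N - degree P)"
      by (simp only: sieve_sum_def sum_distrib_left)
    then show ?thesis using True by (simp only: if_True)
  next
    case False
    then have "?B = {}" by auto
    then show ?thesis using False by (simp only: sum.empty if_False)
  qed
  finally show ?thesis by (simp add: sieve_sum_def)
qed

text \<open>\<open>h\<close> is w/(|P| - w) with w = 1 on \<open>D\<close> and w = 2 elsewhere, the
  local weight for sifting two residue classes that coincide for the primes in \<open>D\<close>. The
  comparison is made one prime at a time, and only the primes in \<open>D\<close> cost a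
  constant.\<close>

lemma conv_sum_le_sieve_sum:
  fixes Q D :: "'a::{finite,field} poly set"
  defines "z \<equiv> \<lambda>P :: 'a poly. 1 / real CARD('a) ^ degree P"
  assumes "finite Q" "Q \<subseteq> monic_irr" "\<And>P. P \<in> Q - D \<Longrightarrow> 2 * z P < 1"
  defines "h \<equiv> \<lambda>P. if P \<in> D then z P / (1 - z P) else 2 * z P / (1 - 2 * z P)"
  shows "conv_sum (smooth_density Q) (smooth_density Q) N \<le>
    (\<Prod>P\<in>Q \<inter> D. 1 / (1 - z P)) * sieve_sum h Q N"
  using assms(2,3,4)
proof (induction arbitrary: N rule: finite_induct)
  case empty
  have "conv_sum (smooth_density ({} :: 'a poly set)) (smooth_density ({} :: 'a poly set)) N =
    (\<Sum>(i,j) | i + j \<le> N. if (i, j) = (0, 0) then 1 else 0)"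
    unfolding conv_sum_def by (intro sum.cong refl) (auto simp: smooth_density_empty)
  also have "\<dots> = (\<Sum>x | fst x + snd x \<le> N. if x = (0, 0) then 1 else 0)"
    by (intro sum.cong) (auto split: if_splits)
  also have "\<dots> = 1"
    using finite_pairs_le[of N] by (subst sum.delta) (auto simp: case_prod_unfold)
  also have "1 = sieve_sum h {} N"
  proof -
    have "{T :: 'a poly set. T \<subseteq> {} \<and> (\<Sum>P\<in>T. degree P) \<le> N} = {{}}" by auto
    then show ?thesis by (simp add: sieve_sum_def)
  qed
  finally show ?case by simp
next
  case (insert P Q)
  let ?c = "\<Prod>P\<in>Q \<inter> D. 1 / (1 - z P)" and ?A = "smooth_density Q" and ?A' = "smooth_density (insert P Q)"
  let ?d = "degree P"
  have q: "real CARD('a) \<ge> 2" using card_field_ge_2[where 'a='a] by simp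
  have P: "P \<in> monic_irr" using insert.prems by auto
  have d: "?d > 0" using P monic_irr_degree_pos by auto
  have z: "z P \<ge> 0" "z P < 1" using q d by (auto simp: z_def one_less_power)
  have IH: "conv_sum ?A ?A N \<le> ?c * sieve_sum h Q N" for N
    using insert.prems by (intro insert.IH) auto
  have rec: "?A' m = ?A m + (if ?d \<le> m then z P * ?A' (m - ?d) else 0)" for m
    using smooth_density_insert[OF P insert.hyps(2), of m] by (simp add: z_def)
  have rec1: "conv_sum ?A' ?A N = conv_sum ?A ?A N + (if ?d \<le> N then z P * conv_sum ?A' ?A (N - ?d) else 0)" for N
    by (rule conv_sum_rec[OF rec])
  have rec2: "conv_sum ?A' ?A' N = conv_sum ?A' ?A N + (if ?d \<le> N then z P * conv_sum ?A' ?A' (N - ?d) else 0)" for N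
    using conv_sum_rec[OF rec, of ?A' N] by (simp add: conv_sum_commute[of ?A])
  note facts = conv_sum_mono[OF smooth_density_nonneg smooth_density_nonneg]
    conv_sum_mono[OF smooth_density_nonneg smooth_density_nonneg]
    conv_sum_mono[OF smooth_density_nonneg smooth_density_nonneg]
    conv_sum_nonneg[OF smooth_density_nonneg smooth_density_nonneg]
    conv_sum_nonneg[OF smooth_density_nonneg smooth_density_nonneg] rec1 rec2 z d
  show ?case
  proof (cases "P \<in> D")
    case True
    have hP: "h P = z P / (1 - z P)" using True by (simp add: h_def)
    have "conv_sum ?A' ?A' N \<le> 1 / (1 - z P) * (conv_sum ?A ?A N + (if ?d \<le> N then h P * conv_sum ?A ?A (N - ?d) else 0))"
      unfolding hP by (rule double_rec_le_1[OF facts])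
    also have "\<dots> \<le> 1 / (1 - z P) * (?c * sieve_sum h Q N + (if ?d \<le> N then h P * (?c * sieve_sum h Q (N - ?d)) else 0))"
      using z IH by (auto simp: hP intro!: mult_left_mono divide_right_mono add_mono)
    also have "\<dots> = (1 / (1 - z P) * ?c) * sieve_sum h (insert P Q) N"
      using insert.hyps by (simp add: sieve_sum_insert algebra_simps)
    also have "1 / (1 - z P) * ?c = (\<Prod>P\<in>insert P Q \<inter> D. 1 / (1 - z P))"
      using True insert.hyps by simp
    finally show ?thesis .
  next
    case False
    have hP: "h P = 2 * z P / (1 - 2 * z P)" using False by (simp add: h_def)
    have z2: "2 * z P < 1" using insert.prems(2)[of P] False by simp
    have "conv_sum ?A' ?A' N \<le> conv_sum ?A ?A N + (if ?d \<le> N then h P * conv_sum ?A ?A (N - ?d) else 0)"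
      unfolding hP by (rule double_rec_le_2[OF facts z2])
    also have "\<dots> \<le> ?c * sieve_sum h Q N + (if ?d \<le> N then h P * (?c * sieve_sum h Q (N - ?d)) else 0)"
      using z z2 IH by (auto simp: hP intro!: mult_left_mono divide_right_mono add_mono)
    also have "\<dots> = ?c * sieve_sum h (insert P Q) N"
      using insert.hyps by (simp add: sieve_sum_insert algebra_simps)
    finally show ?thesis unfolding Int_insert_left_if0[OF False] .
  qed
qed

section \<open>From the sieve to pairs of irreducible polynomials\<close>

lemma irreducible_not_dvd_small:
  fixes h :: "'a::field poly"
  assumes "irreducible h" "P \<in> monic_irr" "degree P < degree h"
  shows "\<not> P dvd h"
proof
  assume "P dvd h"
  then obtain c where c: "h = P * c" by auto
  have "h \<noteq> 0" using assms(1) by auto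
  then have "c \<noteq> 0" using c by auto
  have "is_unit c"
    using irreducibleD[OF assms(1) c] monic_irr_not_dvd_1[OF assms(2)] by auto
  then have "degree c = 0" using \<open>c \<noteq> 0\<close> by (simp add: is_unit_iff_degree)
  then show False using c assms \<open>c \<noteq> 0\<close> by (simp add: degree_mult_eq)
qed

lemma sieve_sum_cong:
  assumes "\<And>P. P \<in> Q \<Longrightarrow> h P = h' P"
  shows "sieve_sum h Q N = sieve_sum h' Q N"
  unfolding sieve_sum_def using assms by (intro sum.cong prod.cong refl) auto

text \<open>1/(1-z) = (1+z)/(1-z^2), and the product of the 1/(1-z^2) is bounded by the zeta value
  at 2. The remaining product of 1+z expands over sets of primes, as the averaging needs.\<close>

lemma prod_inverse_one_minus_norm_le:
  fixes Q :: "'a::{finite,field} poly set"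
  defines "z \<equiv> \<lambda>P :: 'a poly. 1 / real CARD('a) ^ degree P"
  assumes "finite Q" "Q \<subseteq> monic_irr"
  shows "(\<Prod>P\<in>Q. 1 / (1 - z P)) \<le> real CARD('a) / (real CARD('a) - 1) * (\<Prod>P\<in>Q. 1 + z P)"
proof -
  have q: "real CARD('a) \<ge> 2" using card_field_ge_2[where 'a='a] by simp
  have z: "0 \<le> z P" "z P < 1" if "P \<in> Q" for P
    using q monic_irr_degree_pos[of P] that assms(3) by (auto simp: z_def one_less_power)
  have "(\<Prod>P\<in>Q. 1 / (1 - z P)) = (\<Prod>P\<in>Q. 1 / (1 - (z P)\<^sup>2) * (1 + z P))"
  proof (intro prod.cong refl)
    fix P assume P: "P \<in> Q"
    have "1 - (z P)\<^sup>2 = (1 - z P) * (1 + z P)" by (simp add: power2_eq_square algebra_simps)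
    then show "1 / (1 - z P) = 1 / (1 - (z P)\<^sup>2) * (1 + z P)" using z[OF P] by simp
  qed
  also have "\<dots> = (\<Prod>P\<in>Q. 1 / (1 - (z P)\<^sup>2)) * (\<Prod>P\<in>Q. 1 + z P)" by (rule prod.distrib)
  also have "\<dots> \<le> real CARD('a) / (real CARD('a) - 1) * (\<Prod>P\<in>Q. 1 + z P)"
    using assms z unfolding z_def by (intro mult_right_mono prod_inverse_square_le prod_nonneg) (auto intro: add_nonneg_nonneg)
  finally show ?thesis .
qed

text \<open>Both \<open>x\<close> and \<open>x + a\<close> are sifted by all primes of degree at
  most \<open>n div 2\<close>, the highest level for which the sieve is exact. Every monic
  polynomial up to that degree is smooth over these primes, so the convolution sum is a plain count
  of lattice points.\<close>

lemma card_sifted_le: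
  fixes a b :: "'a::{finite,field} poly" and n :: nat
  defines "q \<equiv> real CARD('a)" and "Q \<equiv> {P \<in> monic_irr. degree P \<le> n div 2}"
  assumes a: "a \<noteq> 0" and n: "n > 0"
    and S: "S \<subseteq> (\<lambda>r. b + r) ` polys_below n"
    and sifted: "\<And>x P. x \<in> S \<Longrightarrow> P \<in> Q \<Longrightarrow> \<not> P dvd x \<and> \<not> P dvd x + a"
  shows "real (card S) \<le> 8 * q ^ n / real n ^ 2 * (q / (q - 1)) * (\<Prod>P\<in>prime_divs a. 1 + 1 / q ^ degree P)"
proof -
  let ?N = "n div 2" and ?D = "prime_divs a"
  let ?z = "\<lambda>P :: 'a poly. 1 / q ^ degree P"
  have q: "q \<ge> 2" using card_field_ge_2[where 'a='a] by (simp add: q_def)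
  have Q: "finite Q" "Q \<subseteq> monic_irr" using finite_monic_irr_degree_le by (auto simp: Q_def)
  have prod_nn: "(\<Prod>P\<in>A. 1 + ?z P) \<ge> 0" for A :: "'a poly set"
    using q by (intro prod_nonneg) (auto intro: add_nonneg_nonneg)
  show ?thesis
  proof (cases "\<forall>P\<in>Q - ?D. 2 * ?z P < 1")
    case True
    define forb where "forb = (\<lambda>P x. P dvd x \<or> P dvd x + a)"
    define h where "h = (\<lambda>P. if P \<in> ?D then ?z P / (1 - ?z P) else 2 * ?z P / (1 - 2 * ?z P))"
    \<comment> \<open>The forbidden residues are those of 0 and \<open>- a\<close>; they coincide
      exactly when \<open>P\<close> divides \<open>a\<close>.\<close>
    have w: "card {r \<in> polys_below (degree P). forb P r} = (if P \<in> ?D then 1 else 2)" if P: "P \<in> Q" for P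
    proof -
      have P': "P \<in> monic_irr" using P Q by auto
      have "{r \<in> polys_below (degree P). forb P r} = {0, (- a) mod P}"
      proof (intro equalityI subsetI)
        fix r assume r: "r \<in> {r \<in> polys_below (degree P). forb P r}"
        then have "r mod P = r" by (auto simp: polys_below_iff mod_poly_less)
        moreover have "r mod P = (- a) mod P" if "P dvd r + a"
          using that by (subst mod_eq_dvd_iff) simp
        then have "P dvd r \<or> r mod P = (- a) mod P" using r unfolding forb_def by blast
        ultimately show "r \<in> {0, (- a) mod P}" by auto
      next
        fix r assume r: "r \<in> {0, (- a) mod P}"
        have "P dvd (- a) mod P + a"
        proof -
          have "((- a) mod P + a) mod P = (- a + a) mod P" by (rule mod_add_left_eq)
          then show ?thesis by auto
        qed
        moreover have "(- a) mod P \<in> polys_below (degree P)"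
          using degree_mod_less[of P "- a"] P' by (auto simp: polys_below_iff)
        ultimately show "r \<in> {r \<in> polys_below (degree P). forb P r}"
          using r by (auto simp: forb_def polys_below_iff)
      qed
      moreover have "(- a) mod P = 0 \<longleftrightarrow> P \<in> ?D" using P' by (auto simp: prime_divs_def)
      ultimately show ?thesis by auto
    qed
    have zlt: "?z P < 1" if "P \<in> Q" for P
      using that Q q monic_irr_degree_pos[of P] by (auto simp: one_less_power)
    have "real (card S) * sieve_sum (\<lambda>P. real (card {r \<in> polys_below (degree P). forb P r}) /
        (q ^ degree P - real (card {r \<in> polys_below (degree P). forb P r}))) Q ?N \<le> q ^ n"
      unfolding q_def
    proof (rule selberg_sieve[OF Q _ _ _ S])
      fix P x y assume "P \<in> Q" "P dvd x - y"
      then have "P dvd x \<longleftrightarrow> P dvd y" "P dvd x + a \<longleftrightarrow> P dvd y + a"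
        by (metis dvd_diff_right_iff dvd_diff_left_iff, metis add_diff_cancel_right dvd_diff_left_iff dvd_diff_right_iff)
      then show "forb P x \<longleftrightarrow> forb P y" by (simp add: forb_def)
    next
      fix P assume P: "P \<in> Q"
      show "real (card {r \<in> polys_below (degree P). forb P r}) < real CARD('a) ^ degree P"
      proof (cases "P \<in> ?D")
        case True
        then show ?thesis using w[OF P] zlt[OF P] q by (simp add: q_def)
      next
        case False
        then have "2 * ?z P < 1" using True P by auto
        then show ?thesis using w[OF P] False q by (simp add: q_def)
      qed
    next
      fix x P assume "x \<in> S" "P \<in> Q"
      then show "\<not> forb P x" using sifted by (auto simp: forb_def)
    qed simp
    also have "sieve_sum (\<lambda>P. real (card {r \<in> polys_below (degree P). forb P r}) /
        (q ^ degree P - real (card {r \<in> polys_below (degree P). forb P r}))) Q ?N = sieve_sum h Q ?N"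
    proof (rule sieve_sum_cong)
      fix P assume P: "P \<in> Q"
      have qd: "q ^ degree P > 0" using q by simp
      show "real (card {r \<in> polys_below (degree P). forb P r}) /
        (q ^ degree P - real (card {r \<in> polys_below (degree P). forb P r})) = h P"
        unfolding w[OF P] h_def using qd q by (auto simp: divide_simps)
    qed
    finally have sieve: "real (card S) * sieve_sum h Q ?N \<le> q ^ n" .
    \<comment> \<open>The weaker relation \<open>n \<le> 2 * ?N + 1\<close> covers odd
      \<open>n\<close>; the lattice count still exceeds the square.\<close>
    have "real n ^ 2 / 8 \<le> real ((?N + 1) * (?N + 2)) / 2"
    proof -
      have "n \<le> 2 * ?N + 1" by linarith
      then have "n * n \<le> (2 * ?N + 1) * (2 * ?N + 1)" by (rule mult_le_mono) (use \<open>n \<le> 2 * ?N + 1\<close> in simp)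
      also have "\<dots> \<le> 4 * ((?N + 1) * (?N + 2))" by (simp add: algebra_simps)
      finally have "real (n * n) \<le> real (4 * ((?N + 1) * (?N + 2)))" by (simp only: of_nat_le_iff)
      then show ?thesis by (simp add: power2_eq_square)
    qed
    also have "\<dots> = conv_sum (smooth_density Q) (smooth_density Q) ?N"
      by (subst conv_sum_1) (auto simp: Q_def intro!: smooth_density_eq_1)
    also have "\<dots> \<le> (\<Prod>P\<in>Q \<inter> ?D. 1 / (1 - ?z P)) * sieve_sum h Q ?N"
      unfolding h_def q_def using Q True by (intro conv_sum_le_sieve_sum) (auto simp: q_def)
    finally have L: "real n ^ 2 / 8 \<le> (\<Prod>P\<in>Q \<inter> ?D. 1 / (1 - ?z P)) * sieve_sum h Q ?N" .
    have "(\<Prod>P\<in>Q \<inter> ?D. 1 / (1 - ?z P)) \<le> q / (q - 1) * (\<Prod>P\<in>Q \<inter> ?D. 1 + ?z P)"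
      unfolding q_def using Q by (intro prod_inverse_one_minus_norm_le) auto
    also have "\<dots> \<le> q / (q - 1) * (\<Prod>P\<in>?D. 1 + ?z P)"
      using q finite_prime_divs[OF a]
      by (intro mult_left_mono prod_mono2) (auto intro: add_nonneg_nonneg)
    finally have C: "(\<Prod>P\<in>Q \<inter> ?D. 1 / (1 - ?z P)) \<le> q / (q - 1) * (\<Prod>P\<in>?D. 1 + ?z P)" .
    have nn: "(\<Prod>P\<in>Q \<inter> ?D. 1 / (1 - ?z P)) \<ge> 0" using zlt by (intro prod_nonneg) (auto simp: less_imp_le)
    have "real (card S) * (real n ^ 2 / 8) \<le> real (card S) * ((\<Prod>P\<in>Q \<inter> ?D. 1 / (1 - ?z P)) * sieve_sum h Q ?N)"
      using L by (intro mult_left_mono) auto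
    also have "\<dots> = (\<Prod>P\<in>Q \<inter> ?D. 1 / (1 - ?z P)) * (real (card S) * sieve_sum h Q ?N)" by simp
    also have "\<dots> \<le> (\<Prod>P\<in>Q \<inter> ?D. 1 / (1 - ?z P)) * q ^ n"
      by (intro mult_left_mono sieve nn)
    also have "\<dots> \<le> q / (q - 1) * (\<Prod>P\<in>?D. 1 + ?z P) * q ^ n"
      using q by (intro mult_right_mono C) auto
    finally have "real (card S) \<le> (q / (q - 1) * (\<Prod>P\<in>?D. 1 + ?z P) * q ^ n) / (real n ^ 2 / 8)"
      using n by (subst pos_le_divide_eq) auto
    then show ?thesis by (simp add: mult_ac)
  next
    case False
    text \<open>Some prime of norm 2 not dividing \<open>a\<close> divides \<open>x\<close> or \<open>x + a\<close> for every \<open>x\<close>.\<close>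
    then obtain P where P: "P \<in> Q" "P \<notin> ?D" "q ^ degree P \<le> 2" using q by (auto simp: divide_simps split: if_splits)
    have P': "P \<in> monic_irr" using P Q by auto
    have "card (polys_below (degree P) :: 'a poly set) \<le> 2"
      using P(3) by (simp add: card_polys_below q_def flip: of_nat_power)
    moreover have "{0, 1} \<subseteq> (polys_below (degree P) :: 'a poly set)"
      using monic_irr_degree_pos[OF P'] by (auto simp: polys_below_iff)
    ultimately have res: "polys_below (degree P) = {0, 1 :: 'a poly}"
      by (intro card_seteq[symmetric]) auto
    have modP: "x mod P = 0 \<or> x mod P = 1" for x
      using degree_mod_less[of P x] P' res polys_below_iff[of "x mod P" "degree P"] by auto
    have "x \<notin> S" for x
    proof
      assume "x \<in> S"
      then have "\<not> P dvd x" "\<not> P dvd x + a" using sifted P(1) by auto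
      then have "x mod P = (x + a) mod P" using modP[of x] modP[of "x + a"] by auto
      then have "P dvd (x + a) - x" by (metis mod_eq_dvd_iff)
      then show False using P(2) P' by (auto simp: prime_divs_def)
    qed
    then have "S = {}" by blast
    then show ?thesis using q prod_nn by simp
  qed
qed

text \<open>The sieve acts on one leading coefficient at a time, which yields the factor
  \<open>q - 1\<close>. An irreducible polynomial of degree \<open>n\<close> has no prime divisor of
  degree at most \<open>n div 2\<close>, since that is below \<open>n\<close>.\<close>

lemma card_irreducible_pairs_le:
  fixes a :: "'a::{finite,field} poly" and n :: nat
  defines "q \<equiv> real CARD('a)"
  assumes a: "a \<noteq> 0" and n: "n > 0"
  shows "real (card {h. irreducible h \<and> degree h = n \<and> irreducible (h + a) \<and> degree (h + a) = n}) \<le>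
    (q - 1) * (8 * q ^ n / real n ^ 2 * (q / (q - 1)) * (\<Prod>P\<in>prime_divs a. 1 + 1 / q ^ degree P))"
proof -
  let ?B = "8 * q ^ n / real n ^ 2 * (q / (q - 1)) * (\<Prod>P\<in>prime_divs a. 1 + 1 / q ^ degree P)"
  define S where "S = (\<lambda>c. {h. (irreducible h \<and> degree h = n \<and> irreducible (h + a) \<and> degree (h + a) = n) \<and> lead_coeff h = c})"
  have "real (card (S c)) \<le> ?B" if c: "c \<noteq> 0" for c
    unfolding q_def
  proof (rule card_sifted_le[OF a n])
    have "S c \<subseteq> {p. degree p = n \<and> lead_coeff p = c}" by (auto simp: S_def)
    then show "S c \<subseteq> (\<lambda>r. monom c n + r) ` polys_below n" unfolding degree_lead_eq_image[OF c] .
  next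
    fix x P :: "'a poly" assume x: "x \<in> S c" and P: "P \<in> {P \<in> monic_irr. degree P \<le> n div 2}"
    have "n div 2 < n" using n by simp
    then have "degree P < n" using P by (simp del: div_less_dividend)
    then show "\<not> P dvd x \<and> \<not> P dvd x + a"
      using x P irreducible_not_dvd_small[of x P] irreducible_not_dvd_small[of "x + a" P]
      by (auto simp: S_def)
  qed
  then have "(\<Sum>c\<in>UNIV - {0}. real (card (S c))) \<le> (\<Sum>c\<in>(UNIV - {0 :: 'a}). ?B)"
    by (intro sum_mono) auto
  also have "\<dots> = (q - 1) * ?B"
  proof -
    have "CARD('a) \<ge> 1" using card_field_ge_2[where 'a='a] by simp
    then show ?thesis by (simp add: card_Diff_singleton q_def of_nat_diff)
  qed
  finally have le: "(\<Sum>c\<in>UNIV - {0}. real (card (S c))) \<le> (q - 1) * ?B" .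
  have "{h. irreducible h \<and> degree h = n \<and> irreducible (h + a) \<and> degree (h + a) = n} = (\<Union>c\<in>UNIV - {0}. S c)"
    by (auto simp: S_def)
  then have "card {h. irreducible h \<and> degree h = n \<and> irreducible (h + a) \<and> degree (h + a) = n} \<le> (\<Sum>c\<in>UNIV - {0}. card (S c))"
    by (simp only: card_UN_le finite)
  then have "real (card {h. irreducible h \<and> degree h = n \<and> irreducible (h + a) \<and> degree (h + a) = n}) \<le> (\<Sum>c\<in>UNIV - {0}. real (card (S c)))"
    by (simp only: of_nat_le_iff flip: of_nat_sum)
  with le show ?thesis by linarith
qed

section \<open>Real inequalities\<close>

lemma exp_euler_mascheroni_ge: "exp euler_mascheroni \<ge> (174/100 :: real)"
proof -
  have "1 + 19/33 + (19/33)\<^sup>2 / 2 \<le> exp (19/33 :: real)" by (rule exp_lower_Taylor_quadratic) simp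
  also have "\<dots> \<le> exp euler_mascheroni" using euler_mascheroni_gt_19_over_33 by simp
  finally show ?thesis by (simp add: power2_eq_square)
qed

lemma exp_minus_euler_mascheroni_ge: "exp (- euler_mascheroni) \<ge> (547/1000 :: real)"
proof -
  \<comment> \<open>The 16th power of 1 - x/16 approximates exp(-x) from below; here x = 13/22, an
    upper bound for \<gamma>.\<close>
  have "547/1000 \<le> (339 / 352 :: real) ^ 16" by (simp add: power_divide)
  also have "\<dots> \<le> exp (- 13 / 352 :: real) ^ 16"
    using exp_ge_add_one_self[of "- 13 / 352 :: real"] by (intro power_mono) auto
  also have "\<dots> = exp (- 13 / 22)" by (simp flip: exp_of_nat_mult)
  also have "\<dots> \<le> exp (- euler_mascheroni)" using euler_mascheroni_less_13_over_22 by simp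
  finally show ?thesis by simp
qed

text \<open>For large \<open>m\<close> the left side is about e^\<gamma> (m + 1/2), and e^\<gamma> /
  2 < 1 leaves room. With \<open>M = m + 1\<close> and \<open>t = 1 / (2 * M)\<close>, it suffices
  that M e^-t \<le> M - (1 - e^-\<gamma>), where 1 - e^-\<gamma> < 1/2. The value
  \<open>m = 1\<close> is the tight one: e \<le> 1 + e^\<gamma>.\<close>

lemma exp_harm_le: "exp (harm m :: real) \<le> 1 + exp euler_mascheroni * real m"
proof -
  consider "m = 0" | "m = 1" | "m \<ge> 2" by linarith
  then show ?thesis
  proof cases
    case 1
    then show ?thesis by (simp add: harm_expand)
  next
    case 2
    then show ?thesis using e_less_272 exp_euler_mascheroni_ge by (simp add: harm_expand)
  next
    case 3
    let ?g = "euler_mascheroni :: real"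
    define M where "M = real m + 1"
    define t where "t = 1 / (2 * M)"
    have M: "M \<ge> 3" using 3 by (simp add: M_def)
    have t: "t \<ge> 0" using M by (simp add: t_def)
    obtain k where k: "m = Suc k" using 3 by (cases m) auto
    have "real (k + 2) = M" "1 / real (2 * (k + 2)) = t" by (auto simp: k M_def t_def)
    then have "harm m - ln M + t \<le> ?g" using euler_mascheroni_lower[of k] by (simp only: k)
    then have "exp (harm m) \<le> exp (?g + ln M - t)" by simp
    also have "\<dots> = exp ?g * M / exp t" using M by (simp add: exp_add exp_diff)
    also have "\<dots> \<le> exp ?g * M / (1 + t + t\<^sup>2 / 2)"
      using exp_lower_Taylor_quadratic[OF t] t M
      by (intro divide_left_mono mult_pos_pos) (auto intro!: add_pos_nonneg)
    also have "\<dots> = exp ?g * (8 * M ^ 3 / (8 * M\<^sup>2 + 4 * M + 1))"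
      using M by (simp add: t_def field_simps power2_eq_square power3_eq_cube)
    also have "\<dots> \<le> exp ?g * (M - 1 + exp (- ?g))"
    proof (rule mult_left_mono)
      let ?c = "1 - exp (- ?g)"
      have c: "?c \<le> 453/1000" using exp_minus_euler_mascheroni_ge by simp
      have "?c * (8 * M\<^sup>2 + 4 * M + 1) \<le> 453/1000 * (8 * M\<^sup>2 + 4 * M + 1)"
        using M by (intro mult_right_mono c) auto
      \<comment> \<open>The quadratic margin 4 - 8 * 453/1000 = 376/1000 outweighs the lower terms
        from M = 3 on.\<close>
      also have "\<dots> \<le> 4 * M\<^sup>2 + M"
      proof -
        have "3 * M \<le> M * M" using M by (intro mult_right_mono) auto
        then have "376 * (3 * M) \<le> 376 * (M * M)" by linarith
        then have "812 * M + 453 \<le> 376 * (M * M)" using M by linarith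
        then show ?thesis by (simp add: power2_eq_square)
      qed
      finally have "8 * M ^ 3 \<le> (M - 1 + exp (- ?g)) * (8 * M\<^sup>2 + 4 * M + 1)"
        by (simp add: algebra_simps power2_eq_square power3_eq_cube)
      moreover have "8 * M\<^sup>2 + 4 * M + 1 > 0" using M by (auto intro!: add_pos_pos)
      ultimately show "8 * M ^ 3 / (8 * M\<^sup>2 + 4 * M + 1) \<le> M - 1 + exp (- ?g)"
        by (subst pos_divide_le_eq) auto
    qed simp
    also have "\<dots> = 1 + exp ?g * real m"
      by (simp add: M_def algebra_simps flip: exp_add)
    finally show ?thesis .
  qed
qed

text \<open>On each interval between consecutive test points the exponent is affine in
  \<open>M\<close>. Convexity of \<open>exp\<close>, with concavity of \<open>ln\<close> on the
  other side, reduces the bound 1 + e^\<gamma> log_q M to the two endpoints.\<close>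

lemma exp_le_chord:
  fixes a b t c d :: real
  assumes "0 \<le> t" "t \<le> 1" "exp a \<le> c" "exp b \<le> d"
  shows "exp ((1 - t) * a + t * b) \<le> (1 - t) * c + t * d"
proof -
  have "exp ((1 - t) * a + t * b) \<le> (1 - t) * exp a + t * exp b"
    using convex_onD[OF exp_convex assms(1,2), of a b] by simp
  also have "\<dots> \<le> (1 - t) * c + t * d" using assms by (intro add_mono mult_left_mono) auto
  finally show ?thesis .
qed

lemma ln_ge_chord:
  fixes x y t :: real
  assumes "0 \<le> t" "t \<le> 1" "x > 0" "y > 0"
  shows "(1 - t) * ln x + t * ln y \<le> ln ((1 - t) * x + t * y)"
  using concave_onD[OF ln_concave assms(1,2), of x y] assms by simp

text \<open>The slope 1.72 lies above e - 1 and below the bound 1.74 for e^\<gamma>, so 1 +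
  e^\<gamma> x dominates \<open>exp x\<close> on the unit interval.\<close>

lemma exp_le_chord_0_1:
  fixes x :: real
  assumes "0 \<le> x" "x \<le> 1"
  shows "exp x \<le> 1 + 172/100 * x"
  using exp_le_chord[OF assms, of 0 1 1 "272/100"] e_less_272 by (simp add: algebra_simps)

text \<open>At \<open>M = q\<close> this is e \<le> 1 + e^\<gamma>. At \<open>M = 2\<close> it
  depends on \<open>q\<close>; integrality of \<open>q\<close> reduces it to 2, 3 and the range from
  4 on.\<close>

lemma exp_le_log_bound_0:
  fixes M q :: real and k :: nat
  assumes q: "q = real k" "k \<ge> 2" and M: "2 \<le> M" "M \<le> q"
  shows "exp (M / q) \<le> 1 + exp euler_mascheroni * (ln M / ln q)"
proof -
  let ?e = "exp euler_mascheroni :: real"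
  have q2: "q \<ge> 2" using q by simp
  have lnq: "ln q > 0" using q2 by simp
  have end2: "exp (2 / q) \<le> 1 + ?e * (ln 2 / ln q)"
  proof -
    consider "k = 2" | "k = 3" | "k \<ge> 4" using q(2) by linarith
    then show ?thesis
    proof cases
      case 1
      then show ?thesis using q e_less_272 exp_euler_mascheroni_ge by simp
    next
      case 2
      \<comment> \<open>243 = 3^5 is below 256 = 2^8, which makes 1.74 ln 2 / ln 3 exceed 1; below,
        exp(2/3) \<le> 2 follows from e^2 < 8.\<close>
      have "5 * ln 3 \<le> 8 * ln (2 :: real)"
      proof -
        have "ln (3 ^ 5) \<le> ln ((2 :: real) ^ 8)" by (subst ln_le_cancel_iff) auto
        then show ?thesis by (subst (asm) (1 2) ln_realpow) auto
      qed
      then have "5 / 8 \<le> ln 2 / ln (3 :: real)" by (simp add: field_simps)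
      then have "174/100 * (5 / 8) \<le> ?e * (ln 2 / ln 3)"
        using exp_euler_mascheroni_ge by (intro mult_mono) auto
      moreover have "exp (2 / 3 :: real) \<le> 2"
      proof (rule power_le_imp_le_base)
        have "exp (2 / 3 :: real) ^ Suc 2 = exp 1 ^ 2" by (simp flip: exp_of_nat_mult)
        also have "\<dots> \<le> (272/100) ^ 2" using e_less_272 by (intro power_mono) auto
        finally show "exp (2 / 3 :: real) ^ Suc 2 \<le> 2 ^ Suc 2" by (simp add: power_divide)
      qed simp
      ultimately have "exp (2 / 3) \<le> 1 + ?e * (ln 2 / ln 3)" by linarith
      then show ?thesis using q 2 by simp
    next
      case 3
      \<comment> \<open>ln x / x decreases beyond e, and its value at 4 equals its value at
        2.\<close>
      have "ln q / q \<le> ln 4 / 4"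
        using 3 q e_less_272 by (intro ln_x_over_x_mono) auto
      also have "ln (4 :: real) = 2 * ln 2" using ln_realpow[of 2 2] by simp
      finally have "2 / q \<le> ln 2 / ln q" using q2 lnq by (simp add: field_simps)
      moreover have "exp (2 / q) \<le> 1 + 172/100 * (2 / q)" using q2 by (intro exp_le_chord_0_1) auto
      moreover have "172/100 * (2 / q) \<le> ?e * (2 / q)"
        using exp_euler_mascheroni_ge q2 by (intro mult_right_mono) auto
      moreover have "?e * (2 / q) \<le> ?e * (ln 2 / ln q)"
        using calculation(1) by (intro mult_left_mono) auto
      ultimately show ?thesis by linarith
    qed
  qed
  show ?thesis
  proof (cases "q = 2")
    case True
    then have "M = 2" using M by simp
    then show ?thesis using end2 by simp
  next
    case False
    define t where "t = (M - 2) / (q - 2)"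
    have t: "0 \<le> t" "t \<le> 1" using M q2 False by (auto simp: t_def)
    have "t * (q - 2) = M - 2" using q2 False by (simp add: t_def)
    then have Meq: "M = (1 - t) * 2 + t * q" by (simp add: algebra_simps)
    have "exp (M / q) = exp ((1 - t) * (2 / q) + t * 1)"
      unfolding Meq using q2 by (simp add: field_simps)
    also have "\<dots> \<le> (1 - t) * (1 + ?e * (ln 2 / ln q)) + t * (1 + ?e)"
      using e_less_272 exp_euler_mascheroni_ge by (intro exp_le_chord t end2) auto
    also have "\<dots> = 1 + ?e * (((1 - t) * ln 2 + t * ln q) / ln q)"
      using lnq by (simp add: field_simps)
    also have "\<dots> \<le> 1 + ?e * (ln M / ln q)"
    proof -
      have "(1 - t) * ln 2 + t * ln q \<le> ln M"
        unfolding Meq using q2 by (intro ln_ge_chord t) auto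
      then show ?thesis using lnq by (intro add_left_mono mult_left_mono divide_right_mono) auto
    qed
    finally show ?thesis .
  qed
qed

text \<open>At the endpoints the exponent is \<open>harm m\<close> and at most
  \<open>harm (Suc m)\<close>, so both ends are instances of \<open>exp_harm_le\<close>; the
  interior follows by chords.\<close>

lemma exp_le_log_bound_pos:
  fixes M q :: real and m :: nat
  assumes q: "q \<ge> 2" and M: "q ^ m \<le> M" "M \<le> q ^ Suc m"
  shows "exp (harm m + (M - q ^ m) / (real (Suc m) * q ^ Suc m)) \<le> 1 + exp euler_mascheroni * (ln M / ln q)"
proof -
  let ?e = "exp euler_mascheroni :: real" and ?l = "1 / (real (Suc m) * q ^ Suc m)"
  have lnq: "ln q > 0" and qm: "q ^ m > 0" using q by auto
  define t where "t = (M - q ^ m) / (q ^ Suc m - q ^ m)"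
  have lt: "q ^ m < q ^ Suc m" using q by (simp add: qm)
  have t: "0 \<le> t" "t \<le> 1" using M lt by (auto simp: t_def divide_le_eq)
  have tt: "t * (q ^ Suc m - q ^ m) = M - q ^ m" using lt by (simp add: t_def del: power_Suc)
  have Meq: "M = (1 - t) * q ^ m + t * q ^ Suc m" using tt by (simp add: algebra_simps)
  have e1: "exp (harm m + (q ^ Suc m - q ^ m) * ?l) \<le> 1 + ?e * real (Suc m)"
  proof -
    have "(q ^ Suc m - q ^ m) * ?l \<le> q ^ Suc m * ?l" using q by (intro mult_right_mono) auto
    also have "\<dots> = inverse (real (Suc m))"
    proof -
      have "q ^ Suc m \<noteq> 0" using q by simp
      then show ?thesis by (simp add: inverse_eq_divide del: power_Suc of_nat_Suc)
    qed
    finally have "harm m + (q ^ Suc m - q ^ m) * ?l \<le> harm (Suc m)" by (simp add: harm_Suc)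
    then have "exp (harm m + (q ^ Suc m - q ^ m) * ?l) \<le> exp (harm (Suc m))" by simp
    also have "\<dots> \<le> 1 + ?e * real (Suc m)" by (rule exp_harm_le)
    finally show ?thesis .
  qed
  have "harm m + (M - q ^ m) / (real (Suc m) * q ^ Suc m) =
      (1 - t) * harm m + t * (harm m + (q ^ Suc m - q ^ m) * ?l)"
    by (simp add: algebra_simps flip: tt)
  then have "exp (harm m + (M - q ^ m) / (real (Suc m) * q ^ Suc m)) =
      exp ((1 - t) * harm m + t * (harm m + (q ^ Suc m - q ^ m) * ?l))" by (simp only:)
  also have "\<dots> \<le> (1 - t) * (1 + ?e * real m) + t * (1 + ?e * real (Suc m))"
    by (intro exp_le_chord t e1 exp_harm_le)
  also have "\<dots> = 1 + ?e * (((1 - t) * ln (q ^ m) + t * ln (q ^ Suc m)) / ln q)"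
    using lnq q by (simp add: ln_realpow ln_mult field_simps)
  also have "\<dots> \<le> 1 + ?e * (ln M / ln q)"
  proof -
    have "(1 - t) * ln (q ^ m) + t * ln (q ^ Suc m) \<le> ln ((1 - t) * q ^ m + t * q ^ Suc m)"
      using qm lt by (intro ln_ge_chord t) auto
    then show ?thesis unfolding Meq[symmetric] using lnq
      by (intro add_left_mono mult_left_mono divide_right_mono) auto
  qed
  finally show ?thesis .
qed

subsection \<open>Summation by parts\<close>

text \<open>Abel summation: the weights 1/x decrease, so a pointwise larger function with the same
  starting value has a larger weighted sum of increments. The induction carries the stronger claim
  that the gap is at least \<open>G X / real X\<close>.\<close>

lemma sum_diff_quotient_mono:
  fixes D B :: "nat \<Rightarrow> real"
  assumes "D 0 = B 0" "\<And>x. x > 0 \<Longrightarrow> D x \<le> B x"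
  shows "(\<Sum>x=1..X. (D x - D (x - 1)) / real x) \<le> (\<Sum>x=1..X. (B x - B (x - 1)) / real x)"
proof (cases "X = 0")
  case False
  define G where "G = (\<lambda>x. B x - D x)"
  have G: "G 0 = 0" "G x \<ge> 0" for x
    using assms(1) assms(2)[of x] by (auto simp: G_def) (cases x; auto)
  have "G X / real X \<le> (\<Sum>x=1..X. (G x - G (x - 1)) / real x)" if "X > 0" for X
    using that
  proof (induction X rule: nat_induct_non_zero)
    case 1
    then show ?case by (simp add: G)
  next
    case (Suc X)
    have "G X / real (Suc X) \<le> G X / real X" using Suc.hyps G by (intro divide_left_mono) auto
    then have "G (Suc X) / real (Suc X) \<le> G X / real X + (G (Suc X) - G X) / real (Suc X)"
      by (simp add: diff_divide_distrib)
    with Suc.IH show ?case by simp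
  qed
  from this[of X] False have "0 \<le> (\<Sum>x=1..X. (G x - G (x - 1)) / real x)"
    using G(2)[of X] by (smt (verit) divide_nonneg_nonneg of_nat_0_le_iff not_gr_zero)
  also have "\<dots> = (\<Sum>x=1..X. (B x - B (x - 1)) / real x) - (\<Sum>x=1..X. (D x - D (x - 1)) / real x)"
    unfolding sum_subtractf[symmetric] by (intro sum.cong refl) (simp add: G_def diff_divide_distrib)
  finally show ?thesis by simp
qed simp

text \<open>Bounds the degree of the radical of \<open>g \<cdot> \<Prod>\<^sub>e\<^sub>\<le>\<^sub>x (g\<^sup>e - 1)\<close> in units of \<open>deg g\<close>: one factor for \<open>g\<close>,
  one for \<open>g - 1\<close>, and \<open>e - 1\<close> for the cofactor of \<open>g - 1\<close> in each \<open>g\<^sup>e - 1\<close>.\<close>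

definition rad_bound :: "nat \<Rightarrow> real" where
  "rad_bound x = 2 + real x * (real x - 1) / 2"

lemma rad_bound_ge: "x > 0 \<Longrightarrow> rad_bound x \<ge> 2"
  by (simp add: rad_bound_def)

lemma rad_bound_Suc: "rad_bound (Suc x) = rad_bound x + real x"
  by (simp add: rad_bound_def field_simps)

text \<open>ln(1+u) \<le> u and rad_bound x \<ge> x(x-1)/2 give 2/((x-1)x), a form that
  telescopes.\<close>

lemma ln_rad_bound_increment:
  assumes "x \<ge> 2"
  shows "ln (rad_bound (Suc x) / rad_bound x) / real (Suc x) \<le> 2 * (1 / (real x - 1) - 1 / real x)"
proof -
  have r: "rad_bound x \<ge> 2" using assms by (intro rad_bound_ge) auto
  have x: "real x \<ge> 2" using assms by simp
  have "rad_bound (Suc x) / rad_bound x = 1 + real x / rad_bound x"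
    using r by (simp add: rad_bound_Suc field_simps)
  then have "ln (rad_bound (Suc x) / rad_bound x) \<le> real x / rad_bound x"
    using r by (simp add: ln_add_one_self_le_self)
  also have "\<dots> \<le> real x / (real x * (real x - 1) / 2)"
  proof (rule divide_left_mono)
    show "real x * (real x - 1) / 2 \<le> rad_bound x" by (simp add: rad_bound_def)
    show "0 < rad_bound x * (real x * (real x - 1) / 2)" using x r by (intro mult_pos_pos) auto
  qed simp
  also have "\<dots> = 2 / (real x - 1)" using x by (simp add: field_simps)
  finally have "ln (rad_bound (Suc x) / rad_bound x) / real (Suc x) \<le> 2 / (real x - 1) / real (Suc x)"
    by (intro divide_right_mono) auto
  also have "\<dots> \<le> 2 / (real x - 1) / real x"
    using x by (intro divide_left_mono) auto
  also have "\<dots> = 2 * (1 / (real x - 1) - 1 / real x)" using x by (simp add: field_simps)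
  finally show ?thesis .
qed

text \<open>The origin of the 6. \<open>ln 2\<close> is \<open>ln (rad_bound 1)\<close>; the terms
  up to x = 5 are evaluated exactly, and the tail telescopes to at most 1/2.\<close>

lemma sum_ln_rad_bound_le:
  "ln 2 + (\<Sum>x=2..X. ln (rad_bound x / rad_bound (x - 1)) / real x) \<le> ln 6"
proof -
  define V where "V = (\<lambda>X. ln 2 + (\<Sum>x=2..X. ln (rad_bound x / rad_bound (x - 1)) / real x))"
  have V5: "V 5 + 1 / 2 \<le> ln 6"
  proof -
    \<comment> \<open>\<open>rad_bound\<close> takes the values 2, 3, 5, 8, 12 at 1 to 5.
      Multiplying by 60, the least common multiple of 1 to 5, makes all coefficients integers; the
      tail becomes 30 = 30 ln e, and a comparison of rational numbers remains.\<close>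
    have "60 * V 5 + 30 = 60 * ln 2 + 30 * ln (3/2) + 20 * ln (5/3) + 15 * ln (8/5) + 12 * ln (3/2 :: real) + 30"
      by (simp add: V_def rad_bound_def numeral_eq_Suc)
    also have "\<dots> = 60 * ln 2 + 42 * ln (3/2) + 20 * ln (5/3) + 15 * ln (8/5) + 30 * ln (exp 1 :: real)"
      by simp
    also have "\<dots> \<le> 60 * ln 2 + 42 * ln (3/2) + 20 * ln (5/3) + 15 * ln (8/5) + 30 * ln (272/100 :: real)"
      using e_less_272 by (intro add_left_mono mult_left_mono) (auto simp del: ln_exp)
    also have "\<dots> = ln (2 ^ 60 * (3/2) ^ 42 * (5/3) ^ 20 * (8/5) ^ 15 * (272/100 :: real) ^ 30)"
    proof -
      have "ln (a ^ 60 * b ^ 42 * c ^ 20 * d ^ 15 * e ^ 30) = 60 * ln a + 42 * ln b + 20 * ln c + 15 * ln d + 30 * ln e"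
        if "a > 0" "b > 0" "c > 0" "d > 0" "e > 0" for a b c d e :: real
        using that by (simp add: ln_mult ln_realpow)
      from this[of 2 "3/2" "5/3" "8/5" "272/100"] show ?thesis by simp
    qed
    also have "\<dots> \<le> ln (6 ^ 60)" by (subst ln_le_cancel_iff) (auto simp: power_divide)
    also have "\<dots> = 60 * ln 6"
      using ln_realpow[of "6 :: real" 60] by (simp only: zero_less_numeral of_nat_numeral)
    finally show ?thesis by simp
  qed
  have V_step: "V (Suc X) \<le> V X + 2 * (1 / (real X - 1) - 1 / real X)" if "X \<ge> 2" for X
    using ln_rad_bound_increment[OF that] that by (simp add: V_def)
  have mono: "V X \<le> V (Suc X)" for X
  proof (cases "X \<ge> 1")
    case True
    then have "rad_bound X \<ge> 2" by (intro rad_bound_ge) auto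
    then have "ln (rad_bound (Suc X) / rad_bound X) \<ge> 0" by (simp add: rad_bound_Suc)
    then show ?thesis using True by (simp add: V_def)
  qed (simp add: V_def)
  have "V X \<le> V 5 + 2 * (1 / 4 - 1 / (real X - 1))" if "X \<ge> 5" for X
    using that
  proof (induction X rule: dec_induct)
    case (step X)
    then show ?case using V_step[of X] by simp
  qed simp
  moreover obtain Y where Y: "Y \<ge> 5" "Y \<ge> X" using le_cases[of X 5] by blast
  ultimately have VY: "V Y \<le> V 5 + 2 * (1 / 4 - 1 / (real Y - 1))" by blast
  have "2 * (1 / 4 - 1 / (real Y - 1)) \<le> 1 / 2" using Y by simp
  with VY have "V Y \<le> V 5 + 1 / 2" by (meson add_left_mono order_trans)
  moreover have "V X \<le> V Y" using lift_Suc_mono_le[of V X Y] mono Y by simp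
  ultimately have "V X \<le> V 5 + 1 / 2" by (rule order_trans[rotated])
  with V5 show ?thesis by (simp add: V_def)
qed

text \<open>\<open>D x\<close> will be the total weight of the prime sets of order at most
  \<open>x\<close>; both hypotheses bound it by a product over primes of total degree at most
  \<open>\<delta> * rad_bound x\<close>.\<close>

context
  fixes D :: "nat \<Rightarrow> real" and q \<delta> :: real
  assumes q: "q \<ge> 2" and \<delta>: "\<delta> \<ge> 1" and D0: "D 0 = 0"
    and D_log: "\<And>x. x > 0 \<Longrightarrow> D x \<le> 1 + exp euler_mascheroni * (ln (\<delta> * rad_bound x) / ln q)"
    and D_exp: "\<And>x. x > 0 \<Longrightarrow> D x \<le> exp (\<delta> * rad_bound x / q)"
begin

text \<open>\<open>\<delta>\<close> enters only through x = 1: later increments of the logarithm are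
  ratios of \<open>rad_bound\<close> values, and their weighted sum raises the 2 of
  \<open>rad_bound 1\<close> to at most 6.\<close>

lemma romanov_sum_log:
  "(\<Sum>x=1..X. (D x - D (x - 1)) / real x) \<le> 1 + exp euler_mascheroni * (ln (6 * \<delta>) / ln q)"
proof (cases "X = 0")
  case True
  have "0 \<le> exp euler_mascheroni * (ln (6 * \<delta>) / ln q)" using q \<delta> by (intro mult_nonneg_nonneg divide_nonneg_nonneg) auto
  then show ?thesis using True by simp
next
  case False
  let ?k = "exp euler_mascheroni / ln q"
  have k: "?k \<ge> 0" using q by simp
  define B where "B = (\<lambda>x::nat. if x = 0 then 0 else 1 + ?k * ln (\<delta> * rad_bound x))"
  have "(\<Sum>x=1..X. (D x - D (x - 1)) / real x) \<le> (\<Sum>x=1..X. (B x - B (x - 1)) / real x)"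
    using D0 D_log by (intro sum_diff_quotient_mono) (auto simp: B_def)
  also have "\<dots> = B 1 + (\<Sum>x=2..X. (B x - B (x - 1)) / real x)"
    using False sum.atLeast_Suc_atMost[of 1 X "\<lambda>x. (B x - B (x - 1)) / real x"]
    by (simp add: B_def numeral_2_eq_2)
  also have "(\<Sum>x=2..X. (B x - B (x - 1)) / real x) =
      (\<Sum>x=2..X. ?k * (ln (rad_bound x / rad_bound (x - 1)) / real x))"
  proof (intro sum.cong refl)
    fix x assume x: "x \<in> {2..X}"
    then have "rad_bound x \<ge> 2" "rad_bound (x - 1) \<ge> 2" by (auto intro!: rad_bound_ge)
    then have "ln (\<delta> * rad_bound x) - ln (\<delta> * rad_bound (x - 1)) = ln (rad_bound x / rad_bound (x - 1))"
      using \<delta> by (simp add: ln_mult ln_div)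
    moreover have "B x - B (x - 1) = ?k * (ln (\<delta> * rad_bound x) - ln (\<delta> * rad_bound (x - 1)))"
      using x by (simp add: B_def right_diff_distrib)
    ultimately show "(B x - B (x - 1)) / real x = ?k * (ln (rad_bound x / rad_bound (x - 1)) / real x)"
      by simp
  qed
  also have "\<dots> = ?k * (\<Sum>x=2..X. ln (rad_bound x / rad_bound (x - 1)) / real x)"
    by (rule sum_distrib_left[symmetric])
  also have "B 1 = 1 + ?k * (ln \<delta> + ln 2)"
    using \<delta> by (simp add: B_def rad_bound_def ln_mult)
  also have "1 + ?k * (ln \<delta> + ln 2) + ?k * (\<Sum>x=2..X. ln (rad_bound x / rad_bound (x - 1)) / real x) =
      1 + ?k * (ln \<delta> + (ln 2 + (\<Sum>x=2..X. ln (rad_bound x / rad_bound (x - 1)) / real x)))"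
    by (simp only: algebra_simps)
  also have "\<dots> \<le> 1 + ?k * (ln \<delta> + ln 6)"
    by (intro add_left_mono mult_left_mono sum_ln_rad_bound_le k)
  also have "\<dots> = 1 + exp euler_mascheroni * (ln (6 * \<delta>) / ln q)"
    using \<delta> by (simp add: ln_mult)
  finally show ?thesis .
qed

text \<open>When the square root is the smaller term of the minimum, \<open>\<delta> / q\<close> is
  already small enough for the split summation. With s = \<delta>/q the hypothesis reads 5 sqrt s <
  1 + ln(6s)/ln q; this gives the claim at once if 6s \<le> 1 and is contradictory
  otherwise.\<close>

lemma sqrt_ratio_small:
  assumes "5 * sqrt (\<delta> / q) < ln (6 * \<delta>) / ln q"
  shows "sqrt (\<delta> / q) < 1 / 5" "q > 25"
proof -
  define s where "s = \<delta> / q"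
  have s: "s > 0" and dq: "\<delta> = s * q" using q \<delta> by (auto simp: s_def)
  have lnq: "ln q > 0" using q by simp
  have "ln (6 * \<delta>) = ln (6 * s) + ln q"
    using s q ln_mult_pos[of "6 * s" q] unfolding dq by (simp add: mult.assoc)
  then have *: "5 * sqrt s < 1 + ln (6 * s) / ln q"
    using assms lnq by (simp add: s_def add_divide_distrib)
  have r: "sqrt s < 1 / 5"
  proof (cases "6 * s \<le> 1")
    case True
    then have "ln (6 * s) / ln q \<le> 0" using s lnq by (simp add: divide_nonpos_pos)
    then show ?thesis using * by linarith
  next
    case False
    define t where "t = sqrt (6 * s)"
    have t: "t \<ge> 1" using False by (simp add: t_def)
    have t2: "t\<^sup>2 = 6 * s" using s by (simp add: t_def)
    have le: "ln (6 * s) / ln q \<le> ln (6 * s) / ln 2"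
      using q False by (intro divide_left_mono) auto
    have "ln (6 * s) = 2 * ln t" using t by (simp add: ln_realpow flip: t2)
    \<comment> \<open>The tangent to \<open>ln\<close> at 2 is used rather than the one at 1, which
      would be too weak here.\<close>
    also have "ln t = ln (t / 2) + ln 2" using t by (simp add: ln_div)
    finally have lt: "ln (6 * s) = 2 * (ln (t / 2) + ln 2)" .
    have "5 * sqrt s < 1 + 2 * (ln (t / 2) + ln 2) / ln 2" using * le unfolding lt by linarith
    moreover have "2 * (ln (t / 2) + ln 2) / ln 2 \<le> 2 * (t / 2 - 1 + ln 2) / ln 2"
      using t ln_le_minus_one[of "t / 2"] by (intro divide_right_mono) auto
    \<comment> \<open>After squaring this is 24 s \<le> 25 s.\<close>
    moreover have "2 * t \<le> 5 * sqrt s"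
    proof (rule power2_le_imp_le)
      show "(2 * t)\<^sup>2 \<le> (5 * sqrt s)\<^sup>2" using s t2 by (simp add: power_mult_distrib)
    qed (use s in simp)
    ultimately have "2 * t < 1 + (t - 2 + 2 * ln 2) / ln 2" by (simp add: algebra_simps)
    then have "2 * t * ln 2 < ln 2 + (t - 2 + 2 * ln 2)" by (simp add: field_simps)
    moreover have "2 * t * ln 2 \<ge> 2 * t * (2 / 3)" using t ln2_ge_two_thirds by (intro mult_left_mono) auto
    ultimately have False using t ln2_le_25_over_36 by linarith
    then show ?thesis ..
  qed
  then show "sqrt (\<delta> / q) < 1 / 5" by (simp add: s_def)
  have "s < (1 / 5)\<^sup>2" using r s real_sqrt_less_iff[of s "(1 / 5)\<^sup>2"] by simp
  then have "25 * \<delta> < q" using q by (simp add: s_def power2_eq_square field_simps)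
  then show "q > 25" using \<delta> by linarith
qed

text \<open>With r = sqrt(\<delta>/q), the linearised exponential bound is used up to x = 1/r and
  the logarithmic bound afterwards. In units of e^\<gamma>, the first range contributes at most 1.2
  r, the jump at the switch at most 1.2 r, and the telescoping tail at most 1/n \<le> 1.25 r, which
  is well below 5 r.\<close>

lemma romanov_sum_sqrt:
  assumes small: "sqrt (\<delta> / q) < 1 / 5" "q > 25"
  shows "(\<Sum>x=1..X. (D x - D (x - 1)) / real x) \<le> 1 + exp euler_mascheroni * (5 * sqrt (\<delta> / q))"
proof (cases "X = 0")
  case False
  let ?e = "exp euler_mascheroni :: real"
  define s where "s = \<delta> / q"
  define r where "r = sqrt s"
  \<comment> \<open>Up to this index \<open>s * rad_bound x\<close> stays at most 1, so
    \<open>exp\<close> may be replaced by its chord on the unit interval.\<close>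
  define n where "n = nat \<lfloor>1 / r\<rfloor>"
  define B where "B = (\<lambda>x. if x = 0 then 0 else if x \<le> n then 1 + ?e * (s * rad_bound x)
    else 1 + ?e * (ln (\<delta> * rad_bound x) / ln q))"
  define W where "W = (\<lambda>X. \<Sum>x=1..X. (B x - B (x - 1)) / real x)"
  have s: "s > 0" using q \<delta> by (simp add: s_def)
  have r: "r > 0" "r < 1 / 5" "r\<^sup>2 = s" using s small by (auto simp: r_def s_def)
  have e: "?e \<ge> 174/100" by (rule exp_euler_mascheroni_ge)
  \<comment> \<open>This cancels the factor 2 in the telescoping increments of the second
    range.\<close>
  have lnq2: "ln q \<ge> 2"
  proof -
    have "exp 2 = exp (1::real) ^ 2" by (simp flip: exp_of_nat_mult)
    also have "\<dots> \<le> (272/100) ^ 2" using e_less_272 by (intro power_mono) auto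
    also have "\<dots> \<le> q" using small(2) by (simp add: power_divide)
    finally show ?thesis using q by (simp add: ln_ge_iff)
  qed
  have n1: "real n \<le> 1 / r" using r by (simp add: n_def)
  have n2: "1 / r < real n + 1" using r by (simp add: n_def)
  have "5 < 1 / r" using r by (simp add: field_simps)
  then have n5: "n \<ge> 5" using n2 by linarith
  have nr: "real n * r \<le> 1" using n1 r by (simp add: field_simps)
  have nr': "1 < (real n + 1) * r" using n2 r by (simp add: field_simps)
  have rb: "rad_bound x \<le> real x ^ 2" if "x \<ge> 2" for x
  proof -
    have "2 + y * (y - 1) / 2 \<le> y\<^sup>2" if "y \<ge> 2" for y :: real
    proof -
      have "2 * 2 \<le> y * y" using that by (intro mult_mono) auto
      then have "4 + y * y \<le> y + y * y + y * y" using that by linarith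
      then show ?thesis by (simp add: power2_eq_square field_simps)
    qed
    from this[of "real x"] that show ?thesis by (simp add: rad_bound_def)
  qed
  have le1: "s * rad_bound x \<le> 1" if "0 < x" "x \<le> n" for x
  \<comment> \<open>\<open>rad_bound 1 = 2\<close> is larger than 1 squared, so this index relies on
    s \<le> 1/25 instead.\<close>
  proof (cases "x = 1")
    case True
    have "s \<le> (1 / 5)\<^sup>2" using r by (subst r(3)[symmetric]) (intro power_mono, auto)
    then show ?thesis using True by (simp add: rad_bound_def power2_eq_square)
  next
    case False
    have "s * rad_bound x \<le> s * real x ^ 2" using rb[of x] s False that by (intro mult_left_mono) auto
    also have "\<dots> \<le> s * real n ^ 2" using s that by (intro mult_left_mono power_mono) auto
    also have "\<dots> = (real n * r)\<^sup>2" by (simp add: r(3) power_mult_distrib)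
    also have "\<dots> \<le> 1\<^sup>2" using nr r by (intro power_mono) auto
    finally show ?thesis by simp
  qed
  have "(\<Sum>x=1..X. (D x - D (x - 1)) / real x) \<le> W X"
    unfolding W_def
  proof (rule sum_diff_quotient_mono)
    fix x :: nat assume x: "x > 0"
    show "D x \<le> B x"
    proof (cases "x \<le> n")
      case True
      have rb0: "rad_bound x \<ge> 2" using x by (rule rad_bound_ge)
      have "D x \<le> exp (s * rad_bound x)" using D_exp[OF x] by (simp add: s_def)
      also have "\<dots> \<le> 1 + 172/100 * (s * rad_bound x)" using le1[OF x True] s rb0
        by (intro exp_le_chord_0_1) auto
      also have "\<dots> \<le> 1 + ?e * (s * rad_bound x)" using e s rb0
        by (intro add_left_mono mult_right_mono) auto
      finally show ?thesis using True x by (simp add: B_def)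
    qed (use D_log[OF x] x in \<open>simp add: B_def\<close>)
  qed (simp add: D0 B_def)
  have W_Suc: "W (Suc X) = W X + (B (Suc X) - B X) / real (Suc X)" for X by (simp add: W_def)
  have W_small: "W X \<le> 1 + ?e * (s * (real X + 1))" if "1 \<le> X" "X \<le> n" for X
    using that
  proof (induction X rule: dec_induct)
    case base
    then show ?case using n5 by (simp add: W_def B_def rad_bound_def)
  next
    case (step X)
    have "B (Suc X) - B X = ?e * s * real X"
      using step by (simp add: B_def rad_bound_Suc algebra_simps)
    then have "(B (Suc X) - B X) / real (Suc X) \<le> ?e * s"
      using s by (simp add: field_simps)
    moreover have "W X \<le> 1 + ?e * (s * (real X + 1))" using step by simp
    ultimately show ?case by (simp add: W_Suc algebra_simps)
  qed
  have Wn: "W n \<le> 1 + ?e * (12/10 * r)"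
  proof -
    have "W n \<le> 1 + ?e * (s * (real n + 1))" using n5 by (intro W_small) auto
    also have "s * (real n + 1) = r * (real n * r) + r * r"
      by (simp add: algebra_simps power2_eq_square flip: r(3))
    also have "\<dots> \<le> r * 1 + r * (1 / 5)" using r nr by (intro add_mono mult_left_mono) auto
    finally show ?thesis by (simp add: algebra_simps)
  qed
  \<comment> \<open>Just past the switch \<open>s * rad_bound\<close> is at most (1+r)^2, whose
    logarithm is at most 2r < 4/10; division by \<open>ln q \<ge> 2\<close> leaves an excess of 2/10
    over 1.\<close>
  have BSn: "B (Suc n) \<le> 1 + ?e * (12/10)"
  proof -
    have rbn: "rad_bound (Suc n) \<ge> 2" by (intro rad_bound_ge) auto
    have "s * rad_bound (Suc n) \<le> s * real (Suc n) ^ 2" using rb[of "Suc n"] s n5 by (intro mult_left_mono) auto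
    also have "\<dots> = (real n * r + r) ^ 2" by (simp add: algebra_simps power2_eq_square flip: r(3))
    also have "\<dots> \<le> (1 + r) ^ 2" using nr r by (intro power_mono) auto
    finally have "ln (s * rad_bound (Suc n)) \<le> ln ((1 + r) ^ 2)" using s rbn by (intro ln_mono) auto
    also have "\<dots> = 2 * ln (1 + r)" using r by (simp add: ln_realpow)
    also have "\<dots> \<le> 2 * r" using r ln_add_one_self_le_self[of r] by simp
    finally have "ln (s * rad_bound (Suc n)) \<le> 4/10" using r by simp
    then have "ln (s * rad_bound (Suc n)) / ln q \<le> (4/10) / ln q" using lnq2 by (intro divide_right_mono) auto
    also have "\<dots> \<le> (4/10) / 2" using lnq2 by (intro divide_left_mono) auto
    finally have "1 + ln (s * rad_bound (Suc n)) / ln q \<le> 12/10" by simp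
    moreover have "ln (\<delta> * rad_bound (Suc n)) / ln q = 1 + ln (s * rad_bound (Suc n)) / ln q"
    proof -
      have eq: "\<delta> * rad_bound (Suc n) = q * (s * rad_bound (Suc n))" using q by (simp add: s_def)
      have "ln (\<delta> * rad_bound (Suc n)) = ln q + ln (s * rad_bound (Suc n))"
        unfolding eq using q s rbn by (intro ln_mult_pos) auto
      then show ?thesis using lnq2 by (simp add: add_divide_distrib)
    qed
    ultimately have "?e * (ln (\<delta> * rad_bound (Suc n)) / ln q) \<le> ?e * (12/10)" by (intro mult_left_mono) auto
    then show ?thesis by (simp add: B_def)
  qed
  have W_large: "W X \<le> 1 + ?e * (24/10 * r + (1 / real n - 1 / (real X - 1)))" if "X \<ge> Suc n" for X
    using that
  proof (induction X rule: dec_induct)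
    case base
    have "B n \<ge> 1" using n5 s rad_bound_ge[of n] by (simp add: B_def)
    then have "(B (Suc n) - B n) / real (Suc n) \<le> ?e * (12/10) / real (Suc n)"
      using BSn by (intro divide_right_mono) auto
    also have "\<dots> = ?e * (12/10) * (1 / real (Suc n))" by simp
    also have "\<dots> \<le> ?e * (12/10) * r"
    proof (rule mult_left_mono)
      show "1 / real (Suc n) \<le> r" using nr' by (simp add: field_simps)
    qed simp
    finally have "W (Suc n) \<le> 1 + ?e * (12/10 * r) + ?e * (12/10) * r"
      unfolding W_Suc using Wn by (intro add_mono)
    then show ?case by (simp add: algebra_simps)
  next
    case (step X)
    have X2: "X \<ge> 2" using step n5 by simp
    have rX: "rad_bound X \<ge> 2" "rad_bound (Suc X) \<ge> 2" using X2 by (auto intro!: rad_bound_ge)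
    have "B (Suc X) - B X = ?e * ((ln (\<delta> * rad_bound (Suc X)) - ln (\<delta> * rad_bound X)) / ln q)"
      using step by (simp add: B_def right_diff_distrib diff_divide_distrib)
    also have "ln (\<delta> * rad_bound (Suc X)) - ln (\<delta> * rad_bound X) = ln (rad_bound (Suc X) / rad_bound X)"
      using rX \<delta> by (simp add: ln_mult ln_div)
    finally have "(B (Suc X) - B X) / real (Suc X) =
        ?e * ((ln (rad_bound (Suc X) / rad_bound X) / real (Suc X)) / ln q)" by simp
    also have "\<dots> \<le> ?e * ((2 * (1 / (real X - 1) - 1 / real X)) / ln q)"
      using lnq2 ln_rad_bound_increment[OF X2] by (intro mult_left_mono divide_right_mono) auto
    also have "\<dots> \<le> ?e * ((2 * (1 / (real X - 1) - 1 / real X)) / 2)"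
    proof (intro mult_left_mono divide_left_mono)
      show "0 \<le> 2 * (1 / (real X - 1) - 1 / real X)" using X2 by (simp add: frac_le)
    qed (use lnq2 in auto)
    also have "\<dots> = ?e * (1 / (real X - 1) - 1 / real X)" by simp
    finally have "(B (Suc X) - B X) / real (Suc X) \<le> ?e * (1 / (real X - 1) - 1 / real X)" .
    then have "W (Suc X) \<le> 1 + ?e * (24/10 * r + (1 / real n - 1 / (real X - 1))) + ?e * (1 / (real X - 1) - 1 / real X)"
      unfolding W_Suc using step.IH by linarith
    also have "\<dots> = 1 + ?e * (24/10 * r + (1 / real n - 1 / (real (Suc X) - 1)))"
      by (simp add: algebra_simps)
    finally show ?case .
  qed
  have "W X \<le> 1 + ?e * (5 * r)"
  proof (cases "X \<le> n")
    case True
    have "W X \<le> 1 + ?e * (s * (real X + 1))" using False True by (intro W_small) auto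
    also have "\<dots> \<le> 1 + ?e * (s * (real n + 1))" using True s by (intro add_left_mono mult_left_mono) auto
    also have "s * (real n + 1) = r * (real n * r) + r * r"
      by (simp add: algebra_simps power2_eq_square flip: r(3))
    also have "1 + ?e * (r * (real n * r) + r * r) \<le> 1 + ?e * (5 * r)"
    proof (intro add_left_mono mult_left_mono)
      have "r * (real n * r) + r * r \<le> r * 1 + r * (1 / 5)" using r nr by (intro add_mono mult_left_mono) auto
      then show "r * (real n * r) + r * r \<le> 5 * r" using r by linarith
    qed simp
    finally show ?thesis .
  next
    case False
    have "1 / real n \<le> 5/4 * r"
    proof -
      have "4/5 \<le> real n * r" using nr' r by (simp add: algebra_simps)
      then show ?thesis using n5 by (simp add: field_simps)
    qed
    moreover have "1 / (real X - 1) \<ge> 0" using False by simp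
    ultimately have "24/10 * r + (1 / real n - 1 / (real X - 1)) \<le> 5 * r" using r by linarith
    then have "1 + ?e * (24/10 * r + (1 / real n - 1 / (real X - 1))) \<le> 1 + ?e * (5 * r)"
      by (intro add_left_mono mult_left_mono) auto
    moreover have "W X \<le> 1 + ?e * (24/10 * r + (1 / real n - 1 / (real X - 1)))"
      using False by (intro W_large) auto
    ultimately show ?thesis by linarith
  qed
  with \<open>_ \<le> W X\<close> show ?thesis by (simp add: r_def s_def)
qed (use q \<delta> in simp)

lemma romanov_sum_le:
  "(\<Sum>x=1..X. (D x - D (x - 1)) / real x) \<le>
    1 + exp euler_mascheroni * min (5 * sqrt (\<delta> / q)) (ln (6 * \<delta>) / ln q)"
proof (cases "5 * sqrt (\<delta> / q) < ln (6 * \<delta>) / ln q")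
  case True
  then show ?thesis using romanov_sum_sqrt[OF sqrt_ratio_small] by simp
next
  case False
  then have "min (5 * sqrt (\<delta> / q)) (ln (6 * \<delta>) / ln q) = ln (6 * \<delta>) / ln q" by simp
  then show ?thesis using romanov_sum_log by (simp only:)
qed

end

section \<open>Products over the prime divisors of a polynomial\<close>

text \<open>A linear-programming bound. The multiplier \<open>l\<close> charges for degree so that
  \<open>f\<close> vanishes at degree \<open>m + 1\<close>, is nonnegative below and nonpositive
  above. The sum of \<open>f\<close> over \<open>U\<close> is thus largest when \<open>U\<close>
  consists of all primes of degree at most \<open>m\<close>, for any choice of
  \<open>m\<close>.\<close>

lemma sum_inverse_norm_le:
  fixes U :: "'a::{finite,field} poly set"
  defines "q \<equiv> real CARD('a)"
  assumes U: "finite U" "U \<subseteq> monic_irr" and M: "real (\<Sum>P\<in>U. degree P) \<le> M"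
  shows "(\<Sum>P\<in>U. 1 / q ^ degree P) \<le> harm m + (M - (\<Sum>d=1..m. q ^ d)) / (real (Suc m) * q ^ Suc m)"
proof -
  define l where "l = 1 / (real (Suc m) * q ^ Suc m)"
  define f where "f = (\<lambda>d. 1 / q ^ d - l * real d)"
  have q: "q \<ge> 2" using card_field_ge_2[where 'a='a] by (simp add: q_def)
  have l: "l \<ge> 0" using q by (simp add: l_def)
  have mono: "real d * q ^ d \<le> real e * q ^ e" if "d \<le> e" for d e
    using that q by (intro mult_mono power_increasing) auto
  have f_alt: "f d = (1 - l * (real d * q ^ d)) / q ^ d" for d
    using q by (simp add: f_def field_simps)
  have f_nonneg: "f d \<ge> 0" if "d \<le> m" for d
  proof -
    have "l * (real d * q ^ d) \<le> l * (real (Suc m) * q ^ Suc m)"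
      using that l by (intro mult_left_mono mono) auto
    also have "\<dots> = 1" using q by (simp add: l_def del: power_Suc of_nat_Suc)
    finally show ?thesis using q by (simp add: f_alt)
  qed
  have f_nonpos: "f d \<le> 0" if "d > m" for d
  proof -
    have "1 = l * (real (Suc m) * q ^ Suc m)" using q by (simp add: l_def del: power_Suc of_nat_Suc)
    also have "\<dots> \<le> l * (real d * q ^ d)"
      using that l by (intro mult_left_mono mono) auto
    finally show ?thesis using q by (simp add: f_alt divide_nonpos_pos)
  qed
  let ?B = "{P \<in> monic_irr :: 'a poly set. degree P \<le> m}"
  have finB: "finite ?B" by (rule finite_monic_irr_degree_le)
  have "(\<Sum>P\<in>U. f (degree P)) = (\<Sum>P\<in>U \<inter> ?B. f (degree P)) + (\<Sum>P\<in>U - ?B. f (degree P))"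
    using U by (intro sum.Int_Diff)
  also have "(\<Sum>P\<in>U - ?B. f (degree P)) \<le> 0"
    using U by (intro sum_nonpos f_nonpos) auto
  also have "(\<Sum>P\<in>U \<inter> ?B. f (degree P)) \<le> (\<Sum>P\<in>?B. f (degree P))"
    using finB f_nonneg by (intro sum_mono2) auto
  also have "(\<Sum>P\<in>?B. f (degree P)) = (\<Sum>d\<in>{1..m}. \<Sum>P\<in>{P\<in>?B. degree P = d}. f (degree P))"
    by (intro sum.group[symmetric] finB) (auto dest: monic_irr_degree_pos simp: Suc_le_eq)
  also have "\<dots> = (\<Sum>d\<in>{1..m}. real (irr_count TYPE('a) d) * f d)"
  proof (intro sum.cong refl)
    fix d assume "d \<in> {1..m}"
    then have "{P\<in>?B. degree P = d} = {P \<in> monic_irr. degree P = d}" by auto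
    then show "(\<Sum>P\<in>{P\<in>?B. degree P = d}. f (degree P)) = real (irr_count TYPE('a) d) * f d"
      by (simp add: irr_count_def)
  qed
  also have "\<dots> \<le> (\<Sum>d\<in>{1..m}. q ^ d / real d * f d)"
  proof (intro sum_mono mult_right_mono f_nonneg)
    fix d assume d: "d \<in> {1..m}"
    then have "real (d * irr_count TYPE('a) d) \<le> real (CARD('a) ^ d)"
      by (intro of_nat_mono irr_count_upper) auto
    then show "real (irr_count TYPE('a) d) \<le> q ^ d / real d"
      using d by (simp add: q_def field_simps)
  qed auto
  also have "\<dots> = (\<Sum>d\<in>{1..m}. inverse (real d) - l * q ^ d)"
    using q by (intro sum.cong refl) (auto simp: f_def field_simps)
  also have "\<dots> = harm m - l * (\<Sum>d=1..m. q ^ d)"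
    by (simp add: sum_subtractf harm_def sum_distrib_left)
  finally have "(\<Sum>P\<in>U. f (degree P)) \<le> harm m - l * (\<Sum>d=1..m. q ^ d)" by simp
  moreover have "(\<Sum>P\<in>U. f (degree P)) = (\<Sum>P\<in>U. 1 / q ^ degree P) - l * real (\<Sum>P\<in>U. degree P)"
    by (simp add: f_def sum_subtractf sum_distrib_left)
  moreover have "l * real (\<Sum>P\<in>U. degree P) \<le> l * M" using M l by (intro mult_left_mono)
  ultimately have "(\<Sum>P\<in>U. 1 / q ^ degree P) \<le> harm m + (l * M - l * (\<Sum>d=1..m. q ^ d))" by linarith
  also have "l * M - l * (\<Sum>d=1..m. q ^ d) = (M - (\<Sum>d=1..m. q ^ d)) / (real (Suc m) * q ^ Suc m)"
    by (simp add: l_def diff_divide_distrib)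
  finally show ?thesis .
qed

lemma prod_one_plus_le_exp:
  fixes z :: "'b \<Rightarrow> real"
  assumes "\<And>x. x \<in> A \<Longrightarrow> z x \<ge> 0"
  shows "(\<Prod>x\<in>A. 1 + z x) \<le> exp (\<Sum>x\<in>A. z x)"
proof (cases "finite A")
  case True
  have "(\<Prod>x\<in>A. 1 + z x) \<le> (\<Prod>x\<in>A. exp (z x))"
    using assms by (intro prod_mono) (auto intro: add_nonneg_nonneg)
  with True show ?thesis by (simp add: exp_sum)
qed simp

text \<open>The exponential bound is the choice \<open>m = 0\<close> of the free parameter; the
  logarithmic one, for \<open>M > q\<close>, takes \<open>m\<close> with
  \<open>q ^ m \<le> M \<le> q ^ Suc m\<close>.\<close>

lemma prod_one_plus_norm_le:
  fixes U :: "'a::{finite,field} poly set"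
  defines "q \<equiv> real CARD('a)"
  assumes U: "finite U" "U \<subseteq> monic_irr" and M: "real (\<Sum>P\<in>U. degree P) \<le> M" "M \<ge> 2"
  shows "(\<Prod>P\<in>U. 1 + 1 / q ^ degree P) \<le> exp (M / q)"
    and "(\<Prod>P\<in>U. 1 + 1 / q ^ degree P) \<le> 1 + exp euler_mascheroni * (ln M / ln q)"
proof -
  have q: "q \<ge> 2" using card_field_ge_2[where 'a='a] by (simp add: q_def)
  have exp_le: "(\<Prod>P\<in>U. 1 + 1 / q ^ degree P) \<le> exp (\<Sum>P\<in>U. 1 / q ^ degree P)"
    using q by (intro prod_one_plus_le_exp) auto
  note sum_le = sum_inverse_norm_le[OF U M(1), folded q_def]
  have "(\<Sum>P\<in>U. 1 / q ^ degree P) \<le> M / q" using sum_le[of 0] by (simp add: harm_def)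
  with exp_le show le0: "(\<Prod>P\<in>U. 1 + 1 / q ^ degree P) \<le> exp (M / q)"
    by (meson exp_le_cancel_iff order_trans)
  show "(\<Prod>P\<in>U. 1 + 1 / q ^ degree P) \<le> 1 + exp euler_mascheroni * (ln M / ln q)"
  proof (cases "M \<le> q")
    case True
    have "exp (M / q) \<le> 1 + exp euler_mascheroni * (ln M / ln q)"
      using True M q by (intro exp_le_log_bound_0[of _ "CARD('a)"]) (auto simp: q_def)
    with le0 show ?thesis by linarith
  next
    case False
    define N where "N = (LEAST n. M < q ^ n)"
    have ex: "\<exists>n. M < q ^ n" using q by (intro real_arch_pow) auto
    have N: "M < q ^ N" unfolding N_def using ex by (rule LeastI_ex)
    have "N \<noteq> 0" "N \<noteq> 1"
    proof -
      show "N \<noteq> 0" using N M by (intro notI) simp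
      show "N \<noteq> 1" using N False by (intro notI) simp
    qed
    then obtain m where m: "N = Suc m" "m > 0" by (cases N) auto
    have "\<not> M < q ^ m" using not_less_Least[of m "\<lambda>n. M < q ^ n"] m by (simp add: N_def)
    then have qm: "q ^ m \<le> M" "M \<le> q ^ Suc m" using N m by auto
    have "q ^ m \<le> (\<Sum>d=1..m. q ^ d)" using m q by (intro member_le_sum) auto
    then have "(M - (\<Sum>d=1..m. q ^ d)) / (real (Suc m) * q ^ Suc m) \<le> (M - q ^ m) / (real (Suc m) * q ^ Suc m)"
      using q by (intro divide_right_mono) auto
    then have "(\<Sum>P\<in>U. 1 / q ^ degree P) \<le> harm m + (M - q ^ m) / (real (Suc m) * q ^ Suc m)"
      using sum_le[of m] by linarith
    then have "exp (\<Sum>P\<in>U. 1 / q ^ degree P) \<le> exp (harm m + (M - q ^ m) / (real (Suc m) * q ^ Suc m))"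
      by simp
    also have "\<dots> \<le> 1 + exp euler_mascheroni * (ln M / ln q)"
      using q qm by (intro exp_le_log_bound_pos)
    finally show ?thesis using exp_le by linarith
  qed
qed

section \<open>The Romanov average\<close>

text \<open>A prime dividing \<open>g\<close> divides no \<open>g ^ e - 1\<close> with
  \<open>e > 0\<close>; the extra factor \<open>g\<close> gives such primes the order 1 instead of
  none.\<close>

definition romanov_poly :: "'a::field poly \<Rightarrow> nat \<Rightarrow> 'a poly" where
  "romanov_poly g e = g * (g ^ e - 1)"

text \<open>The multiplicative order of \<open>g\<close> modulo the product of those primes in
  \<open>T\<close> that do not divide \<open>g\<close>. It is applied only to sets with a known
  admissible exponent.\<close>

definition poly_ord :: "'a::field poly \<Rightarrow> 'a poly set \<Rightarrow> nat" where
  "poly_ord g T = (LEAST e. e > 0 \<and> T \<subseteq> prime_divs (romanov_poly g e))"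

text \<open>As for orders in a group: the remainder of an admissible exponent modulo the least one
  would again be admissible, so it must be 0.\<close>

lemma poly_ord_props:
  assumes "e > 0" "T \<subseteq> prime_divs (romanov_poly g e)"
  shows "poly_ord g T > 0" "T \<subseteq> prime_divs (romanov_poly g (poly_ord g T))"
    "poly_ord g T \<le> e" "poly_ord g T dvd e"
proof -
  let ?o = "poly_ord g T"
  let ?Q = "\<lambda>e. e > 0 \<and> T \<subseteq> prime_divs (romanov_poly g e)"
  have ex: "e > 0 \<and> T \<subseteq> prime_divs (romanov_poly g e)" using assms by simp
  have *: "?o > 0 \<and> T \<subseteq> prime_divs (romanov_poly g ?o)"
    unfolding poly_ord_def by (rule LeastI[of ?Q, OF ex])
  then show o: "?o > 0" "T \<subseteq> prime_divs (romanov_poly g ?o)" by auto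
  show "?o \<le> e" unfolding poly_ord_def by (rule Least_le[of ?Q, OF ex])
  show "?o dvd e"
  proof (rule ccontr)
    assume "\<not> ?o dvd e"
    define r where "r = e mod ?o"
    have r: "0 < r" "r < ?o" using \<open>\<not> ?o dvd e\<close> o(1) by (auto simp: r_def mod_greater_zero_iff_not_dvd)
    have "T \<subseteq> prime_divs (romanov_poly g r)"
    proof
      fix P assume "P \<in> T"
      then have P: "P \<in> monic_irr" "P dvd romanov_poly g e" "P dvd romanov_poly g ?o"
        using assms(2) o(2) by (auto simp: prime_divs_def)
      have "P dvd g \<or> P dvd g ^ r - 1"
      proof (cases "P dvd g")
        case False
        then have 1: "P dvd g ^ e - 1" "P dvd g ^ ?o - 1"
          using P by (auto simp: romanov_poly_def monic_irr_dvd_mult_iff)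
        have "g ^ ?o - 1 dvd (g ^ ?o) ^ (e div ?o) - 1"
          by (simp add: power_diff_1_eq)
        then have 2: "P dvd (g ^ ?o) ^ (e div ?o) - 1" using 1(2) dvd_trans by blast
        have "e = ?o * (e div ?o) + r" by (simp add: r_def)
        then have "g ^ e = (g ^ ?o) ^ (e div ?o) * g ^ r" by (metis power_add power_mult)
        then have eq: "g ^ r - 1 = (g ^ e - 1) - g ^ r * ((g ^ ?o) ^ (e div ?o) - 1)" by (simp add: algebra_simps)
        have "P dvd g ^ r - 1" by (subst eq) (intro dvd_diff dvd_mult 1(1) 2)
        then show ?thesis ..
      qed simp
      then show "P \<in> prime_divs (romanov_poly g r)" using P(1)
        by (auto simp: prime_divs_def romanov_poly_def)
    qed
    with r(1) have "?o \<le> r" unfolding poly_ord_def by (intro Least_le) simp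
    with r show False by simp
  qed
qed

text \<open>Distinct primes are counted once each, so the degree of any common multiple of the
  polynomials \<open>romanov_poly g e\<close> is a bound. In \<open>F x\<close> their shared factors
  \<open>g\<close> and \<open>g - 1\<close> occur once instead of \<open>x\<close> times.\<close>

lemma sum_degree_romanov:
  fixes g :: "'a::{finite,field} poly"
  assumes g: "degree g > 0"
  defines "U \<equiv> \<lambda>x. \<Union>e\<in>{1..x}. prime_divs (romanov_poly g e)"
  assumes x: "x > 0"
  shows "finite (U x)" "U x \<subseteq> monic_irr" "real (\<Sum>P\<in>U x. degree P) \<le> real (degree g) * rad_bound x"
proof -
  let ?c = "\<lambda>e. \<Sum>i<e. g ^ i"
  define F where "F = (\<lambda>x. g * ((g - 1) * (\<Prod>e=1..x. ?c e)))"
  have deg1: "degree (g ^ e - 1) = e * degree g" if "e > 0" for e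
  proof -
    have "g \<noteq> 0" using g by auto
    then have "degree (- 1 :: 'a poly) < degree (g ^ e)" using g that by (simp add: degree_power_eq)
    then have "degree (g ^ e + (- 1)) = degree (g ^ e)" by (rule degree_add_eq_left)
    with \<open>g \<noteq> 0\<close> show ?thesis by (simp add: degree_power_eq)
  qed
  have factor: "g ^ e - 1 = (g - 1) * ?c e" for e by (rule power_diff_1_eq)
  have g1: "degree (g - 1) = degree g" using deg1[of 1] by simp
  have c: "?c e \<noteq> 0 \<and> degree (?c e) = (e - 1) * degree g" if "e > 0" for e
  proof -
    have d: "degree ((g - 1) * ?c e) = e * degree g" using deg1[OF that] factor[of e] by simp
    have "?c e \<noteq> 0"
    proof
      assume "?c e = 0"
      then show False using d g that by simp
    qed
    moreover have "g - 1 \<noteq> 0" using g1 g by auto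
    ultimately have "degree g + degree (?c e) = e * degree g" using d g1 by (simp add: degree_mult_eq)
    then have "degree (?c e) = (e - 1) * degree g" by (simp add: diff_mult_distrib)
    with \<open>?c e \<noteq> 0\<close> show ?thesis by simp
  qed
  have g0: "g \<noteq> 0" "g - 1 \<noteq> 0" using g g1 by auto
  have F0: "F x \<noteq> 0" using g0 c by (auto simp: F_def)
  have "degree (\<Prod>e=1..x. ?c e) = (\<Sum>e=1..x. degree (?c e))"
    using c by (intro degree_prod_eq_sum_degree) auto
  also have "\<dots> = (\<Sum>e=1..x. (e - 1) * degree g)" using c by (intro sum.cong) auto
  finally have "degree (F x) = degree g + (degree g + (\<Sum>e=1..x. (e - 1) * degree g))"
    using g0 c g1 by (simp add: F_def degree_mult_eq)
  moreover have "real (\<Sum>e=1..x. (e - 1) * degree g) = real (degree g) * (real x * (real x - 1) / 2)" for x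
    by (induction x) (auto simp: field_simps)
  ultimately have degF: "real (degree (F x)) = real (degree g) * rad_bound x"
    by (simp add: rad_bound_def algebra_simps)
  show sub: "U x \<subseteq> monic_irr" by (auto simp: U_def prime_divs_def)
  have dvd: "P dvd F x" if "P \<in> U x" for P
  proof -
    obtain e where e: "e \<in> {1..x}" "P \<in> prime_divs (romanov_poly g e)"
      using \<open>P \<in> U x\<close> by (auto simp: U_def)
    have "P dvd romanov_poly g e" using e by (simp add: prime_divs_def)
    also have "romanov_poly g e = g * ((g - 1) * ?c e)" by (simp add: romanov_poly_def factor)
    also have "\<dots> dvd F x" unfolding F_def using e(1)
      by (intro mult_dvd_mono dvd_refl dvd_prodI) auto
    finally show ?thesis .
  qed
  have "U x \<subseteq> prime_divs (F x)" using sub dvd by (auto simp: prime_divs_def)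
  then show fin: "finite (U x)" using finite_prime_divs[OF F0] finite_subset by blast
  have "(\<Sum>P\<in>U x. degree P) \<le> degree (F x)" using fin sub dvd F0 by (intro sum_degree_le)
  then have "real (\<Sum>P\<in>U x. degree P) \<le> real (degree (F x))" by (rule of_nat_mono)
  with degF show "real (\<Sum>P\<in>U x. degree P) \<le> real (degree g) * rad_bound x" by linarith
qed

text \<open>\<open>(i - j) + (j - i)\<close> is the distance of \<open>i\<close> and
  \<open>j\<close> under truncated subtraction. There are at most i/d solutions below
  \<open>i\<close> and (K-1-i)/d above; leaving out \<open>j = i\<close> avoids an additional
  1.\<close>

lemma card_multiples_le:
  assumes d: "d > 0" and i: "i < K"
  shows "real (card {j. j < K \<and> j \<noteq> i \<and> d dvd (i - j) + (j - i)}) \<le> real K / real d"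
proof -
  let ?A = "{j. j < K \<and> j \<noteq> i \<and> d dvd (i - j) + (j - i)}"
  have "?A \<subseteq> (\<lambda>t. i + d * t) ` {1..(K - 1 - i) div d} \<union> (\<lambda>t. i - d * t) ` {1..i div d}"
  proof
    fix j assume j: "j \<in> ?A"
    show "j \<in> (\<lambda>t. i + d * t) ` {1..(K - 1 - i) div d} \<union> (\<lambda>t. i - d * t) ` {1..i div d}"
    proof (cases "i < j")
      case True
      with j obtain t where t: "j - i = d * t" by (auto elim: dvdE)
      with True have "t > 0" by (auto intro!: Nat.gr0I)
      moreover have "d * t \<le> K - 1 - i" using t j True by auto
      then have "t \<le> (K - 1 - i) div d" using d by (simp add: less_eq_div_iff_mult_less_eq mult.commute)
      moreover have "j = i + d * t" using t True by simp
      ultimately show ?thesis by auto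
    next
      case False
      with j obtain t where t: "i - j = d * t" by (auto elim: dvdE)
      have "t > 0" using t False j by (intro Nat.gr0I) auto
      moreover have "d * t \<le> i" using t by simp
      then have "t \<le> i div d" using d by (simp add: less_eq_div_iff_mult_less_eq mult.commute)
      moreover have "j = i - d * t" using t False by simp
      ultimately show ?thesis by auto
    qed
  qed
  then have "card ?A \<le> card ((\<lambda>t. i + d * t) ` {1..(K - 1 - i) div d} \<union> (\<lambda>t. i - d * t) ` {1..i div d})"
    by (intro card_mono) auto
  also have "\<dots> \<le> card ((\<lambda>t. i + d * t) ` {1..(K - 1 - i) div d}) + card ((\<lambda>t. i - d * t) ` {1..i div d})"
    by (rule card_Un_le)
  also have "\<dots> \<le> card {1..(K - 1 - i) div d} + card {1..i div d}"
    by (intro add_mono card_image_le) auto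
  finally have "real (card ?A) \<le> real ((K - 1 - i) div d) + real (i div d)"
    by (simp flip: of_nat_add)
  also have "\<dots> \<le> real (K - 1 - i) / real d + real i / real d"
    by (intro add_mono of_nat_div_le_of_nat)
  also have "\<dots> \<le> real K / real d" using i d by (simp add: divide_right_mono flip: add_divide_distrib)
  finally show ?thesis .
qed

lemma romanov_average:
  fixes g :: "'a::{finite,field} poly" and K :: nat
  defines "q \<equiv> real CARD('a)" and "\<delta> \<equiv> real (degree g)"
  assumes g: "degree g > 0"
  shows "(\<Sum>i<K. \<Sum>j\<in>{..<K} - {i}. \<Prod>P\<in>prime_divs (g ^ i - g ^ j). 1 + 1 / q ^ degree P) \<le>
    real K ^ 2 * (1 + exp euler_mascheroni * min (5 * sqrt (\<delta> / q)) (ln (6 * \<delta>) / ln q))"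
proof -
  let ?z = "\<lambda>P :: 'a poly. 1 / q ^ degree P" and ?o = "poly_ord g"
  let ?Z = "\<lambda>T :: 'a poly set. \<Prod>P\<in>T. ?z P"
  define dist where "dist = (\<lambda>i j :: nat. (i - j) + (j - i))"
  define U where "U x = (\<Union>e\<in>{1..x}. prime_divs (romanov_poly g e))" for x
  define TT where "TT = {T. \<exists>e\<in>{1..K}. T \<subseteq> prime_divs (romanov_poly g e)}"
  define D where "D = (\<lambda>x. \<Sum>T | T \<in> TT \<and> ?o T \<le> x. ?Z T)"
  have q: "q \<ge> 2" using card_field_ge_2[where 'a='a] by (simp add: q_def)
  have \<delta>: "\<delta> \<ge> 1" using g by (simp add: \<delta>_def)
  note U_props = sum_degree_romanov[OF g, folded U_def \<delta>_def]
  \<comment> \<open>\<open>Suc K\<close> rather than \<open>K\<close>, because the finiteness of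
    \<open>U\<close> is available for positive indices and \<open>K\<close> may be 0.\<close>
  have TT_sub: "TT \<subseteq> Pow (U (Suc K))" by (fastforce simp: TT_def U_def)
  have finTT: "finite TT" using finite_subset[OF TT_sub] U_props(1)[of "Suc K"] by blast
  have Z_nonneg: "?Z T \<ge> 0" for T using q by (intro prod_nonneg) auto
  have TT_ord: "?o T \<in> {1..K}" "T \<subseteq> prime_divs (romanov_poly g (?o T))" if "T \<in> TT" for T
  proof -
    obtain e where e: "e \<in> {1..K}" "T \<subseteq> prime_divs (romanov_poly g e)" using \<open>T \<in> TT\<close> by (auto simp: TT_def)
    with poly_ord_props[of e T g] show "?o T \<in> {1..K}" "T \<subseteq> prime_divs (romanov_poly g (?o T))" by auto
  qed
  have r0: "romanov_poly g e \<noteq> 0" if "e > 0" for e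
  proof -
    have "g \<noteq> 0" using g by auto
    then have "degree (g ^ e) > 0" using g that by (simp add: degree_power_eq)
    then have "g ^ e \<noteq> 1" by auto
    with \<open>g \<noteq> 0\<close> show ?thesis by (simp add: romanov_poly_def)
  qed
  \<comment> \<open>Up to sign and a power of \<open>g\<close>, the difference is
    \<open>g ^ dist i j - 1\<close>, so its primes divide \<open>romanov_poly g (dist i j)\<close>;
    the product then expands over all sets \<open>T\<close> of such primes, and each order divides
    the distance.\<close>
  have pair: "(\<Prod>P\<in>prime_divs (g ^ i - g ^ j). 1 + ?z P) \<le> (\<Sum>T | T \<in> TT \<and> ?o T dvd dist i j. ?Z T)"
    if ij: "i < K" "j < K" "i \<noteq> j" for i j
  proof -
    let ?e = "dist i j"
    have e: "?e > 0" "?e \<le> K" using ij by (auto simp: dist_def)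
    have sub: "prime_divs (g ^ i - g ^ j) \<subseteq> prime_divs (romanov_poly g ?e)"
    proof
      fix P assume "P \<in> prime_divs (g ^ i - g ^ j)"
      then have P: "P \<in> monic_irr" "P dvd g ^ i - g ^ j" by (auto simp: prime_divs_def)
      have "P dvd g ^ min i j * (g ^ ?e - 1)"
      proof (cases "i < j")
        case True
        then have "g ^ i - g ^ j = - (g ^ min i j * (g ^ ?e - 1))"
          by (simp add: dist_def algebra_simps flip: power_add)
        with P(2) show ?thesis by (metis dvd_minus_iff)
      next
        case False
        then have "g ^ i - g ^ j = g ^ min i j * (g ^ ?e - 1)"
          by (simp add: dist_def algebra_simps flip: power_add)
        with P(2) show ?thesis by simp
      qed
      then have "P dvd g \<or> P dvd g ^ ?e - 1"
        using P(1) monic_irr_prime_elem[of P] prime_elem_dvd_power[of P g]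
        by (auto simp: monic_irr_dvd_mult_iff)
      with P(1) show "P \<in> prime_divs (romanov_poly g ?e)"
        by (auto simp: prime_divs_def romanov_poly_def)
    qed
    have fin: "finite (prime_divs (romanov_poly g ?e))" by (intro finite_prime_divs r0 e)
    have "(\<Prod>P\<in>prime_divs (g ^ i - g ^ j). 1 + ?z P) \<le> (\<Prod>P\<in>prime_divs (romanov_poly g ?e). 1 + ?z P)"
      using sub fin q by (intro prod_mono2) (auto intro: add_nonneg_nonneg)
    also have "\<dots> = (\<Prod>P\<in>prime_divs (romanov_poly g ?e). ?z P + 1)" by (simp add: add.commute)
    also have "\<dots> = (\<Sum>T\<in>Pow (prime_divs (romanov_poly g ?e)). ?Z T)"
      using fin by (subst prod_add) auto
    also have "\<dots> \<le> (\<Sum>T | T \<in> TT \<and> ?o T dvd ?e. ?Z T)"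
    proof (rule sum_mono2)
      show "finite {T \<in> TT. ?o T dvd ?e}" using finTT by simp
      show "Pow (prime_divs (romanov_poly g ?e)) \<subseteq> {T \<in> TT. ?o T dvd ?e}"
      proof clarify
        fix T assume T: "T \<subseteq> prime_divs (romanov_poly g ?e)"
        then show "T \<in> TT \<and> ?o T dvd ?e"
          using e poly_ord_props(4)[of ?e T g] by (auto simp: TT_def intro!: bexI[of _ ?e])
      qed
    qed (rule Z_nonneg)
    finally show ?thesis .
  qed
  have D0: "D 0 = 0"
  proof -
    have "{T. T \<in> TT \<and> ?o T \<le> 0} = {}" using TT_ord(1) by fastforce
    then show ?thesis unfolding D_def by (simp only: sum.empty)
  qed
  \<comment> \<open>Every set counted in \<open>D x\<close> is a subset of \<open>U x\<close>, and
    the sum over all subsets folds back into a product.\<close>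
  have D_prod: "D x \<le> (\<Prod>P\<in>U x. 1 + ?z P)" if "x > 0" for x
  proof -
    have "D x \<le> (\<Sum>T\<in>Pow (U x). ?Z T)"
      unfolding D_def
    proof (rule sum_mono2)
      show "finite (Pow (U x))" using U_props(1)[OF that] by simp
      show "{T. T \<in> TT \<and> ?o T \<le> x} \<subseteq> Pow (U x)"
      proof clarify
        fix T P assume T: "T \<in> TT" "?o T \<le> x" "P \<in> T"
        then have "?o T \<in> {1..x}" "P \<in> prime_divs (romanov_poly g (?o T))" using TT_ord[of T] by auto
        then show "P \<in> U x" unfolding U_def by blast
      qed
    qed (rule Z_nonneg)
    also have "\<dots> = (\<Prod>P\<in>U x. ?z P + 1)" using U_props(1)[OF that] by (subst prod_add) auto
    finally show ?thesis by (simp add: add.commute)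
  qed
  have deg2: "\<delta> * rad_bound x \<ge> 2" if "x > 0" for x
  proof -
    have "1 * 2 \<le> \<delta> * rad_bound x" using \<delta> rad_bound_ge[OF that] by (intro mult_mono) auto
    then show ?thesis by simp
  qed
  have D_log: "D x \<le> 1 + exp euler_mascheroni * (ln (\<delta> * rad_bound x) / ln q)"
    and D_exp: "D x \<le> exp (\<delta> * rad_bound x / q)" if "x > 0" for x
    using D_prod[OF that] prod_one_plus_norm_le[OF U_props(1,2,3)[OF that] deg2[OF that], folded q_def]
    by linarith+
  have romanov: "(\<Sum>x=1..K. (D x - D (x - 1)) / real x) \<le>
    1 + exp euler_mascheroni * min (5 * sqrt (\<delta> / q)) (ln (6 * \<delta>) / ln q)"
    using q \<delta> D0 D_log D_exp by (rule romanov_sum_le)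
  \<comment> \<open>\<open>D x - D (x - 1)\<close> is the weight of the sets of order exactly
    \<open>x\<close>, the form required for summation by parts.\<close>
  have sum_ord: "(\<Sum>T\<in>TT. ?Z T / real (?o T)) = (\<Sum>x=1..K. (D x - D (x - 1)) / real x)"
  proof -
    have "(\<Sum>T\<in>TT. ?Z T / real (?o T)) = (\<Sum>x\<in>{1..K}. \<Sum>T\<in>{T \<in> TT. ?o T = x}. ?Z T / real (?o T))"
      using finTT TT_ord(1) by (intro sum.group[symmetric]) auto
    also have "\<dots> = (\<Sum>x\<in>{1..K}. (D x - D (x - 1)) / real x)"
    proof (intro sum.cong refl)
      fix x assume x: "x \<in> {1..K}"
      have "{T. T \<in> TT \<and> ?o T \<le> x} = {T. T \<in> TT \<and> ?o T \<le> x - 1} \<union> {T \<in> TT. ?o T = x}"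
        using x by auto
      then have "D x = D (x - 1) + (\<Sum>T\<in>{T \<in> TT. ?o T = x}. ?Z T)"
        unfolding D_def using finTT x by (subst sum.union_disjoint[symmetric]) auto
      moreover have "(\<Sum>T\<in>{T \<in> TT. ?o T = x}. ?Z T / real (?o T)) = (\<Sum>T\<in>{T \<in> TT. ?o T = x}. ?Z T) / real x"
        by (simp add: sum_divide_distrib)
      ultimately show "(\<Sum>T\<in>{T \<in> TT. ?o T = x}. ?Z T / real (?o T)) = (D x - D (x - 1)) / real x" by simp
    qed
    finally show ?thesis .
  qed
  have "(\<Sum>i<K. \<Sum>j\<in>{..<K} - {i}. \<Prod>P\<in>prime_divs (g ^ i - g ^ j). 1 + ?z P) \<le>
    (\<Sum>i<K. \<Sum>j\<in>{..<K} - {i}. \<Sum>T | T \<in> TT \<and> ?o T dvd dist i j. ?Z T)"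
    by (intro sum_mono pair) auto
  also have "\<dots> = (\<Sum>i<K. \<Sum>j\<in>{..<K} - {i}. \<Sum>T\<in>TT. if ?o T dvd dist i j then ?Z T else 0)"
    using finTT by (simp add: sum.inter_filter)
  also have "\<dots> = (\<Sum>i<K. \<Sum>T\<in>TT. \<Sum>j\<in>{..<K} - {i}. if ?o T dvd dist i j then ?Z T else 0)"
    by (intro sum.cong refl sum.swap)
  also have "\<dots> \<le> (\<Sum>i<K. \<Sum>T\<in>TT. real K * (?Z T / real (?o T)))"
  proof (intro sum_mono)
    fix i T assume i: "i \<in> {..<K}" and T: "T \<in> TT"
    have "(\<Sum>j\<in>{..<K} - {i}. if ?o T dvd dist i j then ?Z T else 0) =
      real (card {j \<in> {..<K} - {i}. ?o T dvd dist i j}) * ?Z T"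
      by (simp flip: sum.inter_filter)
    also have "{j \<in> {..<K} - {i}. ?o T dvd dist i j} = {j. j < K \<and> j \<noteq> i \<and> ?o T dvd (i - j) + (j - i)}"
      by (auto simp: dist_def)
    also have "real (card \<dots>) * ?Z T \<le> real K / real (?o T) * ?Z T"
      using TT_ord(1)[OF T] i by (intro mult_right_mono card_multiples_le Z_nonneg) auto
    finally show "(\<Sum>j\<in>{..<K} - {i}. if ?o T dvd dist i j then ?Z T else 0) \<le> real K * (?Z T / real (?o T))"
      by simp
  qed
  also have "\<dots> = real K ^ 2 * (\<Sum>T\<in>TT. ?Z T / real (?o T))"
    by (simp only: sum_distrib_left[symmetric] sum_constant card_lessThan power2_eq_square mult.assoc)
  also have "\<dots> \<le> real K ^ 2 * (1 + exp euler_mascheroni * min (5 * sqrt (\<delta> / q)) (ln (6 * \<delta>) / ln q))"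
    unfolding sum_ord by (intro mult_left_mono romanov) auto
  finally show ?thesis .
qed

section \<open>Moments of the number of representations and the final bounds\<close>

lemma card_irreducible:
  "card {h :: 'a::{finite,field} poly. irreducible h \<and> degree h = n} = (CARD('a) - 1) * irr_count TYPE('a) n"
proof -
  let ?M = "{P \<in> monic_irr :: 'a poly set. degree P = n}" and ?I = "{h :: 'a poly. irreducible h \<and> degree h = n}"
  have irr: "irreducible (smult c h) \<longleftrightarrow> irreducible h" if "c \<noteq> 0" for c and h :: "'a poly"
    using that irreducible_mult_unit_left[of "[:c:]" h] by (simp add: is_unit_iff_degree)
  have "bij_betw (\<lambda>(c, P). smult c P) ((UNIV - {0}) \<times> ?M) ?I"
  proof (rule bij_betw_byWitness[where f' = "\<lambda>h. (lead_coeff h, smult (inverse (lead_coeff h)) h)"])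
    show "(\<lambda>(c, P). smult c P) ` ((UNIV - {0}) \<times> ?M) \<subseteq> ?I"
      by (auto simp: irr monic_irr_def)
    show "(\<lambda>h. (lead_coeff h, smult (inverse (lead_coeff h)) h)) ` ?I \<subseteq> (UNIV - {0}) \<times> ?M"
    proof clarify
      fix h :: "'a poly" assume h: "irreducible h"
      then have "lead_coeff h \<noteq> 0" by auto
      with h show "lead_coeff h \<in> UNIV - {0} \<and> smult (inverse (lead_coeff h)) h \<in> {P \<in> monic_irr. degree P = degree h}"
        by (simp add: monic_irr_def irr)
    qed
    show "\<forall>h\<in>?I. (\<lambda>(c, P). smult c P) (lead_coeff h, smult (inverse (lead_coeff h)) h) = h"
    proof
      fix h assume "h \<in> ?I"
      then have "lead_coeff h \<noteq> 0" by auto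
      then show "(\<lambda>(c, P). smult c P) (lead_coeff h, smult (inverse (lead_coeff h)) h) = h" by simp
    qed
  qed (auto simp: monic_irr_def)
  then have "card ?I = card ((UNIV - {0 :: 'a}) \<times> ?M)" by (simp add: bij_betw_same_card)
  then show ?thesis by (simp add: card_cartesian_product irr_count_def card_Diff_singleton)
qed

text \<open>The squares count pairs \<open>i\<close>, \<open>j\<close> representing the same
  \<open>f\<close>; then \<open>h = f - g ^ i\<close> and \<open>h + (g ^ i - g ^ j)\<close> are
  both irreducible. The diagonal costs \<open>card I\<close> for each \<open>i\<close>; off the
  diagonal the shift is nonzero and the averaged sieve bound applies.\<close>

lemma sum_square_representations_le:
  fixes g :: "'a::{finite,field} poly" and n K :: nat
  defines "q \<equiv> real CARD('a)" and "\<delta> \<equiv> real (degree g)"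
    and "I \<equiv> {h :: 'a poly. irreducible h \<and> degree h = n}"
  assumes g: "degree g > 0" and n: "n > 0" and F: "finite F"
  shows "(\<Sum>f\<in>F. real (card {k. k < K \<and> f - g ^ k \<in> I}) ^ 2) \<le>
    (q - 1) * q ^ n * (real K / real n + 8 * (q / (q - 1)) *
      (1 + exp euler_mascheroni * min (5 * sqrt (\<delta> / q)) (ln (6 * \<delta>) / ln q)) * (real K ^ 2 / real n ^ 2))"
proof -
  let ?E = "1 + exp euler_mascheroni * min (5 * sqrt (\<delta> / q)) (ln (6 * \<delta>) / ln q)"
  let ?W = "\<lambda>i j. \<Prod>P\<in>prime_divs (g ^ i - g ^ j). 1 + 1 / q ^ degree P"
  have q: "q \<ge> 2" using card_field_ge_2[where 'a='a] by (simp add: q_def)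
  have finI: "finite I" by (rule finite_subset[OF _ finite_degree_eq[of n]]) (auto simp: I_def)
  have card_r: "real (card {k. k < K \<and> f - g ^ k \<in> I}) = (\<Sum>k<K. of_bool (f - g ^ k \<in> I))" for f
  proof -
    have "{k. k < K \<and> f - g ^ k \<in> I} = {..<K} \<inter> {k. f - g ^ k \<in> I}" by auto
    then show ?thesis by simp
  qed
  have sq: "real (card {k. k < K \<and> f - g ^ k \<in> I}) ^ 2 =
      (\<Sum>i<K. \<Sum>j<K. of_bool (f - g ^ i \<in> I \<and> f - g ^ j \<in> I))" for f
    unfolding card_r power2_eq_square sum_product by (intro sum.cong refl) simp
  have cnt: "(\<Sum>f\<in>F. of_bool (f - g ^ i \<in> I \<and> f - g ^ j \<in> I)) \<le> real (card {h \<in> I. h + (g ^ i - g ^ j) \<in> I})"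
    for i j
  proof -
    have "(\<Sum>f\<in>F. of_bool (f - g ^ i \<in> I \<and> f - g ^ j \<in> I)) = real (card (F \<inter> {f. f - g ^ i \<in> I \<and> f - g ^ j \<in> I}))"
      using F by simp
    also have "\<dots> \<le> real (card {h \<in> I. h + (g ^ i - g ^ j) \<in> I})"
    proof (intro of_nat_mono card_inj_on_le)
      show "inj_on (\<lambda>f. f - g ^ i) (F \<inter> {f. f - g ^ i \<in> I \<and> f - g ^ j \<in> I})" by (auto simp: inj_on_def)
      show "(\<lambda>f. f - g ^ i) ` (F \<inter> {f. f - g ^ i \<in> I \<and> f - g ^ j \<in> I}) \<subseteq> {h \<in> I. h + (g ^ i - g ^ j) \<in> I}"
        by auto
    qed (use finI in simp)
    finally show ?thesis .
  qed
  have diag: "real (card {h \<in> I. h + (g ^ i - g ^ i) \<in> I}) \<le> (q - 1) * q ^ n / real n" for i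
  proof -
    have "real (n * irr_count TYPE('a) n) \<le> real (CARD('a) ^ n)"
      by (intro of_nat_mono irr_count_upper n)
    then have "real (irr_count TYPE('a) n) \<le> q ^ n / real n" using n by (simp add: q_def field_simps)
    then have "(q - 1) * real (irr_count TYPE('a) n) \<le> (q - 1) * (q ^ n / real n)"
      using q by (intro mult_left_mono) auto
    moreover have "real (card I) = (q - 1) * real (irr_count TYPE('a) n)"
      using card_field_ge_2[where 'a='a] unfolding I_def card_irreducible by (simp add: q_def of_nat_diff)
    ultimately show ?thesis by simp
  qed
  have off: "real (card {h \<in> I. h + (g ^ i - g ^ j) \<in> I}) \<le>
      (q - 1) * q ^ n * (8 * (q / (q - 1)) / real n ^ 2) * ?W i j" if "i \<noteq> j" for i j
  proof -
    have "g \<noteq> 0" using g by auto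
    then have "degree (g ^ i) \<noteq> degree (g ^ j)" using that g by (simp add: degree_power_eq)
    then have "g ^ i - g ^ j \<noteq> 0" by auto
    note le = card_irreducible_pairs_le[OF this n, folded q_def]
    have alg: "s * (8 * t / u * v * w) = s * t * (8 * v / u) * w" for s t u v w :: real by simp
    have "{h \<in> I. h + (g ^ i - g ^ j) \<in> I} = {h. irreducible h \<and> degree h = n \<and>
      irreducible (h + (g ^ i - g ^ j)) \<and> degree (h + (g ^ i - g ^ j)) = n}"
      by (auto simp: I_def)
    with le show ?thesis by (simp only: alg)
  qed
  have "(\<Sum>f\<in>F. real (card {k. k < K \<and> f - g ^ k \<in> I}) ^ 2) =
      (\<Sum>f\<in>F. \<Sum>i<K. \<Sum>j<K. of_bool (f - g ^ i \<in> I \<and> f - g ^ j \<in> I))"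
    by (simp only: sq)
  also have "\<dots> = (\<Sum>i<K. \<Sum>f\<in>F. \<Sum>j<K. of_bool (f - g ^ i \<in> I \<and> f - g ^ j \<in> I))"
    by (rule sum.swap)
  also have "\<dots> = (\<Sum>i<K. \<Sum>j<K. \<Sum>f\<in>F. of_bool (f - g ^ i \<in> I \<and> f - g ^ j \<in> I))"
    by (intro sum.cong refl sum.swap)
  also have "\<dots> \<le> (\<Sum>i<K. \<Sum>j<K. real (card {h \<in> I. h + (g ^ i - g ^ j) \<in> I}))"
    by (intro sum_mono cnt)
  also have "\<dots> \<le> (\<Sum>i<K. (q - 1) * q ^ n / real n +
      (q - 1) * q ^ n * (8 * (q / (q - 1)) / real n ^ 2) * (\<Sum>j\<in>{..<K} - {i}. ?W i j))"
  proof (intro sum_mono)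
    fix i assume i: "i \<in> {..<K}"
    have "(\<Sum>j<K. real (card {h \<in> I. h + (g ^ i - g ^ j) \<in> I})) =
      real (card {h \<in> I. h + (g ^ i - g ^ i) \<in> I}) + (\<Sum>j\<in>{..<K} - {i}. real (card {h \<in> I. h + (g ^ i - g ^ j) \<in> I}))"
      using i by (intro sum.remove) auto
    also have "\<dots> \<le> (q - 1) * q ^ n / real n +
      (\<Sum>j\<in>{..<K} - {i}. (q - 1) * q ^ n * (8 * (q / (q - 1)) / real n ^ 2) * ?W i j)"
      by (intro add_mono sum_mono off diag) auto
    finally show "(\<Sum>j<K. real (card {h \<in> I. h + (g ^ i - g ^ j) \<in> I})) \<le> (q - 1) * q ^ n / real n +
      (q - 1) * q ^ n * (8 * (q / (q - 1)) / real n ^ 2) * (\<Sum>j\<in>{..<K} - {i}. ?W i j)"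
      by (simp only: sum_distrib_left)
  qed
  also have "\<dots> = real K * ((q - 1) * q ^ n / real n) +
      (q - 1) * q ^ n * (8 * (q / (q - 1)) / real n ^ 2) * (\<Sum>i<K. \<Sum>j\<in>{..<K} - {i}. ?W i j)"
    by (simp add: sum.distrib flip: sum_distrib_left)
  also have "\<dots> \<le> real K * ((q - 1) * q ^ n / real n) +
      (q - 1) * q ^ n * (8 * (q / (q - 1)) / real n ^ 2) * (real K ^ 2 * ?E)"
    using q romanov_average[OF g, of K, folded q_def \<delta>_def]
    by (intro add_left_mono mult_left_mono) auto
  also have "\<dots> = (q - 1) * q ^ n * (real K / real n + 8 * (q / (q - 1)) * ?E * (real K ^ 2 / real n ^ 2))"
    by (simp add: distrib_left mult_ac)
  finally show ?thesis .
qed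

theorem theorem2:
  fixes g :: "'a::{finite,field} poly" and n :: nat
  assumes "degree g \<ge> 1" and "n \<ge> 1"
  defines "q \<equiv> real CARD('a)" and "\<delta> \<equiv> real (degree g)"
  shows "(1 + \<delta> / real n) / \<delta> \<ge> rtilde n g \<and>
    rtilde n g >
      (1 - 2 * q powr (- real n / 2))\<^sup>2 * inverse (1 + \<delta> / real n) /
      (\<delta> + 8 * (q / (q - 1)) *
        (1 + exp euler_mascheroni * min (5 * sqrt (\<delta> / q)) (ln (6 * \<delta>) / ln q)))"
proof -
  define I where "I = {h :: 'a poly. irreducible h \<and> degree h = n}"
  define F where "F = {f :: 'a poly. degree f = n \<and> (\<exists>h k. irreducible h \<and> degree h = n \<and> f = h + g ^ k)}"
  define N where "N = real (irr_count TYPE('a) n)"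
  let ?d = "degree g"
  have q: "q \<ge> 2" using card_field_ge_2[where 'a='a] by (simp add: q_def)
  have d: "?d > 0" and n: "n > 0" and \<delta>: "\<delta> > 0" using assms(1,2) by (auto simp: \<delta>_def)
  have g0: "g \<noteq> 0" using d by auto
  have deg_gk: "degree (g ^ k) = k * ?d" for k using g0 by (simp add: degree_power_eq)
  have finI: "finite I" by (rule finite_subset[OF _ finite_degree_eq[of n]]) (auto simp: I_def)
  have finF: "finite F" by (rule finite_subset[OF _ finite_degree_eq[of n]]) (auto simp: F_def)
  have cardI: "real (card I) = (q - 1) * N"
    using card_field_ge_2[where 'a='a] unfolding I_def card_irreducible by (simp add: q_def N_def of_nat_diff)
  have rt: "rtilde n g = real (card F) / ((q - 1) * q ^ n)"
    by (simp add: rtilde_def Rtilde_def F_def q_def)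
  have Q: "(q - 1) * q ^ n > 0" using q by simp
  have "real (n * irr_count TYPE('a) n) \<le> real (CARD('a) ^ n)"
    by (intro of_nat_mono irr_count_upper n)
  then have N_upper: "N \<le> q ^ n / real n" using n by (simp add: q_def N_def field_simps)
  have upper: "rtilde n g \<le> (1 + \<delta> / real n) / \<delta>"
  proof -
    have "F \<subseteq> (\<lambda>(h, k). h + g ^ k) ` (I \<times> {..n div ?d})"
    proof
      fix f assume "f \<in> F"
      then obtain h k where f: "f = h + g ^ k" "h \<in> I" "degree f = n" by (auto simp: F_def I_def)
      \<comment> \<open>A power of degree above \<open>n\<close> would impose its degree on
        \<open>f\<close>, so only \<open>n div ?d + 1\<close> exponents remain.\<close>
      have "k * ?d \<le> n"
      proof (rule ccontr)
        assume "\<not> k * ?d \<le> n"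
        then have "degree h < degree (g ^ k)" using f(2) by (simp add: I_def deg_gk)
        then have "degree f = degree (g ^ k)" unfolding f(1) by (rule degree_add_eq_right)
        with f(3) \<open>\<not> k * ?d \<le> n\<close> show False by (simp add: deg_gk)
      qed
      then have "k \<le> n div ?d" using d by (simp add: less_eq_div_iff_mult_less_eq)
      with f(1,2) show "f \<in> (\<lambda>(h, k). h + g ^ k) ` (I \<times> {..n div ?d})" by auto
    qed
    then have "card F \<le> card ((\<lambda>(h, k). h + g ^ k) ` (I \<times> {..n div ?d}))"
      using finI by (intro card_mono) auto
    also have "\<dots> \<le> card (I \<times> {..n div ?d})" using finI by (intro card_image_le) auto
    also have "\<dots> = card I * (n div ?d + 1)" by (simp add: card_cartesian_product)
    finally have "real (card F) \<le> real (card I * (n div ?d + 1))" by (rule of_nat_mono)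
    also have "\<dots> = (q - 1) * N * (real (n div ?d) + 1)" by (simp add: cardI algebra_simps)
    also have "\<dots> \<le> (q - 1) * (q ^ n / real n) * (real n / \<delta> + 1)"
      using q N_upper of_nat_div_le_of_nat[of n ?d, where 'a=real]
      by (intro mult_mono add_mono) (auto simp: \<delta>_def N_def)
    also have "\<dots> = ((1 + \<delta> / real n) / \<delta>) * ((q - 1) * q ^ n)"
      using \<delta> n by (simp add: field_simps)
    finally show ?thesis unfolding rt using Q by (simp add: pos_divide_le_eq)
  qed
  \<comment> \<open>This is n / deg g rounded up. It is small enough that every \<open>k < K\<close>
    has \<open>k * ?d < n\<close> strictly, and large enough that
    \<open>real n / real K \<le> \<delta>\<close>.\<close>
  define K where "K = (n - 1) div ?d + 1"
  define E where "E = 1 + exp euler_mascheroni * min (5 * sqrt (\<delta> / q)) (ln (6 * \<delta>) / ln q)"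
  define c where "c = 8 * (q / (q - 1)) * E"
  define p where "p = real n * N / q ^ n"
  have "\<delta> \<ge> 1" using d by (simp add: \<delta>_def)
  then have "ln (6 * \<delta>) / ln q \<ge> 0" using q by (intro divide_nonneg_nonneg) auto
  then have "E \<ge> 0" using q \<delta> by (auto simp: E_def intro!: add_nonneg_nonneg)
  then have c: "c \<ge> 0" using q by (simp add: c_def)
  have K: "k * ?d < n" if "k < K" for k
  proof -
    have "k \<le> (n - 1) div ?d" using that by (simp add: K_def)
    then have "k * ?d \<le> n - 1" using d by (simp add: less_eq_div_iff_mult_less_eq)
    then show ?thesis using n by linarith
  qed
  have K_pos: "real K > 0" by (simp add: K_def)
  have "n \<le> K * ?d"
  proof -
    have "n - 1 < ((n - 1) div ?d + 1) * ?d" using d dividend_less_div_times[of ?d "n - 1"] by simp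
    then show ?thesis by (simp add: K_def)
  qed
  then have "real n \<le> real (K * ?d)" by (rule of_nat_mono)
  then have nK: "real n / real K \<le> \<delta>" using K_pos by (simp add: \<delta>_def field_simps)
  define r where "r = (\<lambda>f. real (card {k. k < K \<and> f - g ^ k \<in> I}))"
  have sum_r: "(\<Sum>f\<in>F. r f) = real K * ((q - 1) * N)"
  proof -
    have "r f = (\<Sum>k<K. of_bool (f - g ^ k \<in> I))" for f
    proof -
      have "{k. k < K \<and> f - g ^ k \<in> I} = {..<K} \<inter> {k. f - g ^ k \<in> I}" by auto
      then show ?thesis by (simp add: r_def)
    qed
    then have "(\<Sum>f\<in>F. r f) = (\<Sum>f\<in>F. \<Sum>k<K. of_bool (f - g ^ k \<in> I))" by simp
    also have "\<dots> = (\<Sum>k<K. \<Sum>f\<in>F. of_bool (f - g ^ k \<in> I))" by (rule sum.swap)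
    also have "\<dots> = (\<Sum>k<K. real (card I))"
    proof (intro sum.cong refl)
      fix k assume k: "k \<in> {..<K}"
      have "F \<inter> {f. f - g ^ k \<in> I} = (\<lambda>h. h + g ^ k) ` I"
      proof (intro equalityI subsetI)
        fix f assume "f \<in> F \<inter> {f. f - g ^ k \<in> I}"
        then show "f \<in> (\<lambda>h. h + g ^ k) ` I" by (intro image_eqI[of _ _ "f - g ^ k"]) auto
      next
        fix f assume "f \<in> (\<lambda>h. h + g ^ k) ` I"
        then obtain h where h: "f = h + g ^ k" "h \<in> I" by auto
        \<comment> \<open>The sum keeps the degree of \<open>h\<close>, so every pair of
          \<open>h\<close> and \<open>k < K\<close> lands in \<open>F\<close> and the first moment
          is exact.\<close>
        have "degree (g ^ k) < degree h" using K[of k] k h(2) by (simp add: deg_gk I_def)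
        then have "degree f = degree h" unfolding h(1) by (rule degree_add_eq_left)
        then show "f \<in> F \<inter> {f. f - g ^ k \<in> I}" using h by (auto simp: F_def I_def)
      qed
      then have "card (F \<inter> {f. f - g ^ k \<in> I}) = card I" by (simp add: card_image)
      then show "(\<Sum>f\<in>F. of_bool (f - g ^ k \<in> I)) = real (card I)" using finF by simp
    qed
    finally show ?thesis by (simp add: cardI)
  qed
  have sum_r2: "(\<Sum>f\<in>F. r f ^ 2) \<le> (q - 1) * q ^ n * (real K / real n + c * (real K ^ 2 / real n ^ 2))"
    unfolding r_def I_def c_def E_def q_def \<delta>_def by (rule sum_square_representations_le[OF d n finF])
  have "(\<Sum>f\<in>F. r f * 1) ^ 2 \<le> (\<Sum>f\<in>F. r f ^ 2) * (\<Sum>f\<in>F. 1 ^ 2)" by (rule Cauchy_Schwarz_ineq_sum)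
  then have "(real K * ((q - 1) * N)) ^ 2 \<le> (\<Sum>f\<in>F. r f ^ 2) * real (card F)" by (simp add: sum_r)
  also have "\<dots> \<le> ((q - 1) * q ^ n * (real K / real n + c * (real K ^ 2 / real n ^ 2))) * real (card F)"
    by (intro mult_right_mono sum_r2) auto
  also have "real (card F) = rtilde n g * ((q - 1) * q ^ n)" using q by (simp add: rt)
  finally have main: "(real K * ((q - 1) * N)) ^ 2 \<le>
    ((q - 1) * q ^ n * (real K / real n + c * (real K ^ 2 / real n ^ 2))) * (rtilde n g * ((q - 1) * q ^ n))" .
  have p_le: "p\<^sup>2 \<le> rtilde n g * (real n / real K + c)"
  proof -
    have N_eq: "N = p * q ^ n / real n" using n q by (simp add: p_def)
    \<comment> \<open>Dividing both sides by this square leaves \<open>K\<close> only in the ratio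
      \<open>real n / real K\<close>.\<close>
    define Z where "Z = ((q - 1) * q ^ n * real K / real n)\<^sup>2"
    have Z: "Z > 0" using q K_pos n by (simp add: Z_def)
    have lhs: "(real K * ((q - 1) * N)) ^ 2 = Z * p\<^sup>2"
      by (simp add: N_eq Z_def power2_eq_square)
    have rhs: "((q - 1) * q ^ n * (real K / real n + c * (real K ^ 2 / real n ^ 2))) * (rtilde n g * ((q - 1) * q ^ n)) =
        Z * (rtilde n g * (real n / real K + c))"
      using K_pos n by (simp add: Z_def power2_eq_square field_simps)
    have "Z * p\<^sup>2 \<le> Z * (rtilde n g * (real n / real K + c))" using main unfolding lhs rhs .
    then show ?thesis using Z by simp
  qed
  have rt_nonneg: "rtilde n g \<ge> 0" unfolding rt using Q by (intro divide_nonneg_nonneg) auto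
  have "p\<^sup>2 \<le> rtilde n g * (\<delta> + c)"
    using p_le mult_left_mono[OF add_right_mono[OF nK, of c] rt_nonneg] by linarith
  then have lower: "p\<^sup>2 / (\<delta> + c) \<le> rtilde n g" using \<delta> c by (simp add: pos_divide_le_eq)
  have p: "\<bar>1 - 2 * q powr (- real n / 2)\<bar> \<le> p" "p > 0"
    using irr_count_bounds[OF n, where 'a='a] n q by (auto simp: p_def N_def q_def)
  have "(1 - 2 * q powr (- real n / 2))\<^sup>2 \<le> p\<^sup>2"
    using p(1) by (simp add: abs_le_square_iff[symmetric])
  then have "(1 - 2 * q powr (- real n / 2))\<^sup>2 * inverse (1 + \<delta> / real n) \<le> p\<^sup>2 * inverse (1 + \<delta> / real n)"
    using \<delta> by (intro mult_right_mono) auto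
  \<comment> \<open>Strictness is obtained after passing to \<open>p > 0\<close>, because
    \<open>1 - 2 * q powr (- real n / 2)\<close> itself vanishes for n = 1 and q = 4.\<close>
  also have "\<dots> < p\<^sup>2 * 1"
  proof (rule mult_strict_left_mono)
    have "1 + \<delta> / real n > 1" using \<delta> n by simp
    then show "inverse (1 + \<delta> / real n) < 1" by (simp add: inverse_less_1_iff)
  qed (use p(2) in simp)
  finally have "(1 - 2 * q powr (- real n / 2))\<^sup>2 * inverse (1 + \<delta> / real n) / (\<delta> + c) < p\<^sup>2 / (\<delta> + c)"
    using \<delta> c by (intro divide_strict_right_mono) auto
  with lower have "(1 - 2 * q powr (- real n / 2))\<^sup>2 * inverse (1 + \<delta> / real n) / (\<delta> + c) < rtilde n g"
    by linarith
  with upper show ?thesis by (simp only: c_def E_def)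
qed

end
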